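(* Let $\Omega$ be a (one-dimensional, FLC, minimal) uniquely ergodic tiling space. Suppose that $F\in\mathcal F(\Omega)$ and that the rotation class $[\mu]$ of $F$ exists and is irrational. Then $F$ is semi-conjugate to a uniform translation on $\Omega$, via a semi-conjugacy that sends each path component of $\Omega$ to itself, if and only if $[\mu]\in\mathbb R\,dx\oplus H^1_{AN}(\Omega,\mathbb R)\subset H^1(\Omega,\mathbb R)$.
   Context: Tilings: A tile is a pair $(I,\ell)$, with $I\subset\mathbb R$ a closed bounded interval of positive length and $\ell$ a label from a finite alphabet; tiles with the same label have the same length. $(I,\ell)-s=(I-s,\ell)$. A tiling $T$ is a collection of tiles meeting only at boundaries with union $\mathbb R$; $T-s$ is obtained by translating all tiles, and $\Gamma_s(T)=T-s$. (Such tilings have finite local complexity, FLC.) $d(T,T')$ is the infimum of the $\epsilon\in(0,1)$ for which there are $|s_1|,|s_2|\le\epsilon/2$ with $T-s_1$ and $T'-s_2$ agreeing exactly on $[-\epsilon^{-1},\epsilon^{-1}]$ ($1$ if there is none). $T$ is repetitive if for each finite pattern $P$ of $T$ there is $L_P$ such that every interval of length $L_P$ in $T$ contains a copy of $P$. A tiling space $\Omega$ is the closure of the translation orbit $\{T-s\}$ of a repetitive non-periodic tiling; it is compact, minimal under $\Gamma$, and its path components are the translation orbits. Uniquely ergodic means that $(\Omega,\Gamma)$ has a unique invariant probability measure. The orbit of a reference tiling $T\in\Omega$ is identified with $\mathbb R$ by $T-x\leftrightarrow x$. Pattern equivariance and cohomology: A continuous $\phi:\mathbb R\to\mathbb R$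 is pattern equivariant (PE) with radius $R$ with respect to $T$ if $\phi(x_1)=\phi(x_2)$ whenever $T-x_1$ and $T-x_2$ agree exactly on $[-R,R]$; it is strongly PE (sPE) if this holds for some $R>0$, and weakly PE (wPE) if it is a uniform limit of sPE functions. A continuous $G:\Omega\to\mathbb R$ is sPE if $x\mapsto G(T-x)$ is sPE with respect to $T$ (for one, equivalently every, $T\in\Omega$). An sPE 1-form with respect to $T$ is $g(x)\,dx$ with $g$ sPE. $H^1(\Omega,\mathbb R)$ is $\{\text{sPE 1-forms}\}/d\{\text{sPE functions}\}$, which is isomorphic to the Čech cohomology $\check H^1(\Omega,\mathbb R)$; $[\mu]$ is the class of $\mu$, and forms with the same class are called cohomologous. A class $[\alpha]$ is asymptotically negligible if $\alpha=dg$ for some wPE function $g$; these classes form the subspace $H^1_{AN}(\Omega,\mathbb R)$. $\mathbb R\,dx$ is the line spanned by $[dx]$. Maps: $\mathcal F(\Omega)$ is the set of homeomorphisms $F:\Omega\to\Omega$, homotopic to the identity, such that the displacement $\Phi:\Omega\to\mathbb R$, defined by $F(T)=T-\Phi(T)$, is sPE. For a reference tiling $T$, $f_T:\mathbb R\to\mathbb R$ is given by $F(T-x)=T-f_T(x)$. Rotation forms: An sPE 1-form $\mu$ (with respect to a reference tiling $T$) is a rotation form for $F$ if there is $R$ such that, for all $x_1,x_2\in\mathbb R$ for which $T-x_1$ and $T-x_2$ agree on the ball of radius $R$ about the origin, and all integers $n_\pm$ with $n_-<\int_{x_1}^{x_2}\mu<n_+$, the point $x_2$ is strictly between $f_T^{n_-}(x_1)$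 and $f_T^{n_+}(x_1)$. Any form cohomologous to a rotation form is a rotation form, and $[\mu]$ is then called a rotation class. Shape change and irrationality: Let $\mu$ be a positive sPE 1-form of radius $R$ with respect to $T$. Relabel (collar) the tiles of $T$ so that the label of each tile records the pattern of $T$ around it out to distance $R$; this does not change the space up to translation-commuting homeomorphism. Let $T'$ be obtained by keeping labels and moving each vertex $x$ of $T$ to $\int_0^x\mu$. The orbit closure $\Omega_\mu$ of $T'$ is the shape change of $\Omega$ by $\mu$, and $T-x\mapsto T'-\int_0^x\mu$ extends to a homeomorphism $S:\Omega\to\Omega_\mu$. Shape changes by negative forms are defined similarly (and reverse orientation). A class is irrational if it is represented by a positive (or negative) sPE 1-form $\mu$ such that $\Omega_\mu$ is minimal under the action of $\Gamma_1$ (translation by $1$); this does not depend on the choice of representative. Semi-conjugacy: $F$ on $\Omega$ is semi-conjugate to $F'$ on $\Omega'$, via the semi-conjugacy $H$, if $H:\Omega\to\Omega'$ is a continuous map with $F'\circ H=H\circ F$. A uniform translation on $\Omega$ is a map $\Gamma_\rho$ with $\rho\ne0$. *)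

theory Defs
  imports "HOL-Analysis.Analysis" "HOL-Probability.Probability"
begin

section \<open>Tilings of the line\<close>

type_synonym 'l tile = "real set \<times> 'l"
type_synonym 'l tiling = "'l tile set"

text \<open>The finite alphabet is the set of labels that occur; it is not fixed in advance, and
  the type of labels may be infinite.\<close>

definition is_tiling :: "'l tiling \<Rightarrow> bool" where
  "is_tiling T \<longleftrightarrow>
     (\<forall>(I, l) \<in> T. \<exists>a b. a < b \<and> I = {a..b}) \<and>
     finite (snd ` T) \<and>
     (\<forall>(I, l) \<in> T. \<forall>(J, l') \<in> T. l = l' \<longrightarrow> measure lebesgue I = measure lebesgue J) \<and>
     (\<forall>t \<in> T. \<forall>t' \<in> T. t \<noteq> t' \<longrightarrow> interior (fst t) \<inter> interior (fst t') = {}) \<and>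
     \<Union> (fst ` T) = UNIV"

definition tile_translate :: "real \<Rightarrow> 'l tile \<Rightarrow> 'l tile" where
  "tile_translate s t = ((\<lambda>x. x - s) ` fst t, snd t)"

text \<open>\<open>translate s T\<close> is $T - s$, that is, $\Gamma_s(T)$; it is also used for patterns.\<close>

definition translate :: "real \<Rightarrow> 'l tiling \<Rightarrow> 'l tiling" where
  "translate s T = tile_translate s ` T"

text \<open>Agreeing on \<open>K\<close> means having the same tiles among those that meet \<open>K\<close>, tiles that
  only touch \<open>K\<close> included. Comparing only the portions of the tiles inside \<open>K\<close> would
  change radii by a bounded amount, and neither the topology nor any notion below.\<close>

definition patch :: "'l tiling \<Rightarrow> real set \<Rightarrow> 'l tiling" where
  "patch T K = {t \<in> T. fst t \<inter> K \<noteq> {}}"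

definition agree_on :: "real set \<Rightarrow> 'l tiling \<Rightarrow> 'l tiling \<Rightarrow> bool" where
  "agree_on K T T' \<longleftrightarrow> patch T K = patch T' K"

definition tiling_dist :: "'l tiling \<Rightarrow> 'l tiling \<Rightarrow> real" where
  "tiling_dist T T' = Inf (insert 1 {\<epsilon>. 0 < \<epsilon> \<and> \<epsilon> < 1 \<and>
     (\<exists>s1 s2. \<bar>s1\<bar> \<le> \<epsilon> / 2 \<and> \<bar>s2\<bar> \<le> \<epsilon> / 2 \<and>
        agree_on {- (1 / \<epsilon>)..1 / \<epsilon>} (translate s1 T) (translate s2 T'))})"

definition tiling_topology :: "'l tiling topology" where
  "tiling_topology = Metric_space.mtopology {T. is_tiling T} tiling_dist"

text \<open>\<open>tiling_topology\<close> is the topology of a genuine metric on the set of all tilings.\<close>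

lemma translate_translate [simp]: "translate s (translate t T) = translate (s + t) T"
  by (simp add: translate_def tile_translate_def image_image diff_diff_eq add.commute[of s t])

lemma translate_0 [simp]: "translate 0 T = T"
  by (simp add: translate_def tile_translate_def)

lemma patch_translate: "patch (translate s T) K = translate s (patch T ((\<lambda>x. x + s) ` K))"
proof -
  have "(\<lambda>x. x - s) ` I \<inter> K \<noteq> {} \<longleftrightarrow> I \<inter> (\<lambda>x. x + s) ` K \<noteq> {}" for I
    by (force simp: image_iff algebra_simps)
  then have "{t \<in> T. fst (tile_translate s t) \<inter> K \<noteq> {}} = patch T ((\<lambda>x. x + s) ` K)"
    unfolding patch_def tile_translate_def fst_conv by (simp only:)
  moreover have "patch (translate s T) K = translate s {t \<in> T. fst (tile_translate s t) \<inter> K \<noteq> {}}"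
    unfolding patch_def translate_def by blast
  ultimately show ?thesis by (simp only:)
qed

lemma agree_on_translate:
  assumes "agree_on K T T'" and "(\<lambda>x. x + s) ` K' \<subseteq> K"
  shows "agree_on K' (translate s T) (translate s T')"
proof -
  have "patch T ((\<lambda>x. x + s) ` K') = {t \<in> patch T K. fst t \<inter> (\<lambda>x. x + s) ` K' \<noteq> {}}" for T :: "'a tiling"
    using assms(2) by (auto simp: patch_def)
  then show ?thesis
    using assms(1) by (simp add: agree_on_def patch_translate)
qed

definition within_dist :: "real \<Rightarrow> 'l tiling \<Rightarrow> 'l tiling \<Rightarrow> bool" where
  "within_dist \<epsilon> T T' \<longleftrightarrow> 0 < \<epsilon> \<and> \<epsilon> < 1 \<and>
     (\<exists>s1 s2. \<bar>s1\<bar> \<le> \<epsilon> / 2 \<and> \<bar>s2\<bar> \<le> \<epsilon> / 2 \<and>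
        agree_on {- (1 / \<epsilon>)..1 / \<epsilon>} (translate s1 T) (translate s2 T'))"

lemma tiling_dist_within: "tiling_dist T T' = Inf (insert 1 {\<epsilon>. within_dist \<epsilon> T T'})"
  by (simp add: tiling_dist_def within_dist_def)

lemma bdd_below_within_dist: "bdd_below (insert 1 {\<epsilon>. within_dist \<epsilon> T T'})"
  by (rule bdd_belowI[of _ 0]) (auto simp: within_dist_def)

lemma tiling_dist_le: "within_dist \<epsilon> T T' \<Longrightarrow> tiling_dist T T' \<le> \<epsilon>"
  unfolding tiling_dist_within using bdd_below_within_dist by (intro cInf_lower) auto

lemma tiling_dist_le1: "tiling_dist T T' \<le> 1"
  unfolding tiling_dist_within using bdd_below_within_dist by (intro cInf_lower) auto

lemma tiling_dist_ge0: "0 \<le> tiling_dist T T'"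
  unfolding tiling_dist_within by (rule cInf_greatest) (auto simp: within_dist_def)

lemma tiling_dist_less:
  assumes "tiling_dist T T' < e" "e \<le> 1" obtains \<epsilon> where "within_dist \<epsilon> T T'" "\<epsilon> < e"
  using assms cInf_lessD[of "insert 1 {\<epsilon>. within_dist \<epsilon> T T'}" e] unfolding tiling_dist_within by auto

lemma within_dist_sym: "within_dist \<epsilon> T T' \<longleftrightarrow> within_dist \<epsilon> T' T"
  unfolding within_dist_def agree_on_def by metis

lemma within_dist_triangle:
  assumes "within_dist e T T'" "within_dist e' T' T''" "e + e' < 1"
  shows "within_dist (e + e') T T''"
proof -
  obtain s t where 1: "\<bar>s\<bar> \<le> e / 2" "\<bar>t\<bar> \<le> e / 2" "agree_on {- (1 / e)..1 / e} (translate s T) (translate t T')" and p: "0 < e"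
    using assms(1) by (auto simp: within_dist_def)
  obtain s' t' where 2: "\<bar>s'\<bar> \<le> e' / 2" "\<bar>t'\<bar> \<le> e' / 2" "agree_on {- (1 / e')..1 / e'} (translate s' T') (translate t' T'')" and p': "0 < e'"
    using assms(2) by (auto simp: within_dist_def)
  have key: "1 / (a + b) + b / 2 \<le> 1 / a" if "0 < a" "0 < b" "a + b < 1" for a b :: real
  proof -
    have "a * (a + b) \<le> 1 * 1" using that by (intro mult_mono) auto
    then have "b / 2 \<le> b / (a * (a + b))"
      using that by (intro divide_left_mono) auto
    also have "\<dots> = 1 / a - 1 / (a + b)" using that by (simp add: field_simps)
    finally show ?thesis by simp
  qed
  let ?K = "{- (1 / (e + e'))..1 / (e + e')}"
  have "agree_on ?K (translate s' (translate s T)) (translate s' (translate t T'))"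
    using key[OF p p' assms(3)] 2(1) by (intro agree_on_translate[OF 1(3)]) (auto simp: abs_le_iff)
  moreover have "agree_on ?K (translate t (translate s' T')) (translate t (translate t' T''))"
    using key[OF p' p] assms(3) 1(2) by (intro agree_on_translate[OF 2(3)]) (auto simp: abs_le_iff add.commute)
  ultimately have "agree_on ?K (translate (s' + s) T) (translate (t + t') T'')"
    by (simp add: agree_on_def add.commute)
  moreover have "\<bar>s' + s\<bar> \<le> (e + e') / 2" "\<bar>t + t'\<bar> \<le> (e + e') / 2"
    using 1(1,2) 2(1,2) abs_triangle_ineq[of s' s] abs_triangle_ineq[of t t'] by (simp_all add: field_simps)
  ultimately show ?thesis using p p' assms(3) unfolding within_dist_def by auto
qed

lemma tiling_triangle: "tiling_dist T T'' \<le> tiling_dist T T' + tiling_dist T' T''"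
proof (rule field_le_epsilon)
  fix d :: real assume d: "0 < d"
  show "tiling_dist T T'' \<le> tiling_dist T T' + tiling_dist T' T'' + d"
  proof (cases "tiling_dist T T' + tiling_dist T' T'' + d < 1")
    case True
    have "tiling_dist T T' + d / 2 \<le> 1" "tiling_dist T' T'' + d / 2 \<le> 1"
      using True d tiling_dist_ge0[of T T'] tiling_dist_ge0[of T' T''] by auto
    then obtain e e' where "within_dist e T T'" "e < tiling_dist T T' + d / 2"
       "within_dist e' T' T''" "e' < tiling_dist T' T'' + d / 2"
      using d tiling_dist_less[of T T' "tiling_dist T T' + d / 2"] tiling_dist_less[of T' T'' "tiling_dist T' T'' + d / 2"]
      by (metis half_gt_zero less_add_same_cancel1)
    with True show ?thesis using within_dist_triangle[of e T T' e' T''] tiling_dist_le[of "e + e'" T T''] by auto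
  next
    case False with tiling_dist_le1[of T T''] show ?thesis by linarith
  qed
qed

lemma tiling_dist_refl: "tiling_dist T T = 0"
proof -
  have "tiling_dist T T \<le> 0 + d" if "0 < d" for d
  proof -
    have "within_dist (min d (1/2)) T T" using that by (auto simp: within_dist_def agree_on_def intro!: exI[of _ 0])
    from tiling_dist_le[OF this] show ?thesis by simp
  qed
  then have "tiling_dist T T \<le> 0" by (rule field_le_epsilon)
  with tiling_dist_ge0[of T T] show ?thesis by simp
qed

lemma is_tiling_disjoint:
  "is_tiling T \<Longrightarrow> t \<in> T \<Longrightarrow> t' \<in> T \<Longrightarrow> t \<noteq> t' \<Longrightarrow> interior (fst t) \<inter> interior (fst t') = {}"
  unfolding is_tiling_def by blast

lemma tiling_zero_sub:
  assumes T: "is_tiling T" and T': "is_tiling T'" and 0: "tiling_dist T T' = 0"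
  shows "T \<subseteq> T'"
proof
  fix u assume u: "u \<in> T"
  obtain a b l where ab: "a < b" "u = ({a..b}, l)" using T u unfolding is_tiling_def by fastforce
  have *: "\<exists>d. \<bar>d\<bar> \<le> e \<and> tile_translate d u \<in> T'" if e: "0 < e" for e
  proof -
    define e' where "e' = min e (1 / (\<bar>a\<bar> + 2))"
    have "1 / (\<bar>a\<bar> + 2) \<le> 1" by simp
    then have "e' \<le> 1" unfolding e'_def by linarith
    moreover have "0 < e'" using e by (auto simp: e'_def)
    ultimately obtain \<epsilon> where cl: "within_dist \<epsilon> T T'" and lt: "\<epsilon> < e'" using tiling_dist_less[of T T' e'] 0 by auto
    then obtain s t where s: "\<bar>s\<bar> \<le> \<epsilon> / 2" "\<bar>t\<bar> \<le> \<epsilon> / 2"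
       and ag: "agree_on {- (1 / \<epsilon>)..1 / \<epsilon>} (translate s T) (translate t T')" and p: "0 < \<epsilon>" "\<epsilon> < 1"
      unfolding within_dist_def by auto
    have "\<epsilon> < 1 / (\<bar>a\<bar> + 2)" using lt by (simp add: e'_def)
    then have "\<bar>a\<bar> + 2 < 1 / \<epsilon>" using p by (simp add: field_simps)
    then have "a - s \<in> fst (tile_translate s u) \<inter> {- (1 / \<epsilon>)..1 / \<epsilon>}"
      using s p ab by (auto simp: tile_translate_def)
    moreover have "tile_translate s u \<in> translate s T" using u by (auto simp: translate_def)
    ultimately have "tile_translate s u \<in> patch (translate s T) {- (1 / \<epsilon>)..1 / \<epsilon>}"
      by (auto simp: patch_def)
    then have "tile_translate s u \<in> translate t T'"
      using ag by (auto simp: agree_on_def patch_def)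
    then have "tile_translate (- t) (tile_translate s u) \<in> translate (- t) (translate t T')"
      by (auto simp: translate_def)
    then have "tile_translate (s - t) u \<in> T'"
      by (simp add: tile_translate_def image_image algebra_simps)
    moreover have "\<bar>s - t\<bar> \<le> e" using s lt by (auto simp: e'_def)
    ultimately show ?thesis by auto
  qed
  obtain d where d: "\<bar>d\<bar> \<le> (b - a) / 4" "tile_translate d u \<in> T'" using *[of "(b - a)/4"] ab by auto
  show "u \<in> T'"
  proof (cases "d = 0")
    case True then show ?thesis using d by (simp add: tile_translate_def)
  next
    case False
    obtain d' where d': "\<bar>d'\<bar> \<le> \<bar>d\<bar> / 2" "tile_translate d' u \<in> T'" using *[of "\<bar>d\<bar>/2"] False by auto
    have im: "(\<lambda>x. x - c) ` {a..b} = {a - c..b - c}" for c by simp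
    have "tile_translate d u \<noteq> tile_translate d' u" using d' False ab
      by (auto simp: tile_translate_def im Icc_eq_Icc)
    then have "interior {a - d..b - d} \<inter> interior {a - d'..b - d'} = {}"
      using is_tiling_disjoint[OF T' d(2) d'(2)] ab by (simp add: tile_translate_def im del: interior_atLeastAtMost_real)
    moreover have "(a + b) / 2 \<in> {a - d<..<b - d}" "(a + b) / 2 \<in> {a - d'<..<b - d'}"
      using d(1) d'(1) ab(1) by (simp_all add: abs_le_iff, linarith+)
    ultimately show ?thesis by auto
  qed
qed

lemma tiling_dist_sym: "tiling_dist T T' = tiling_dist T' T"
  by (simp add: tiling_dist_within within_dist_sym[of _ T])

lemma Metric_space_tilings: "Metric_space {T. is_tiling T} tiling_dist"
proof
  show "tiling_dist T T' = 0 \<longleftrightarrow> T = T'" if "T \<in> {T. is_tiling T}" "T' \<in> {T. is_tiling T}" for T T' :: "'a tiling"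
    using that tiling_zero_sub[of T T'] tiling_zero_sub[of T' T] tiling_dist_sym[of T T'] tiling_dist_refl[of T] by auto
qed (simp_all add: tiling_dist_ge0 tiling_triangle, rule tiling_dist_sym)

definition repetitive :: "'l tiling \<Rightarrow> bool" where
  "repetitive T \<longleftrightarrow> (\<forall>P. finite P \<and> P \<subseteq> T \<longrightarrow>
     (\<exists>L>0. \<forall>a. \<exists>s. translate s P \<subseteq> T \<and> \<Union> (fst ` translate s P) \<subseteq> {a..a + L}))"

definition periodic :: "'l tiling \<Rightarrow> bool" where
  "periodic T \<longleftrightarrow> (\<exists>s. s \<noteq> 0 \<and> translate s T = T)"

definition orbit_closure :: "'l tiling \<Rightarrow> 'l tiling set" where
  "orbit_closure T = tiling_topology closure_of (range (\<lambda>s. translate s T))"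

definition tiling_space :: "'l tiling set \<Rightarrow> bool" where
  "tiling_space \<Omega> \<longleftrightarrow>
     (\<exists>T. is_tiling T \<and> repetitive T \<and> \<not> periodic T \<and> \<Omega> = orbit_closure T)"

abbreviation top_of_tilings :: "'l tiling set \<Rightarrow> 'l tiling topology" where
  "top_of_tilings \<Omega> \<equiv> subtopology tiling_topology \<Omega>"

definition uniquely_ergodic :: "'l tiling set \<Rightarrow> bool" where
  "uniquely_ergodic \<Omega> \<longleftrightarrow>
     (\<exists>!M. space M = \<Omega> \<and> sets M = sigma_sets \<Omega> {U. openin (top_of_tilings \<Omega>) U} \<and>
           prob_space M \<and> (\<forall>s. distr M M (translate s) = M))"


section \<open>Pattern equivariance and cohomology\<close>

definition PE_radius :: "'l tiling \<Rightarrow> real \<Rightarrow> (real \<Rightarrow> real) \<Rightarrow> bool" where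
  "PE_radius T R \<phi> \<longleftrightarrow> continuous_on UNIV \<phi> \<and>
     (\<forall>x1 x2. agree_on {- R..R} (translate x1 T) (translate x2 T) \<longrightarrow> \<phi> x1 = \<phi> x2)"

definition sPE :: "'l tiling \<Rightarrow> (real \<Rightarrow> real) \<Rightarrow> bool" where
  "sPE T \<phi> \<longleftrightarrow> (\<exists>R>0. PE_radius T R \<phi>)"

definition wPE :: "'l tiling \<Rightarrow> (real \<Rightarrow> real) \<Rightarrow> bool" where
  "wPE T \<phi> \<longleftrightarrow> (\<exists>f. (\<forall>n. sPE T (f n)) \<and> uniform_limit UNIV f \<phi> sequentially)"

definition sPE_on_space :: "'l tiling set \<Rightarrow> ('l tiling \<Rightarrow> real) \<Rightarrow> bool" where
  "sPE_on_space \<Omega> G \<longleftrightarrow> continuous_map (top_of_tilings \<Omega>) euclideanreal G \<and>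
     (\<forall>T\<in>\<Omega>. sPE T (\<lambda>x. G (translate x T)))"

text \<open>The 1-form $g(x)\,dx$ is represented by its density \<open>g\<close>, so the sPE 1-forms are the
  sPE functions, and $d\phi = g\,dx$ says that \<open>\<phi>\<close> has derivative \<open>g\<close>.\<close>

definition sPE_forms :: "'l tiling \<Rightarrow> (real \<Rightarrow> real) set" where
  "sPE_forms T = {g. sPE T g}"

definition is_d :: "(real \<Rightarrow> real) \<Rightarrow> (real \<Rightarrow> real) \<Rightarrow> bool" where
  "is_d \<phi> g \<longleftrightarrow> (\<forall>x. (\<phi> has_real_derivative g x) (at x))"

definition cohomologous :: "'l tiling \<Rightarrow> ((real \<Rightarrow> real) \<times> (real \<Rightarrow> real)) set" where
  "cohomologous T = {(g, h). g \<in> sPE_forms T \<and> h \<in> sPE_forms T \<and>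
     (\<exists>\<phi>. sPE T \<phi> \<and> is_d \<phi> (\<lambda>x. h x - g x))}"

definition H1 :: "'l tiling \<Rightarrow> (real \<Rightarrow> real) set set" where
  "H1 T = sPE_forms T // cohomologous T"

definition form_class :: "'l tiling \<Rightarrow> (real \<Rightarrow> real) \<Rightarrow> (real \<Rightarrow> real) set" where
  "form_class T g = cohomologous T `` {g}"

definition H1_AN :: "'l tiling \<Rightarrow> (real \<Rightarrow> real) set set" where
  "H1_AN T = {A \<in> H1 T. \<exists>\<alpha>\<in>A. \<exists>g. wPE T g \<and> is_d g \<alpha>}"

definition dx_line :: "'l tiling \<Rightarrow> (real \<Rightarrow> real) set set" where
  "dx_line T = {form_class T (\<lambda>x. c) | c. True}"

text \<open>Addition in the quotient: the elementwise sum of two cosets is the coset of the sum.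
  The sum of two subspaces of the quotient is then the set of all sums of their elements.\<close>

definition class_add ::
    "(real \<Rightarrow> real) set \<Rightarrow> (real \<Rightarrow> real) set \<Rightarrow> (real \<Rightarrow> real) set" where
  "class_add A B = {(\<lambda>x. a x + b x) | a b. a \<in> A \<and> b \<in> B}"

definition subspace_sum ::
    "(real \<Rightarrow> real) set set \<Rightarrow> (real \<Rightarrow> real) set set \<Rightarrow> (real \<Rightarrow> real) set set" where
  "subspace_sum U V = {class_add A B | A B. A \<in> U \<and> B \<in> V}"

text \<open>Signed: \<open>form_integral g a b = - form_integral g b a\<close>.\<close>

definition form_integral :: "(real \<Rightarrow> real) \<Rightarrow> real \<Rightarrow> real \<Rightarrow> real" where
  "form_integral g a b = (LBINT x=ereal a..ereal b. g x)"


section \<open>Maps of a tiling space and their rotation forms\<close>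

definition homeos_sPE :: "'l tiling set \<Rightarrow> ('l tiling \<Rightarrow> 'l tiling) set" where
  "homeos_sPE \<Omega> = {F. homeomorphic_map (top_of_tilings \<Omega>) (top_of_tilings \<Omega>) F \<and>
     homotopic_with (\<lambda>h. True) (top_of_tilings \<Omega>) (top_of_tilings \<Omega>) F id \<and>
     (\<exists>\<Phi>. (\<forall>T\<in>\<Omega>. F T = translate (\<Phi> T) T) \<and> sPE_on_space \<Omega> \<Phi>)}"

definition orbit_map :: "('l tiling \<Rightarrow> 'l tiling) \<Rightarrow> 'l tiling \<Rightarrow> real \<Rightarrow> real" where
  "orbit_map F T x = (THE y. F (translate x T) = translate y T)"

definition int_iterate :: "(real \<Rightarrow> real) \<Rightarrow> int \<Rightarrow> real \<Rightarrow> real" where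
  "int_iterate f n = (if n \<ge> 0 then f ^^ nat n else inv f ^^ nat (- n))"

text \<open>``Strictly between'' does not order the two end points: \<open>int_iterate f n x\<close> is decreasing
  in \<open>n\<close> for an \<open>F\<close> that moves points to the left.\<close>

definition rotation_form ::
    "('l tiling \<Rightarrow> 'l tiling) \<Rightarrow> 'l tiling \<Rightarrow> (real \<Rightarrow> real) \<Rightarrow> bool" where
  "rotation_form F T \<mu> \<longleftrightarrow> sPE T \<mu> \<and>
     (\<exists>R>0. \<forall>x1 x2. agree_on {- R..R} (translate x1 T) (translate x2 T) \<longrightarrow>
        (\<forall>n m :: int. of_int n < form_integral \<mu> x1 x2 \<and> form_integral \<mu> x1 x2 < of_int m \<longrightarrow>
           x2 \<in> open_segment (int_iterate (orbit_map F T) n x1) (int_iterate (orbit_map F T) m x1)))"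


section \<open>Shape changes and irrationality\<close>

text \<open>The new label of a tile is the pattern of \<open>T\<close> within distance \<open>R\<close> of the tile, translated
  so that the left end point of the tile is 0. The old label is that of the tile of this
  pattern whose left end point is 0.\<close>

definition collar :: "real \<Rightarrow> 'l tiling \<Rightarrow> 'l tiling tiling" where
  "collar R T = {({a..b}, translate a (patch T {a - R..b + R})) | a b l. ({a..b}, l) \<in> T}"

text \<open>The image of the interval with end points \<open>a\<close> and \<open>b\<close> under the monotone function
  \<open>x \<mapsto> form_integral \<mu> 0 x\<close> is the interval whose end points are the images of \<open>a\<close> and \<open>b\<close>,
  both for positive and for negative \<open>\<mu>\<close>; in the latter case the order is reversed.\<close>

definition shape_change_tiling :: "(real \<Rightarrow> real) \<Rightarrow> 'l tiling \<Rightarrow> 'l tiling" where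
  "shape_change_tiling \<mu> T = (\<lambda>(I, l). (form_integral \<mu> 0 ` I, l)) ` T"

definition shape_change_space ::
    "real \<Rightarrow> (real \<Rightarrow> real) \<Rightarrow> 'l tiling \<Rightarrow> 'l tiling tiling set" where
  "shape_change_space R \<mu> T = orbit_closure (shape_change_tiling \<mu> (collar R T))"

definition minimal_under_unit_translation :: "'l tiling set \<Rightarrow> bool" where
  "minimal_under_unit_translation \<Omega> \<longleftrightarrow>
     (\<forall>T\<in>\<Omega>. top_of_tilings \<Omega> closure_of (range (\<lambda>n::int. translate (of_int n) T)) = \<Omega>)"

definition irrational_class :: "'l tiling \<Rightarrow> (real \<Rightarrow> real) set \<Rightarrow> bool" where
  "irrational_class T A \<longleftrightarrow>
     (\<exists>\<mu>\<in>A. \<exists>R>0. PE_radius T R \<mu> \<and> ((\<forall>x. \<mu> x > 0) \<or> (\<forall>x. \<mu> x < 0)) \<and>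
        minimal_under_unit_translation (shape_change_space R \<mu> T))"


section \<open>Semi-conjugacy\<close>

definition semi_conjugacy :: "'l tiling set \<Rightarrow> ('l tiling \<Rightarrow> 'l tiling) \<Rightarrow>
    'k tiling set \<Rightarrow> ('k tiling \<Rightarrow> 'k tiling) \<Rightarrow> ('l tiling \<Rightarrow> 'k tiling) \<Rightarrow> bool" where
  "semi_conjugacy \<Omega> F \<Omega>' F' H \<longleftrightarrow>
     continuous_map (top_of_tilings \<Omega>) (top_of_tilings \<Omega>') H \<and> (\<forall>T\<in>\<Omega>. F' (H T) = H (F T))"

end

theory Submission
  imports Defs
begin

text \<open>
  Choose the representative \<open>\<mu>\<close> of the rotation class to be positive, and let \<open>M x\<close> be its integral
  from 0 to \<open>x\<close>. As for circle maps,
  \<open>\<kappa> x = sup {M y + n | y \<sim> 0, f\<^sup>n y \<le> x}\<close>, with \<open>y \<sim> 0\<close> meaning that the tilings agree around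
  \<open>y\<close> and 0 out to the radius of the rotation form, satisfies \<open>\<kappa> (f x) = \<kappa> x + 1\<close>. By irrationality
  the numbers \<open>M y + n\<close> are dense, already for \<open>y\<close> in a window of bounded length, so that \<open>\<kappa>\<close> is
  continuous and \<open>\<kappa> - M\<close> is determined up to any \<open>e > 0\<close> by the pattern around \<open>x\<close>.

  If \<open>M x = c x + \<psi> x\<close> with \<open>\<psi>\<close> weakly pattern equivariant, the displacement \<open>\<kappa> x / c - x\<close> therefore
  extends continuously to the hull, and gives the semi-conjugacy.

  Conversely, let a semi-conjugacy act on the orbit of \<open>T\<close> by \<open>h\<close>. Then \<open>h - \<rho> \<kappa>\<close> is invariant under
  \<open>f\<close>, hence bounded, and \<open>h x - x\<close> is bounded by a Baire category argument on the hull. So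
  \<open>M x - x / \<rho>\<close> is bounded, and a bounded primitive of a strongly pattern equivariant function is
  weakly pattern equivariant (Gottschalk and Hedlund).
\<close>

section \<open>Pattern equivariance on a recurrent line\<close>

text \<open>Irrationality speaks of the shape change, the rotation form of \<open>T\<close>; they
  meet in \<open>changed_agree\<close>, by which a near return of the changed tiling is an exact
  return of \<open>T\<close>. Unit minimality thus makes \<open>M\<close> dense modulo 1 on returns.
  \<open>M y + n\<close> is where the n-th image of \<open>y\<close> would lie if the map were
  translation by 1 in the coordinate \<open>M\<close>; the rotation form orders images of returns by
  these numbers. Only \<open>n \<ge> 0\<close> is used, since forward images of returns far to the
  left reach every level.

  In the converse, a semi-conjugacy has a displacement at each point of the hull, but its continuity
  is not given. On one orbit it is continuous because paths move along orbits. Invariance under the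
  map yields boundedness because \<open>\<kappa>\<close> stays close to \<open>M\<close>, which
  grows linearly, so that one compact interval meets every orbit of the map. Hence \<open>h\<close>
  follows \<open>\<rho> * M\<close>, and displacements of nearby points differ by a controlled
  amount; a large displacement can then be found next to any prescribed pattern, as the category
  argument requires.\<close>

lemma equal_increments:
  assumes M: "\<And>x. (M has_real_derivative \<mu> x) (at x)" and X: "convex X" "0 \<in> X"
    and eq: "\<And>u. u \<in> X \<Longrightarrow> \<mu> (a + u) = \<mu> (b + u)" and u: "u \<in> X"
  shows "M (a + u) - M a = M (b + u) - M b"
proof -
  have "((\<lambda>u. M (a + u) - M (b + u)) has_real_derivative 0) (at u within X)"
    if "u \<in> X" for u
  proof -
    have "((\<lambda>u. M (z + u)) has_real_derivative \<mu> (z + u)) (at u within X)" for z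
    proof -
      have "((\<lambda>u. M (z + u)) has_real_derivative \<mu> (z + u) * 1) (at u within X)"
        by (rule DERIV_chain2[OF M]) (auto intro!: derivative_eq_intros)
      then show ?thesis by simp
    qed
    from DERIV_diff[OF this[of a] this[of b]] show ?thesis using eq[OF that] by simp
  qed
  then obtain c where c: "\<And>u. u \<in> X \<Longrightarrow> M (a + u) - M (b + u) = c"
    using has_field_derivative_zero_constant[OF X(1), of "\<lambda>u. M (a + u) - M (b + u)"] by metis
  show ?thesis using c[OF u] c[OF X(2)] by simp
qed

text \<open>\<open>rel R x y\<close> stands for agreement of the tilings seen from \<open>x\<close>
  and \<open>y\<close> out to radius \<open>R\<close>; these are the only properties of it that the
  arguments on the line use. In \<open>recurrent\<close> the gap \<open>L\<close> depends on
  \<open>R\<close> but not on the pattern, which is repetitivity combined with finite local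
  complexity.\<close>

locale recurrent_line =
  fixes rel :: "real \<Rightarrow> real \<Rightarrow> real \<Rightarrow> bool"
  assumes rel_refl [simp]: "rel R x x"
    and rel_sym: "rel R x y \<Longrightarrow> rel R y x"
    and rel_trans: "rel R x y \<Longrightarrow> rel R y z \<Longrightarrow> rel R x z"
    and rel_shift: "rel R x y \<Longrightarrow> R' + \<bar>s\<bar> \<le> R \<Longrightarrow> rel R' (x + s) (y + s)"
    and recurrent: "\<exists>L>0. \<forall>x a. \<exists>y. a \<le> y \<and> y \<le> a + L \<and> rel R x y"
begin

definition pe :: "real \<Rightarrow> (real \<Rightarrow> real) \<Rightarrow> bool" where
  "pe R \<phi> \<longleftrightarrow> (\<forall>x y. rel R x y \<longrightarrow> \<phi> x = \<phi> y)"

text \<open>Stated without approximating functions: this is the estimate that passes to limits in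
  the hull, and \<open>wPE_weakly_pe\<close> derives it from uniform approximation.\<close>

definition weakly_pe :: "(real \<Rightarrow> real) \<Rightarrow> bool" where
  "weakly_pe \<phi> \<longleftrightarrow> (\<forall>e>0. \<exists>R. \<forall>x y. rel R x y \<longrightarrow> \<bar>\<phi> x - \<phi> y\<bar> \<le> e)"

lemma rel_mono: "rel R x y \<Longrightarrow> R' \<le> R \<Longrightarrow> rel R' x y"
  using rel_shift[of R x y R' 0] by simp

lemma weakly_peD:
  assumes "weakly_pe \<phi>" "0 < e"
  obtains R where "\<And>x y. rel R x y \<Longrightarrow> \<bar>\<phi> x - \<phi> y\<bar> \<le> e"
  using assms unfolding weakly_pe_def by blast

lemma pe_weakly_pe: "pe R \<phi> \<Longrightarrow> weakly_pe \<phi>"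
  unfolding pe_def weakly_pe_def by (metis abs_zero diff_self less_imp_le)

lemma weakly_pe_add:
  assumes "weakly_pe \<phi>" "weakly_pe \<psi>"
  shows "weakly_pe (\<lambda>x. \<phi> x + \<psi> x)"
  unfolding weakly_pe_def
proof (intro allI impI)
  fix e :: real assume e: "0 < e"
  obtain R1 where 1: "\<And>x y. rel R1 x y \<Longrightarrow> \<bar>\<phi> x - \<phi> y\<bar> \<le> e / 2"
    using weakly_peD[OF assms(1), of "e / 2"] e by auto
  obtain R2 where 2: "\<And>x y. rel R2 x y \<Longrightarrow> \<bar>\<psi> x - \<psi> y\<bar> \<le> e / 2"
    using weakly_peD[OF assms(2), of "e / 2"] e by auto
  have "\<bar>\<phi> x + \<psi> x - (\<phi> y + \<psi> y)\<bar> \<le> e" if "rel (max R1 R2) x y" for x y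
    using 1[OF rel_mono[OF that]] 2[OF rel_mono[OF that]] by simp argo
  then show "\<exists>R. \<forall>x y. rel R x y \<longrightarrow> \<bar>\<phi> x + \<psi> x - (\<phi> y + \<psi> y)\<bar> \<le> e" by blast
qed

lemma weakly_pe_cmult:
  assumes "weakly_pe \<phi>"
  shows "weakly_pe (\<lambda>x. c * \<phi> x)"
  unfolding weakly_pe_def
proof (intro allI impI)
  fix e :: real assume e: "0 < e"
  obtain R where R: "\<And>x y. rel R x y \<Longrightarrow> \<bar>\<phi> x - \<phi> y\<bar> \<le> e / (\<bar>c\<bar> + 1)"
    using weakly_peD[OF assms, of "e / (\<bar>c\<bar> + 1)"] e by auto
  have "\<bar>c * \<phi> x - c * \<phi> y\<bar> \<le> e" if "rel R x y" for x y
  proof -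
    have "\<bar>c * \<phi> x - c * \<phi> y\<bar> = \<bar>c\<bar> * \<bar>\<phi> x - \<phi> y\<bar>"
      by (simp add: abs_mult flip: right_diff_distrib)
    also have "\<dots> \<le> (\<bar>c\<bar> + 1) * (e / (\<bar>c\<bar> + 1))"
      using R[OF that] by (intro mult_mono) auto
    finally show ?thesis by simp
  qed
  then show "\<exists>R. \<forall>x y. rel R x y \<longrightarrow> \<bar>c * \<phi> x - c * \<phi> y\<bar> \<le> e" by blast
qed

text \<open>Every pattern recurs in \<open>{0..L}\<close>, so compactness of this one interval
  controls the whole line.\<close>

lemma weakly_pe_bounded:
  assumes "continuous_on UNIV \<phi>" "weakly_pe \<phi>"
  obtains B where "0 < B" "\<And>x. \<bar>\<phi> x\<bar> \<le> B"
proof -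
  obtain R where R: "\<And>x y. rel R x y \<Longrightarrow> \<bar>\<phi> x - \<phi> y\<bar> \<le> 1"
    using weakly_peD[OF assms(2), of 1] by auto
  obtain L where L: "\<And>x a. \<exists>y. a \<le> y \<and> y \<le> a + L \<and> rel R x y" using recurrent by blast
  have "compact (\<phi> ` {0..L})"
    by (intro compact_continuous_image continuous_on_subset[OF assms(1)]) auto
  then obtain B where B: "\<And>x. x \<in> {0..L} \<Longrightarrow> \<bar>\<phi> x\<bar> \<le> B"
    using compact_imp_bounded bounded_real by (metis imageI)
  have "\<bar>\<phi> x\<bar> \<le> \<bar>B\<bar> + 1" for x
  proof -
    obtain y where "0 \<le> y" "y \<le> L" "rel R x y" using L[of 0 x] by auto
    then show ?thesis using B[of y] R[of x y] by auto
  qed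
  then show thesis using that[of "\<bar>B\<bar> + 1"] by auto
qed

lemma weakly_pe_uniformly_continuous:
  assumes cont: "continuous_on UNIV \<phi>" and "weakly_pe \<phi>" and e: "0 < e"
  obtains d where "0 < d" "\<And>x y. \<bar>x - y\<bar> \<le> d \<Longrightarrow> \<bar>\<phi> x - \<phi> y\<bar> \<le> e"
proof -
  obtain R where R: "\<And>x y. rel R x y \<Longrightarrow> \<bar>\<phi> x - \<phi> y\<bar> \<le> e / 3"
    using weakly_peD[OF assms(2), of "e / 3"] e by auto
  \<comment> \<open>The extra 1 in the radius lets a pair of points at distance at most 1 be moved
    together; the moved pair lies in \<open>{-1..L + 1}\<close>.\<close>
  obtain L where L: "\<And>x a. \<exists>y. a \<le> y \<and> y \<le> a + L \<and> rel (R + 1) x y" using recurrent by blast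
  have "uniformly_continuous_on {-1..L + 1} \<phi>"
    by (intro compact_uniformly_continuous continuous_on_subset[OF cont]) auto
  then obtain d where d: "0 < d" "\<And>x y. x \<in> {-1..L + 1} \<Longrightarrow> y \<in> {-1..L + 1} \<Longrightarrow> dist y x < d \<Longrightarrow> dist (\<phi> y) (\<phi> x) < e / 3"
    using e unfolding uniformly_continuous_on_def by (metis divide_pos_pos zero_less_numeral)
  have "\<bar>\<phi> x - \<phi> y\<bar> \<le> e" if xy: "\<bar>x - y\<bar> \<le> min (d / 2) 1" for x y
  proof -
    obtain x' where x': "0 \<le> x'" "x' \<le> L" "rel (R + 1) x x'" using L[of 0 x] by auto
    have "rel R (x + (y - x)) (x' + (y - x))"
      by (rule rel_shift[OF x'(3)]) (use xy in auto)
    then have 1: "\<bar>\<phi> y - \<phi> (x' + (y - x))\<bar> \<le> e / 3" using R[of y "x' + (y - x)"] by simp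
    have 2: "\<bar>\<phi> x - \<phi> x'\<bar> \<le> e / 3" using R rel_mono[OF x'(3), of R] by auto
    have "dist (x' + (y - x)) x' < d" using xy d(1) by (auto simp: dist_real_def abs_minus_commute)
    then have "\<bar>\<phi> (x' + (y - x)) - \<phi> x'\<bar> < e / 3"
      using d(2)[of x' "x' + (y - x)"] x' xy by (auto simp: dist_real_def abs_if split: if_splits)
    then show ?thesis using 1 2 by linarith
  qed
  then show thesis using that[of "min (d / 2) 1"] d(1) by auto
qed

lemma pe_positive_lower_bound:
  assumes "continuous_on UNIV \<mu>" "pe R \<mu>" "\<And>x. 0 < \<mu> x"
  obtains m where "0 < m" "\<And>x. m \<le> \<mu> x"
proof -
  obtain L where L: "0 < L" "\<And>x a. \<exists>y. a \<le> y \<and> y \<le> a + L \<and> rel R x y" using recurrent by blast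
  obtain z where z: "z \<in> {0..L}" "\<And>y. y \<in> {0..L} \<Longrightarrow> \<mu> z \<le> \<mu> y"
    using continuous_attains_inf[of "{0..L}" \<mu>] continuous_on_subset[OF assms(1), of "{0..L}"] L(1)
    by (metis atLeastAtMost_iff compact_Icc empty_iff less_imp_le order_refl subset_UNIV)
  have "\<mu> z \<le> \<mu> x" for x
  proof -
    obtain y where "0 \<le> y" "y \<le> L" "rel R x y" using L(2)[of 0 x] by auto
    then show ?thesis using z(2)[of y] assms(2) by (auto simp: pe_def)
  qed
  then show thesis using that assms(3) by blast
qed

section \<open>Increments of primitives and the Gottschalk-Hedlund argument\<close>

lemma pe_increment:
  assumes M: "\<And>x. (M has_real_derivative \<mu> x) (at x)" and "pe R \<mu>"
    and "rel (R + r) x y" "\<bar>s\<bar> \<le> r"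
  shows "M (x + s) - M x = M (y + s) - M y"
proof (rule equal_increments[OF M, of "{- r..r}"])
  show "\<mu> (x + u) = \<mu> (y + u)" if "u \<in> {- r..r}" for u
  proof -
    have "rel R (x + u) (y + u)" by (rule rel_shift[OF assms(3)]) (use that in auto)
    then show ?thesis using assms(2) by (simp add: pe_def)
  qed
qed (use assms(4) in auto)

text \<open>A bounded primitive \<open>g\<close> comes within any \<open>e\<close> of its supremum in every interval of some
  fixed length, because a pattern on which it almost realizes its total oscillation recurs.\<close>

lemma bounded_primitive_near_sup:
  assumes g: "\<And>x. (g has_real_derivative \<gamma> x) (at x)" and "pe R \<gamma>"
    and bd: "\<And>x. \<bar>g x\<bar> \<le> B" and e: "0 < e"
  obtains L where "0 < L" "\<And>a. \<exists>y. a \<le> y \<and> y \<le> a + L \<and> Sup (range g) - e < g y"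
proof -
  have bdd: "bdd_above (range g)" "bdd_below (range g)"
    using bd by (auto intro!: bdd_aboveI[of _ B] bdd_belowI[of _ "-B"] simp: abs_le_iff minus_le_iff)
  obtain p where p: "Sup (range g) - e / 2 < g p"
    using less_cSupD[of "range g" "Sup (range g) - e / 2"] e by auto
  obtain q where q: "g q < Inf (range g) + e / 2"
    using cInf_lessD[of "range g" "Inf (range g) + e / 2"] e by auto
  obtain L where L: "0 < L" "\<And>a. \<exists>y. a \<le> y \<and> y \<le> a + L \<and> rel (R + \<bar>q - p\<bar>) p y"
    using recurrent by metis
  have "Sup (range g) - e < g y" if "rel (R + \<bar>q - p\<bar>) p y" for y
  proof -
    have "g (p + (q - p)) - g p = g (y + (q - p)) - g y"
      by (rule pe_increment[OF g assms(2) that]) simp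
    moreover have "Inf (range g) \<le> g (y + (q - p))" using bdd by (intro cInf_lower) auto
    ultimately show ?thesis using p q by simp
  qed
  then show thesis using that L by metis
qed

text \<open>The supremum of \<open>g\<close> over a long window is nearly
  \<open>Sup (range g)\<close>, uniformly in the centre, by
  \<open>bounded_primitive_near_sup\<close>. Replacing the constant by the windowed supremum
  therefore costs little.\<close>

lemma bounded_primitive_weakly_pe:
  assumes g: "\<And>x. (g has_real_derivative \<gamma> x) (at x)" and pe: "pe R \<gamma>"
    and bd: "\<And>x. \<bar>g x\<bar> \<le> B" and C: "\<And>x. \<bar>\<gamma> x\<bar> \<le> C"
  obtains G where "\<And>n. continuous_on UNIV (G n)" "\<And>n. pe (R + real n) (G n)"
    "uniform_limit UNIV G g sequentially"
proof -
  define A where "A = Sup (range g)"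
  define W where "W n x = g ` {x - real n..x + real n}" for n x
  \<comment> \<open>The difference of \<open>g x\<close> and a supremum of \<open>g\<close> over a window around \<open>x\<close> is a
    supremum of integrals of \<open>\<gamma>\<close> over that window, hence exactly pattern equivariant.\<close>
  define G where "G n x = A - Sup ((\<lambda>s. g (x + s) - g x) ` {- real n..real n})" for n :: nat and x
  have bddg: "bdd_above (range g)"
    using bd by (auto intro!: bdd_aboveI[of _ B] simp: abs_le_iff)
  have bW: "bdd_above (W n x)" for n x using bddg by (rule bdd_above_mono) (auto simp: W_def)
  have neW: "W n x \<noteq> {}" for n x by (auto simp: W_def)
  have G: "G n x = A - Sup (W n x) + g x" for n x
  proof -
    have W': "W n x = (\<lambda>s. g (x + s)) ` {- real n..real n}"
    proof -
      have "{x - real n..x + real n} = (+) x ` {- real n..real n}" by simp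
      then show ?thesis unfolding W_def by (simp only: image_image)
    qed
    have eq: "(\<lambda>s. g (x + s) - g x) ` {- real n..real n} = (\<lambda>v. - g x + v) ` W n x"
      by (simp add: W' image_image)
    have "Sup ((\<lambda>v. - g x + v) ` W n x) = - g x + Sup (W n x)"
      using Sup_add_eq[of "\<lambda>v. v" "W n x" "- g x"] neW bW by simp
    then show ?thesis using eq by (simp add: G_def)
  qed
  have lip: "\<bar>g x - g y\<bar> \<le> C * \<bar>x - y\<bar>" for x y
    using field_differentiable_bound[of UNIV g \<gamma> C x y] g C by (simp add: has_field_derivative_at_within)
  have C0: "0 \<le> C" using C[of 0] by linarith
  have SupW: "Sup (W n x) \<le> Sup (W n y) + C * \<bar>x - y\<bar>" for n x y
  proof (rule cSup_least[OF neW])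
    fix v assume "v \<in> W n x"
    then obtain z where "z \<in> {x - real n..x + real n}" and z': "v = g z" by (auto simp: W_def)
    then have z: "\<bar>z - x\<bar> \<le> real n" by auto
    have "g (z + (y - x)) \<in> W n y" using z by (auto simp: W_def abs_le_iff)
    then have "g (z + (y - x)) \<le> Sup (W n y)" by (rule cSup_upper[OF _ bW])
    then show "v \<le> Sup (W n y) + C * \<bar>x - y\<bar>" using lip[of z "z + (y - x)"] z' by auto
  qed
  have "continuous_on UNIV (G n)" for n
  proof (rule continuous_on_subset[OF lipschitz_on_continuous_on], rule lipschitz_onI)
    \<comment> \<open>One \<open>C\<close> accounts for sliding the window, the other for the term
      \<open>g x\<close>.\<close>
    show "dist (G n x) (G n y) \<le> (2 * C) * dist x y" for x y
      using SupW[of n x y] SupW[of n y x] lip[of x y]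
      by (simp add: G dist_real_def abs_minus_commute[of y x] abs_le_iff)
  qed (use C0 in auto)
  moreover have "pe (R + real n) (G n)" for n
    unfolding pe_def
  proof (intro allI impI)
    fix x y assume "rel (R + real n) x y"
    then have "(\<lambda>s. g (x + s) - g x) ` {- real n..real n} = (\<lambda>s. g (y + s) - g y) ` {- real n..real n}"
      by (intro image_cong pe_increment[OF g pe]) (auto simp: abs_le_iff)
    then show "G n x = G n y" by (simp add: G_def)
  qed
  moreover have "uniform_limit UNIV G g sequentially"
  proof (rule uniform_limitI)
    fix e :: real assume e: "0 < e"
    obtain L where L: "0 < L" "\<And>a. \<exists>y. a \<le> y \<and> y \<le> a + L \<and> A - e < g y"
      using bounded_primitive_near_sup[OF g pe bd e] unfolding A_def by metis
    have "dist (G n x) (g x) < e" if n: "L \<le> real n" for n x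
    proof -
      obtain y where "x \<le> y" "y \<le> x + L" "A - e < g y" using L(2) by blast
      then have "A - e < Sup (W n x)"
        using n by (intro less_le_trans[OF _ cSup_upper[OF _ bW]]) (auto simp: W_def)
      moreover have "Sup (W n x) \<le> A"
        unfolding A_def using neW bddg by (intro cSup_subset_mono) (auto simp: W_def)
      ultimately show ?thesis by (simp add: G dist_real_def)
    qed
    then show "\<forall>\<^sub>F n in sequentially. \<forall>x\<in>UNIV. dist (G n x) (g x) < e"
      by (auto intro!: eventually_sequentiallyI[of "nat \<lceil>L\<rceil>"] simp: nat_ceiling_le_eq)
  qed
  ultimately show thesis by (rule that)
qed

end

section \<open>The height function of a rotation\<close>

lemma strict_mono_funpow: "strict_mono (f :: real \<Rightarrow> real) \<Longrightarrow> strict_mono (f ^^ n)"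
  by (induction n) (auto simp: strict_mono_def)

text \<open>\<open>order\<close> is the rotation form condition for returns to the pattern at 0,
  with natural exponents only; \<open>dense\<close> is irrationality, the values of \<open>M\<close>
  modulo 1 at returns of any radius being dense in the circle.\<close>

locale ordered_orbit = recurrent_line +
  fixes f M \<mu> :: "real \<Rightarrow> real" and R0 Rf R\<mu> :: real
  assumes f_mono: "strict_mono f" and f_cont: "continuous_on UNIV f"
    and f_pe: "pe Rf (\<lambda>x. f x - x)"
    and M_deriv: "\<And>x. (M has_real_derivative \<mu> x) (at x)"
    and \<mu>_pe: "pe R\<mu> \<mu>" and \<mu>_cont: "continuous_on UNIV \<mu>" and \<mu>_pos: "\<And>x. 0 < \<mu> x"
    and order: "\<And>y y' n n'. rel R0 0 y \<Longrightarrow> rel R0 0 y' \<Longrightarrow>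
      M y + real n < M y' + real n' \<Longrightarrow> (f ^^ n) y < (f ^^ n') y'"
    and dense: "\<And>t e R. 0 < e \<Longrightarrow> \<exists>y n::int. rel R 0 y \<and> \<bar>M y - t - of_int n\<bar> < e"
begin

section \<open>Linear growth of \<open>M\<close> and density of its values at returns\<close>

definition slope_min :: real where "slope_min = (SOME m. 0 < m \<and> (\<forall>x. m \<le> \<mu> x))"
definition slope_max :: real where "slope_max = (SOME C. 0 < C \<and> (\<forall>x. \<mu> x \<le> C))"

lemma slope_min: "0 < slope_min" "slope_min \<le> \<mu> x"
proof -
  have "\<exists>m. 0 < m \<and> (\<forall>x. m \<le> \<mu> x)"
    by (rule pe_positive_lower_bound[OF \<mu>_cont \<mu>_pe \<mu>_pos]) blast
  from someI_ex[OF this] show "0 < slope_min" "slope_min \<le> \<mu> x" by (simp_all add: slope_min_def)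
qed

lemma slope_max: "0 < slope_max" "\<mu> x \<le> slope_max"
proof -
  have "\<exists>C. 0 < C \<and> (\<forall>x. \<mu> x \<le> C)"
    using weakly_pe_bounded[OF \<mu>_cont pe_weakly_pe[OF \<mu>_pe]] by (metis abs_le_D1)
  from someI_ex[OF this] show "0 < slope_max" "\<mu> x \<le> slope_max" by (simp_all add: slope_max_def)
qed

lemma M_diff:
  assumes "x \<le> y"
  shows "slope_min * (y - x) \<le> M y - M x" "M y - M x \<le> slope_max * (y - x)"
proof -
  have "slope_min * (y - x) \<le> M y - M x \<and> M y - M x \<le> slope_max * (y - x)"
  proof (cases "x = y")
    case False
    then have "x < y" using assms by simp
    then obtain z where "M y - M x = (y - x) * \<mu> z" using MVT2[OF _ M_deriv] by blast
    then show ?thesis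
      using slope_min(2)[of z] slope_max(2)[of z] assms
      by (simp add: mult.commute[of "y - x"] mult_right_mono)
  qed simp
  then show "slope_min * (y - x) \<le> M y - M x" "M y - M x \<le> slope_max * (y - x)" by auto
qed

lemma M_mono: "x \<le> y \<Longrightarrow> M x \<le> M y"
  using M_diff(1)[of x y] slope_min(1) mult_nonneg_nonneg[of slope_min "y - x"] by linarith

text \<open>Compactness of the circle: finitely many returns approximate all multiples of
  \<open>1 / J\<close> modulo 1, and these finitely many points fit in one window that serves every
  \<open>t\<close>.\<close>

lemma dense_bounded:
  assumes e: "0 < e"
  obtains W where "0 < W" "\<And>t. \<exists>y n::int. \<bar>y\<bar> \<le> W \<and> rel R 0 y \<and> \<bar>M y - t - of_int n\<bar> < e"
proof -
  obtain J :: nat where J: "2 / e < real J" using reals_Archimedean2 by blast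
  then have J0: "0 < real J" using e by (meson divide_pos_pos order_less_trans zero_less_numeral)
  have "\<exists>y. rel R 0 y \<and> (\<exists>n::int. \<bar>M y - real j / real J - of_int n\<bar> < e / 2)" for j
    using dense[of "e / 2"] e by (metis half_gt_zero)
  then obtain y where y: "\<And>j. rel R 0 (y j) \<and> (\<exists>n::int. \<bar>M (y j) - real j / real J - of_int n\<bar> < e / 2)"
    by metis
  define W where "W = 1 + (\<Sum>j\<le>J. \<bar>y j\<bar>)"
  have W: "\<bar>y j\<bar> \<le> W" if "j \<le> J" for j
    using member_le_sum[of j "{..J}" "\<lambda>j. \<bar>y j\<bar>"] that by (simp add: W_def)
  have "\<exists>x n::int. \<bar>x\<bar> \<le> W \<and> rel R 0 x \<and> \<bar>M x - t - of_int n\<bar> < e" for t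
  proof -
    define j where "j = nat \<lfloor>frac t * real J\<rfloor>"
    have fr: "0 \<le> frac t" "frac t < 1" by (auto simp: frac_lt_1)
    have j: "real j \<le> frac t * real J" "frac t * real J < real j + 1"
      using fr J0 by (simp_all add: j_def of_nat_floor)
    have "real j < 1 * real J" using j(1) mult_strict_right_mono[OF fr(2) J0] by linarith
    then have "j \<le> J" by simp
    obtain n :: int where n: "\<bar>M (y j) - real j / real J - of_int n\<bar> < e / 2" using y by blast
    have "frac t - real j / real J = (frac t * real J - real j) / real J"
      using J0 by (simp add: field_simps)
    moreover have "\<bar>frac t * real J - real j\<bar> \<le> 1" using j by linarith
    ultimately have "\<bar>frac t - real j / real J\<bar> \<le> 1 / real J"
      using J0 by (simp add: divide_right_mono)
    also have "\<dots> < e / 2" using J J0 e by (simp add: field_simps)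
    finally have "\<bar>frac t - real j / real J\<bar> < e / 2" .
    \<comment> \<open>The integer part of \<open>t\<close> goes into the integer; what remains is
      the distance from \<open>frac t\<close> to the grid point below it.\<close>
    moreover have "M (y j) - t - of_int (n - \<lfloor>t\<rfloor>)
        = (M (y j) - real j / real J - of_int n) - (frac t - real j / real J)"
      by (simp add: frac_def)
    ultimately have "\<bar>M (y j) - t - of_int (n - \<lfloor>t\<rfloor>)\<bar> < e" using n by linarith
    then show ?thesis using W[OF \<open>j \<le> J\<close>] y by blast
  qed
  moreover have "0 < W" unfolding W_def by (smt (verit) abs_ge_zero sum_nonneg)
  ultimately show thesis using that by blast
qed

text \<open>The window around 0 recurs near every \<open>x\<close>, at a point \<open>z\<close>;
  aiming at \<open>t - M z + M 0\<close> compensates for the change of \<open>M\<close>. The radius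
  exceeds \<open>W\<close> by enough to preserve both \<open>rel R0 0\<close> and the increments of
  \<open>M\<close> throughout the window.\<close>

lemma dense_everywhere:
  assumes e: "0 < e"
  obtains W where "0 < W"
    "\<And>x t. \<exists>y n::int. \<bar>y - x\<bar> \<le> W \<and> rel R0 0 y \<and> \<bar>M y - t - of_int n\<bar> < e"
proof -
  obtain W where W: "0 < W" "\<And>t. \<exists>y n::int. \<bar>y\<bar> \<le> W \<and> rel R0 0 y \<and> \<bar>M y - t - of_int n\<bar> < e"
    using dense_bounded[OF e] by blast
  define R where "R = max R0 R\<mu> + W"
  obtain L where L: "0 < L" "\<And>x a. \<exists>y. a \<le> y \<and> y \<le> a + L \<and> rel R x y" using recurrent by blast
  have "\<exists>y n::int. \<bar>y - x\<bar> \<le> W + L \<and> rel R0 0 y \<and> \<bar>M y - t - of_int n\<bar> < e" for x t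
  proof -
    obtain z where z: "x \<le> z" "z \<le> x + L" "rel R 0 z" using L(2) by blast
    obtain y and n :: int where y: "\<bar>y\<bar> \<le> W" "rel R0 0 y" "\<bar>M y - (t - M z + M 0) - of_int n\<bar> < e"
      using W(2) by blast
    have "rel R0 (0 + y) (z + y)" by (rule rel_shift[OF z(3)]) (use y(1) in \<open>auto simp: R_def\<close>)
    then have "rel R0 0 (z + y)" using rel_trans[OF y(2)] by simp
    moreover have "M (0 + y) - M 0 = M (z + y) - M z"
      by (rule pe_increment[OF M_deriv \<mu>_pe _ y(1)], rule rel_mono[OF z(3)]) (auto simp: R_def)
    then have "\<bar>M (z + y) - t - of_int n\<bar> < e" using y(3) by (simp add: algebra_simps)
    moreover have "\<bar>z + y - x\<bar> \<le> W + L" using y(1) z by linarith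
    ultimately show ?thesis by blast
  qed
  then show thesis using that[of "W + L"] W(1) L(1) by simp
qed

text \<open>Returns far to the left have very negative \<open>M y\<close>, so a large exponent is
  needed to lift them to the level between \<open>a\<close> and \<open>b\<close>. This is why
  natural exponents suffice.\<close>

lemma dense_with_exponent:
  assumes "a < b"
  obtains y n where "N \<le> n" "rel R0 0 y" "a < M y + real n" "M y + real n < b"
proof -
  obtain W where W: "0 < W"
    "\<And>x t. \<exists>y n::int. \<bar>y - x\<bar> \<le> W \<and> rel R0 0 y \<and> \<bar>M y - t - of_int n\<bar> < (b - a) / 2"
    using dense_everywhere[of "(b - a) / 2"] assms by auto
  \<comment> \<open>The window is centred at \<open>- Z - W\<close>, so that
    \<open>y \<le> - Z\<close> and \<open>M y\<close> is at most
    \<open>- \<bar>a\<bar> - real N - 1\<close>.\<close>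
  define Z where "Z = (\<bar>M 0\<bar> + \<bar>a\<bar> + real N + 1) / slope_min"
  have Z: "0 \<le> Z" using slope_min(1) by (simp add: Z_def)
  obtain y and n :: int where y: "\<bar>y - (- Z - W)\<bar> \<le> W" "rel R0 0 y"
    "\<bar>M y - (a + b) / 2 - of_int n\<bar> < (b - a) / 2"
    using W(2) by blast
  have "y \<le> - Z" using y(1) by simp
  then have "M y \<le> M (- Z)" by (rule M_mono)
  also have "\<dots> \<le> M 0 - slope_min * Z" using M_diff(1)[of "- Z" 0] Z by simp
  finally have "M y \<le> M 0 - (\<bar>M 0\<bar> + \<bar>a\<bar> + real N + 1)" using slope_min(1) by (simp add: Z_def)
  moreover have 2: "a < M y - of_int n" "M y - of_int n < b" using y(3) by (auto simp: abs_less_iff field_simps)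
  ultimately have "real N \<le> of_int (- n)" by simp
  then have "int N \<le> - n" by (metis of_int_le_iff of_int_of_nat_eq)
  then have "real (nat (- n)) = - of_int n" "N \<le> nat (- n)" by auto
  then show thesis using that[of "nat (- n)" y] y(2) 2 by simp
qed

text \<open>The cut of levels already passed at \<open>x\<close>, as in the construction of
  Poincare's semi-conjugacy of a circle map to a rotation. Inverse iterates are left out, by
  \<open>dense_with_exponent\<close> without loss of levels.\<close>

definition below :: "real \<Rightarrow> real set" where
  "below x = {M y + real n | y n. rel R0 0 y \<and> (f ^^ n) y \<le> x}"

definition height :: "real \<Rightarrow> real" where "height x = Sup (below x)"

text \<open>Both bounds compare with a return \<open>z\<close> near \<open>x\<close> and exponent 0:
  for \<open>z\<close> to the right of \<open>x\<close>, \<open>order\<close> forbids levels above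
  \<open>M z\<close>, and for \<open>z\<close> to the left, \<open>M z\<close> itself is a level
  passed at \<open>x\<close>.\<close>

lemma below_bounds:
  obtains K where "0 < K" "\<And>x v. v \<in> below x \<Longrightarrow> v \<le> M x + K" "\<And>x. \<exists>v\<in>below x. M x - K \<le> v"
proof -
  obtain L where L: "0 < L" "\<And>a. \<exists>y. a \<le> y \<and> y \<le> a + L \<and> rel R0 0 y" using recurrent by metis
  have 1: "v \<le> M x + slope_max * (L + 1)" if v: "v \<in> below x" for x v
  proof -
    obtain y n where y: "rel R0 0 y" "(f ^^ n) y \<le> x" "v = M y + real n" using v by (auto simp: below_def)
    obtain z where z: "x + 1 \<le> z" "z \<le> x + 1 + L" "rel R0 0 z" using L(2) by blast
    have "\<not> M z + real 0 < M y + real n" using order[OF z(3) y(1), of 0 n] z y(2) by auto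
    moreover have "M z \<le> M x + slope_max * (z - x)" using M_diff(2)[of x z] z(1) by simp
    moreover have "slope_max * (z - x) \<le> slope_max * (L + 1)" using z slope_max(1) by simp
    ultimately show ?thesis using y(3) by simp
  qed
  have 2: "\<exists>v\<in>below x. M x - slope_max * (L + 1) \<le> v" for x
  proof -
    obtain z where z: "x - L \<le> z" "z \<le> x" "rel R0 0 z" using L(2)[of "x - L"] by auto
    have "M x - M z \<le> slope_max * (x - z)" using M_diff(2) z by simp
    moreover have "slope_max * (x - z) \<le> slope_max * (L + 1)" using z slope_max(1) by simp
    moreover have "M z + real 0 \<in> below x" using z unfolding below_def by fastforce
    ultimately show ?thesis by (intro bexI[of _ "M z + real 0"]) auto
  qed
  show thesis using that[OF _ 1 2] slope_max(1) L(1) by simp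
qed

lemma below_bdd_above: "bdd_above (below x)"
  using below_bounds by (metis bdd_aboveI)

lemma below_nonempty: "below x \<noteq> {}"
  using below_bounds by (metis empty_iff)

lemma height_bounds: obtains K where "0 < K" "\<And>x. \<bar>height x - M x\<bar> \<le> K"
proof -
  obtain K where K: "0 < K" "\<And>x v. v \<in> below x \<Longrightarrow> v \<le> M x + K" "\<And>x. \<exists>v\<in>below x. M x - K \<le> v"
    using below_bounds by blast
  have "height x \<le> M x + K" for x
    unfolding height_def by (rule cSup_least[OF below_nonempty]) (rule K(2))
  moreover have "M x - K \<le> height x" for x
    using K(3)[of x] cSup_upper[OF _ below_bdd_above] unfolding height_def by (meson order_trans)
  ultimately show thesis using that[OF K(1)] by (simp add: abs_le_iff algebra_simps)
qed

lemma le_height: "rel R0 0 y \<Longrightarrow> (f ^^ n) y \<le> x \<Longrightarrow> M y + real n \<le> height x"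
  unfolding height_def by (rule cSup_upper[OF _ below_bdd_above]) (auto simp: below_def)

text \<open>Together with \<open>le_height\<close> this lets the position of
  \<open>(f ^^ n) y\<close> relative to \<open>x\<close> be read off from levels and conversely; the
  remaining properties of \<open>height\<close> reduce to these two facts and density.\<close>

lemma less_height:
  assumes y: "rel R0 0 y" and "M y + real n < height x"
  shows "(f ^^ n) y < x"
proof -
  obtain v where "v \<in> below x" "M y + real n < v"
    using less_cSupD[OF below_nonempty] assms(2) unfolding height_def by blast
  then obtain y' n' where "rel R0 0 y'" "(f ^^ n') y' \<le> x" "M y + real n < M y' + real n'"
    by (auto simp: below_def)
  then show ?thesis using order[OF y] by fastforce
qed

lemma height_f: "height (f x) = height x + 1"
proof (rule antisym; rule ccontr)
  assume "\<not> height (f x) \<le> height x + 1"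
  then have "height x + 1 < height (f x)" by simp
  \<comment> \<open>The exponent is at least 1 so that one application of \<open>f\<close> can be
    cancelled.\<close>
  then obtain y n where y: "1 \<le> n" "rel R0 0 y" "height x + 1 < M y + real n" "M y + real n < height (f x)"
    by (rule dense_with_exponent)
  have "(f ^^ n) y < f x" using less_height y by blast
  moreover have "(f ^^ n) y = f ((f ^^ (n - 1)) y)" using y(1) by (cases n) auto
  ultimately have "(f ^^ (n - 1)) y < x" using f_mono by (simp add: strict_mono_less)
  then have "M y + real (n - 1) \<le> height x" using le_height y(2) by simp
  then show False using y(1,3) by (simp add: of_nat_diff)
next
  assume "\<not> height x + 1 \<le> height (f x)"
  then have "height (f x) - 1 < height x" by simp
  then obtain y n where y: "0 \<le> n" "rel R0 0 y" "height (f x) - 1 < M y + real n" "M y + real n < height x"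
    by (rule dense_with_exponent)
  have "(f ^^ Suc n) y < f x" using less_height[OF y(2,4)] f_mono by (simp add: strict_mono_less)
  then have "M y + real (Suc n) \<le> height (f x)" using le_height[OF y(2), of "Suc n"] by simp
  then show False using y(3) by simp
qed

text \<open>By density two orbit points with levels within \<open>e\<close> of
  \<open>height x\<close>, one below and one above, bracket \<open>x\<close>; between them
  \<open>height\<close> stays between these levels.\<close>

lemma continuous_height: "continuous_on UNIV height"
  unfolding continuous_on_iff
proof (intro ballI allI impI)
  fix x e :: real assume e: "0 < e"
  obtain y n where y: "(0::nat) \<le> n" "rel R0 0 y" "height x - e < M y + real n" "M y + real n < height x"
    by (rule dense_with_exponent[of "height x - e" "height x" 0]) (use e in auto)
  obtain z m where z: "(0::nat) \<le> m" "rel R0 0 z" "height x < M z + real m" "M z + real m < height x + e"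
    by (rule dense_with_exponent[of "height x" "height x + e" 0]) (use e in auto)
  define d where "d = min (x - (f ^^ n) y) ((f ^^ m) z - x)"
  have "(f ^^ n) y < x" by (rule less_height[OF y(2,4)])
  moreover have "x < (f ^^ m) z" using le_height[OF z(2), of m x] z(3) by fastforce
  ultimately have "0 < d" by (simp add: d_def)
  moreover have "dist (height x') (height x) < e" if x': "dist x' x < d" for x'
  proof -
    have "(f ^^ n) y \<le> x'" "x' \<le> (f ^^ m) z" using x' by (auto simp: d_def dist_real_def)
    then have "M y + real n \<le> height x'" "\<not> M z + real m < height x'"
      using le_height[OF y(2)] less_height[OF z(2), of m x'] by auto
    then show ?thesis using y z by (simp add: dist_real_def)
  qed
  ultimately show "\<exists>d>0. \<forall>x'\<in>UNIV. dist x' x < d \<longrightarrow> dist (height x') (height x) < e" by blast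
qed

text \<open>Each application of \<open>f\<close> moves a point by at most \<open>B\<close>, so each
  costs \<open>B\<close> of the radius.\<close>

lemma funpow_pe:
  assumes B: "\<And>x. \<bar>f x - x\<bar> \<le> B" and xy: "rel (Rf + real n * B) x y"
  shows "(f ^^ n) y - y = (f ^^ n) x - x \<and> \<bar>(f ^^ n) x - x\<bar> \<le> real n * B"
  using xy
proof (induction n)
  case (Suc n)
  have B0: "0 \<le> B" using B[of 0] by linarith
  have IH: "(f ^^ n) y - y = (f ^^ n) x - x" "\<bar>(f ^^ n) x - x\<bar> \<le> real n * B"
    using Suc.IH[OF rel_mono[OF Suc.prems]] B0 by (auto simp: algebra_simps)
  define s where "s = (f ^^ n) x - x"
  have eq: "(f ^^ n) x = x + s" "(f ^^ n) y = y + s" using IH(1) by (auto simp: s_def)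
  have "rel Rf (x + s) (y + s)"
    by (rule rel_shift[OF Suc.prems]) (use IH(2) B0 in \<open>auto simp: s_def algebra_simps\<close>)
  then have "f (x + s) - (x + s) = f (y + s) - (y + s)" using f_pe by (simp add: pe_def)
  moreover have "\<bar>f (x + s) - x\<bar> \<le> B + real n * B" using B[of "x + s"] IH(2) unfolding s_def by linarith
  ultimately show ?case by (simp add: eq algebra_simps)
qed simp

text \<open>A level just below \<open>height x\<close> is realized by a return in a bounded window
  to the left of \<open>x\<close> and by a bounded exponent. Whether its image lies below
  \<open>x\<close> is then decided by the pattern around \<open>x\<close> out to a fixed
  radius.\<close>

lemma weakly_pe_height: "weakly_pe (\<lambda>x. height x - M x)"
  unfolding weakly_pe_def
proof (intro allI impI)
  fix e :: real assume e: "0 < e"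
  obtain K where K: "0 < K" "\<And>x. \<bar>height x - M x\<bar> \<le> K" using height_bounds by blast
  have "continuous_on UNIV (\<lambda>x. f x - x)" by (intro continuous_intros f_cont)
  then obtain B where B: "0 < B" "\<And>x. \<bar>f x - x\<bar> \<le> B"
    using weakly_pe_bounded[OF _ pe_weakly_pe[OF f_pe]] by blast
  obtain W where W: "0 < W"
    "\<And>x t. \<exists>y n::int. \<bar>y - x\<bar> \<le> W \<and> rel R0 0 y \<and> \<bar>M y - t - of_int n\<bar> < e / 2"
    using dense_everywhere[of "e / 2"] e by auto
  \<comment> \<open>Every \<open>y\<close> within \<open>W\<close> of \<open>x - Z\<close> satisfies
    \<open>M y \<le> M x - (K + e)\<close>, which forces a nonnegative exponent; \<open>N\<close>
    bounds this exponent from above, and \<open>R\<close> covers the window and \<open>N\<close>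
    steps of \<open>f\<close>.\<close>
  define Z where "Z = (K + e) / slope_min + W"
  define N where "N = nat \<lceil>K + slope_max * (Z + W)\<rceil>"
  define R where "R = max R0 (max R\<mu> (Rf + real N * B)) + (Z + W)"
  have Z: "W \<le> Z" "slope_min * (Z - W) = K + e" using slope_min(1) K(1) e by (simp_all add: Z_def)
  have half: "height x - M x - e \<le> height x' - M x'" if xx': "rel R x x'" for x x'
  proof -
    obtain y and n :: int where y: "\<bar>y - (x - Z)\<bar> \<le> W" "rel R0 0 y"
      "\<bar>M y - (height x - e / 2) - of_int n\<bar> < e / 2"
      using W(2) by blast
    have yx: "x - (Z + W) \<le> y" "y \<le> x - (Z - W)" "y \<le> x" "\<bar>y - x\<bar> \<le> Z + W" using y(1) Z(1) by auto
    have 2: "height x - e < M y - of_int n" "M y - of_int n < height x"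
      using y(3) by (auto simp: abs_less_iff field_simps)
    have "slope_min * (Z - W) \<le> slope_min * (x - y)" using yx slope_min(1) by simp
    then have "M y \<le> M x - (K + e)" using M_diff(1)[of y x] yx Z(2) by simp
    then have "0 \<le> real_of_int (- n)" using 2(1) K(2)[of x] unfolding of_int_minus by linarith
    then have n: "real (nat (- n)) = - of_int n" by simp
    have "M x - M y \<le> slope_max * (x - y)" using M_diff(2) yx by simp
    moreover have "slope_max * (x - y) \<le> slope_max * (Z + W)" using yx slope_max(1) by simp
    ultimately have "- of_int n \<le> K + slope_max * (Z + W)" using 2(2) K(2)[of x] by (simp add: abs_le_iff)
    then have nN: "nat (- n) \<le> N" unfolding N_def using n by (intro nat_mono) linarith
    define y' where "y' = x' + (y - x)"
    have rel: "rel (max R0 (max R\<mu> (Rf + real N * B))) y y'"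
      using rel_shift[OF xx', of _ "y - x"] yx(4) by (simp add: R_def y'_def)
    have "real (nat (- n)) * B \<le> real N * B" using nN B(1) by simp
    then have "rel (Rf + real (nat (- n)) * B) y y'" by (intro rel_mono[OF rel]) simp
    then have "(f ^^ nat (- n)) y' - y' = (f ^^ nat (- n)) y - y" using funpow_pe[OF B(2)] by blast
    moreover have "(f ^^ nat (- n)) y < x" using less_height[OF y(2)] 2(2) n by simp
    ultimately have "(f ^^ nat (- n)) y' \<le> x'" by (simp add: y'_def)
    moreover have "rel R0 0 y'" using rel_trans[OF y(2) rel_mono[OF rel]] by simp
    ultimately have "M y' - of_int n \<le> height x'" using le_height n by fastforce
    moreover have "M (x + (y - x)) - M x = M (x' + (y - x)) - M x'"
      by (rule pe_increment[OF M_deriv \<mu>_pe _ yx(4)], rule rel_mono[OF xx']) (simp add: R_def)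
    ultimately show ?thesis using 2(1) by (simp add: y'_def)
  qed
  have "\<bar>height x - M x - (height x' - M x')\<bar> \<le> e" if "rel R x x'" for x x'
    using half[OF that] half[OF rel_sym[OF that]] by (simp add: abs_le_iff)
  then show "\<exists>R. \<forall>x y. rel R x y \<longrightarrow> \<bar>height x - M x - (height y - M y)\<bar> \<le> e" by blast
qed

end

section \<open>Finite local complexity and recurrence\<close>

lemma tile_translate_Icc [simp]: "tile_translate s ({a..b}, l) = ({a - s..b - s}, l)"
  by (simp add: tile_translate_def)

lemma tile_translate_uminus [simp]: "tile_translate (- s) (tile_translate s t) = t"
  "tile_translate s (tile_translate (- s) t) = t"
  by (simp_all add: tile_translate_def image_image)

lemma in_translate_iff: "t \<in> translate s T \<longleftrightarrow> tile_translate (- s) t \<in> T"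
  unfolding translate_def by (metis image_iff tile_translate_uminus)

lemma translate_mono: "T \<subseteq> T' \<Longrightarrow> translate s T \<subseteq> translate s T'"
  unfolding translate_def by blast

lemma agree_on_iff: "agree_on K T T' \<longleftrightarrow> (\<forall>t. fst t \<inter> K \<noteq> {} \<longrightarrow> (t \<in> T \<longleftrightarrow> t \<in> T'))"
  unfolding agree_on_def patch_def by blast

lemma agree_on_refl [simp]: "agree_on K T T"
  by (simp add: agree_on_def)

lemma agree_on_sym: "agree_on K T T' \<Longrightarrow> agree_on K T' T"
  by (simp add: agree_on_def)

lemma agree_on_trans: "agree_on K T T' \<Longrightarrow> agree_on K T' T'' \<Longrightarrow> agree_on K T T''"
  by (simp add: agree_on_def)

lemma agree_on_shift:
  "agree_on {- R..R} T T' \<Longrightarrow> R' + \<bar>s\<bar> \<le> R \<Longrightarrow> agree_on {- R'..R'} (translate s T) (translate s T')"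
  by (erule agree_on_translate) auto

lemma agree_on_shrink: "agree_on {- R..R} T T' \<Longrightarrow> R' \<le> R \<Longrightarrow> agree_on {- R'..R'} T T'"
  using agree_on_shift[of R T T' R' 0] by simp

lemma agree_on_shift_left:
  "agree_on {- R..R} (translate s T) T' \<Longrightarrow> R' + \<bar>s\<bar> \<le> R \<Longrightarrow> agree_on {- R'..R'} T (translate (- s) T')"
  using agree_on_shift[of R "translate s T" T' R' "- s"] by simp

lemma tile_nondegenerate: "is_tiling T \<Longrightarrow> ({a..b}, l) \<in> T \<Longrightarrow> a < b"
  unfolding is_tiling_def by (fastforce simp: Icc_eq_Icc)

lemma tile_interval:
  assumes "is_tiling T" "t \<in> T" obtains a b l where "a < b" "t = ({a..b}, l)"
  using assms unfolding is_tiling_def by fastforce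

lemma tiling_covers:
  assumes T: "is_tiling T" obtains a b l where "({a..b}, l) \<in> T" "a \<le> x" "x \<le> b" "a < b"
proof -
  have "x \<in> \<Union> (fst ` T)" using T unfolding is_tiling_def by simp
  then obtain t where t: "t \<in> T" "x \<in> fst t" by auto
  show thesis by (rule tile_interval[OF T t(1)]) (use t that in auto)
qed

lemma tiles_overlap_eq:
  assumes T: "is_tiling T" "({a..b}, l) \<in> T" "({c..d}, l') \<in> T" and "a < d" "c < b"
  shows "a = c \<and> b = d \<and> l = l'"
proof (rule ccontr)
  assume "\<not> ?thesis"
  then have "({a..b}, l) \<noteq> ({c..d}, l')" using tile_nondegenerate[OF T(1,2)] by (auto simp: Icc_eq_Icc)
  from is_tiling_disjoint[OF T this] have "{a<..<b} \<inter> {c<..<d} = {}" by simp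
  moreover have "(max a c + min b d) / 2 \<in> {a<..<b} \<inter> {c<..<d}"
    using tile_nondegenerate[OF T(1,2)] tile_nondegenerate[OF T(1,3)] assms(4,5)
    by (auto simp: max_def min_def field_simps)
  ultimately show False by blast
qed

lemma is_tilingI:
  assumes "\<And>t. t \<in> T \<Longrightarrow> \<exists>a b. a < b \<and> fst t = {a..b}" and "finite (snd ` T)"
    and "\<And>t t'. t \<in> T \<Longrightarrow> t' \<in> T \<Longrightarrow> snd t = snd t' \<Longrightarrow> measure lebesgue (fst t) = measure lebesgue (fst t')"
    and "\<And>t t'. t \<in> T \<Longrightarrow> t' \<in> T \<Longrightarrow> t \<noteq> t' \<Longrightarrow> interior (fst t) \<inter> interior (fst t') = {}"
    and "\<And>x. x \<in> \<Union> (fst ` T)"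
  shows "is_tiling T"
proof -
  have "\<forall>t\<in>T. \<exists>a b. a < b \<and> fst t = {a..b}" using assms(1) by blast
  moreover have "\<forall>t\<in>T. \<forall>t'\<in>T. snd t = snd t' \<longrightarrow> measure lebesgue (fst t) = measure lebesgue (fst t')"
    using assms(3) by blast
  moreover have "\<forall>t\<in>T. \<forall>t'\<in>T. t \<noteq> t' \<longrightarrow> interior (fst t) \<inter> interior (fst t') = {}"
    using assms(4) by blast
  moreover have "\<Union> (fst ` T) = UNIV" using assms(5) by (intro equalityI subsetI UNIV_I)
  ultimately show ?thesis
    unfolding is_tiling_def case_prod_beta using assms(2) by (intro conjI)
qed

lemma is_tiling_lengths:
  assumes "is_tiling T" "t \<in> T" "t' \<in> T" "snd t = snd t'"
  shows "measure lebesgue (fst t) = measure lebesgue (fst t')"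
proof -
  have "\<forall>t\<in>T. \<forall>t'\<in>T. snd t = snd t' \<longrightarrow> measure lebesgue (fst t) = measure lebesgue (fst t')"
    using assms(1) unfolding is_tiling_def case_prod_beta by (elim conjE)
  from bspec[OF bspec[OF this assms(2)] assms(3)] show ?thesis using assms(4) by simp
qed

lemma is_tiling_finite_labels: "is_tiling T \<Longrightarrow> finite (snd ` T)"
  unfolding is_tiling_def by (elim conjE)

lemma is_tiling_translate:
  assumes T: "is_tiling T" shows "is_tiling (translate s T)"
proof -
  have len: "measure lebesgue (fst (tile_translate s t)) = measure lebesgue (fst t)" if "t \<in> T" for t
    by (rule tile_interval[OF T that]) simp
  have 1: "\<exists>a b. a < b \<and> fst t = {a..b}" if "t \<in> translate s T" for t
    using that tile_interval[OF T] unfolding translate_def by (smt (verit) fst_conv imageE tile_translate_Icc)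
  have 2: "snd ` translate s T = snd ` T"
    by (simp add: translate_def image_image tile_translate_def)
  have 3: "measure lebesgue (fst t) = measure lebesgue (fst t')"
    if "t \<in> translate s T" "t' \<in> translate s T" "snd t = snd t'" for t t'
  proof -
    obtain u u' where u: "u \<in> T" "u' \<in> T" "t = tile_translate s u" "t' = tile_translate s u'"
      using \<open>t \<in> translate s T\<close> \<open>t' \<in> translate s T\<close> by (auto simp: translate_def)
    then have "snd u = snd u'" using \<open>snd t = snd t'\<close> by (simp add: tile_translate_def)
    then have "measure lebesgue (fst u) = measure lebesgue (fst u')"
      by (rule is_tiling_lengths[OF T u(1,2)])
    then show ?thesis using len u by simp
  qed
  have 4: "interior (fst t) \<inter> interior (fst t') = {}"
    if "t \<in> translate s T" "t' \<in> translate s T" "t \<noteq> t'" for t t'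
  proof -
    obtain u u' where u: "u \<in> T" "u' \<in> T" "t = tile_translate s u" "t' = tile_translate s u'"
      using \<open>t \<in> translate s T\<close> \<open>t' \<in> translate s T\<close> by (auto simp: translate_def)
    have "interior (fst u) \<inter> interior (fst u') = {}"
      using is_tiling_disjoint[OF T u(1,2)] u(3,4) that(3) by blast
    moreover have "interior (fst (tile_translate s w)) = (\<lambda>x. x - s) ` interior (fst w)" for w :: "'a tile"
      using interior_translation[of "- s" "fst w"] by (simp add: tile_translate_def)
    ultimately show ?thesis using u(3,4) by auto
  qed
  have 5: "x \<in> \<Union> (fst ` translate s T)" for x
  proof -
    obtain a b l where "({a..b}, l) \<in> T" "a \<le> x + s" "x + s \<le> b" by (rule tiling_covers[OF T])
    then have "({a - s..b - s}, l) \<in> translate s T" "x \<in> {a - s..b - s}" by (auto simp: in_translate_iff)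
    then show ?thesis by force
  qed
  have 6: "finite (snd ` translate s T)" using is_tiling_finite_labels[OF T] by (simp only: 2)
  show ?thesis by (rule is_tilingI) (fact 1 6 3 4 5)+
qed

lemma is_tiling_translate_iff [simp]: "is_tiling (translate s T) \<longleftrightarrow> is_tiling T"
  using is_tiling_translate[of "translate s T" "- s"] is_tiling_translate[of T s] by auto

lemma finite_tile_lengths:
  assumes T: "is_tiling T"
  shows "finite {b - a | a b l. ({a..b}, l) \<in> T}"
proof -
  define g where "g l = measure lebesgue (fst (SOME t. t \<in> T \<and> snd t = l))" for l
  have "b - a = g l" if t: "({a..b}, l) \<in> T" for a b l
  proof -
    have "\<exists>t. t \<in> T \<and> snd t = l" using t by force
    from someI_ex[OF this] have "measure lebesgue {a..b} = g l"
      using is_tiling_lengths[OF T t] by (simp add: g_def)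
    then show ?thesis using tile_nondegenerate[OF T t] by simp
  qed
  then have "{b - a | a b l. ({a..b}, l) \<in> T} \<subseteq> g ` snd ` T" by force
  moreover have "finite (snd ` T)" by (rule is_tiling_finite_labels[OF T])
  ultimately show ?thesis by (meson finite_imageI finite_subset)
qed

lemma tile_length_bounds:
  assumes T: "is_tiling T"
  shows "\<exists>m M. 0 < m \<and> 0 < M \<and> (\<forall>a b l. ({a..b}, l) \<in> T \<longrightarrow> m \<le> b - a \<and> b - a \<le> M)"
proof -
  define \<Lambda> where "\<Lambda> = {b - a | a b l. ({a..b}, l) \<in> T}"
  have fin: "finite \<Lambda>" using finite_tile_lengths[OF T] by (simp add: \<Lambda>_def)
  obtain a b l where "({a..b}, l) \<in> T" by (rule tiling_covers[OF T])
  then have ne: "\<Lambda> \<noteq> {}" by (auto simp: \<Lambda>_def)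
  have pos: "\<forall>x\<in>\<Lambda>. 0 < x" using tile_nondegenerate[OF T] by (auto simp: \<Lambda>_def)
  have *: "\<And>a b l. ({a..b}, l) \<in> T \<Longrightarrow> b - a \<in> \<Lambda>" by (auto simp: \<Lambda>_def)
  have "0 < Min \<Lambda>" using Min_in[OF fin ne] pos by blast
  moreover have "Min \<Lambda> \<le> b - a \<and> b - a \<le> Max \<Lambda>" if "({a..b}, l) \<in> T" for a b l
    using Min_le[OF fin] Max_ge[OF fin] *[OF that] by blast
  moreover have "0 < Max \<Lambda>" using Max_in[OF fin ne] pos by blast
  ultimately show ?thesis by blast
qed

text \<open>The covering condition alone does not rule out tiles accumulating at \<open>b\<close>;
  the minimal length \<open>m\<close> does, as any tile in a gap between \<open>b\<close> and
  \<open>b + m / 2\<close> would be too short.\<close>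

lemma next_tile:
  assumes T: "is_tiling T" and t: "({a..b}, l) \<in> T"
  obtains d l' where "({b..d}, l') \<in> T"
proof -
  obtain m M where m: "0 < m" "0 < M" "\<And>a b l. ({a..b}, l) \<in> T \<Longrightarrow> m \<le> b - a \<and> b - a \<le> M"
    using tile_length_bounds[OF T] by blast
  have ab: "a < b" by (rule tile_nondegenerate[OF T t])
  obtain c d l' where c: "({c..d}, l') \<in> T" "c \<le> b + m / 2" "b + m / 2 \<le> d" by (rule tiling_covers[OF T])
  have "b \<le> c" using tiles_overlap_eq[OF T t c(1)] c m(1) ab by force
  have "c = b"
  proof (rule ccontr)
    assume "c \<noteq> b"
    with \<open>b \<le> c\<close> have bc: "b < c" by simp
    obtain p q l'' where p: "({p..q}, l'') \<in> T" "p \<le> (b + c) / 2" "(b + c) / 2 \<le> q"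
      by (rule tiling_covers[OF T])
    have "b \<le> p" using tiles_overlap_eq[OF T t p(1)] p bc ab by force
    moreover have "q \<le> c" using tiles_overlap_eq[OF T p(1) c(1)] p bc c tile_nondegenerate[OF T c(1)] by force
    ultimately show False using m(3)[OF p(1)] m(1) c(2) by simp
  qed
  then show thesis using that c(1) by blast
qed

text \<open>Induction on the number of minimal tile lengths in the distance: stepping from one tile
  to the next writes the difference as a sum of boundedly many tile lengths, of which there are
  finitely many.\<close>

lemma finite_vertex_differences:
  assumes T: "is_tiling T"
  shows "\<exists>V. finite V \<and> (\<forall>a b l c d l'. ({a..b}, l) \<in> T \<longrightarrow> ({c..d}, l') \<in> T \<longrightarrow> \<bar>c - a\<bar> \<le> r \<longrightarrow> c - a \<in> V)"
proof -
  obtain m M where m: "0 < m" "0 < M" "\<And>a b l. ({a..b}, l) \<in> T \<Longrightarrow> m \<le> b - a \<and> b - a \<le> M"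
    using tile_length_bounds[OF T] by blast
  define \<Lambda> where "\<Lambda> = {b - a | a b l. ({a..b}, l) \<in> T}"
  have \<Lambda>: "finite \<Lambda>" using finite_tile_lengths[OF T] by (simp add: \<Lambda>_def)
  have ind: "\<exists>V. finite V \<and> (\<forall>a b l c d l'. ({a..b}, l) \<in> T \<longrightarrow> ({c..d}, l') \<in> T \<longrightarrow> a \<le> c \<longrightarrow>
      c - a \<le> real n * m \<longrightarrow> c - a \<in> V)" for n
  proof (induction n)
    case 0
    then show ?case by (intro exI[of _ "{0}"]) auto
  next
    case (Suc n)
    then obtain V where V: "finite V" "\<And>a b l c d l'. ({a..b}, l) \<in> T \<Longrightarrow> ({c..d}, l') \<in> T \<Longrightarrow> a \<le> c \<Longrightarrow>
      c - a \<le> real n * m \<Longrightarrow> c - a \<in> V" by blast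
    have "c - a \<in> insert 0 ((\<lambda>(v, w). v + w) ` (V \<times> \<Lambda>))"
      if t: "({a..b}, l) \<in> T" "({c..d}, l') \<in> T" "a \<le> c" "c - a \<le> real (Suc n) * m" for a b l c d l'
    proof (cases "a = c")
      case False
      obtain e l'' where e: "({b..e}, l'') \<in> T" by (rule next_tile[OF T t(1)])
      have "b \<le> c" using tiles_overlap_eq[OF T t(1,2)] False t(3) tile_nondegenerate[OF T t(2)] by force
      moreover have "c - b \<le> real n * m" using m(3)[OF t(1)] t(4) by (simp add: algebra_simps)
      ultimately have "c - b \<in> V" using V(2) e t(2) by blast
      moreover have "b - a \<in> \<Lambda>" using t(1) by (auto simp: \<Lambda>_def)
      ultimately show ?thesis by (force simp: image_iff)
    qed simp
    moreover have "finite (insert 0 ((\<lambda>(v, w). v + w) ` (V \<times> \<Lambda>)))" using V(1) \<Lambda> by simp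
    ultimately show ?case by blast
  qed
  obtain n where n: "r \<le> real n * m"
    using reals_Archimedean2[of "r / m"] m(1) by (auto simp: field_simps intro: less_imp_le)
  obtain V where V: "finite V" "\<And>a b l c d l'. ({a..b}, l) \<in> T \<Longrightarrow> ({c..d}, l') \<in> T \<Longrightarrow> a \<le> c \<Longrightarrow>
      c - a \<le> real n * m \<Longrightarrow> c - a \<in> V"
    using ind[of n] by blast
  have "c - a \<in> V \<union> uminus ` V"
    if t: "({a..b}, l) \<in> T" "({c..d}, l') \<in> T" "\<bar>c - a\<bar> \<le> r" for a b l c d l'
  proof (cases "a \<le> c")
    case True
    then show ?thesis using V(2)[OF t(1,2)] t(3) n by simp
  next
    case False
    then have "a - c \<in> V" using V(2)[OF t(2,1)] t(3) n by simp
    then have "- (a - c) \<in> uminus ` V" by (rule imageI)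
    then show ?thesis by simp
  qed
  then show ?thesis using V(1) by (intro exI[of _ "V \<union> uminus ` V"]) auto
qed

text \<open>A nearby tile is determined by its offset, length and label, each from a finite set. One
  finite \<open>D\<close> contains all recentred patches, so there are only finitely many of
  them.\<close>

lemma finite_local_complexity:
  assumes T: "is_tiling T"
  shows "\<exists>D. finite D \<and> (\<forall>a b l. ({a..b}, l) \<in> T \<longrightarrow> translate a (patch T {a - r..b + r}) \<subseteq> D)"
proof -
  obtain m M where m: "0 < m" "0 < M" "\<And>a b l. ({a..b}, l) \<in> T \<Longrightarrow> m \<le> b - a \<and> b - a \<le> M"
    using tile_length_bounds[OF T] by blast
  obtain V where V: "finite V" "\<And>a b l c d l'. ({a..b}, l) \<in> T \<Longrightarrow> ({c..d}, l') \<in> T \<Longrightarrow>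
      \<bar>c - a\<bar> \<le> \<bar>r\<bar> + M \<Longrightarrow> c - a \<in> V"
    using finite_vertex_differences[OF T, of "\<bar>r\<bar> + M"] by blast
  define \<Lambda> where "\<Lambda> = {b - a | a b l. ({a..b}, l) \<in> T}"
  have \<Lambda>: "finite \<Lambda>" using finite_tile_lengths[OF T] by (simp add: \<Lambda>_def)
  define D where "D = (\<lambda>(v, w, l). ({v..v + w}, l)) ` (V \<times> \<Lambda> \<times> snd ` T)"
  have "finite (snd ` T)" by (rule is_tiling_finite_labels[OF T])
  then have "finite D" using V(1) \<Lambda> by (simp add: D_def)
  moreover have "translate a (patch T {a - r..b + r}) \<subseteq> D" if t: "({a..b}, l) \<in> T" for a b l
  proof
    fix u assume "u \<in> translate a (patch T {a - r..b + r})"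
    then have u: "tile_translate (- a) u \<in> T" "fst (tile_translate (- a) u) \<inter> {a - r..b + r} \<noteq> {}"
      by (auto simp: in_translate_iff patch_def)
    obtain c d l' where c: "c < d" "tile_translate (- a) u = ({c..d}, l')"
      by (rule tile_interval[OF T u(1)])
    have "u = tile_translate a (tile_translate (- a) u)" by simp
    also have "\<dots> = ({c - a..(c - a) + (d - c)}, l')" by (simp add: c(2))
    finally have ueq: "u = ({c - a..(c - a) + (d - c)}, l')" .
    have cT: "({c..d}, l') \<in> T" using u c by simp
    obtain z where "z \<in> {c..d}" "z \<in> {a - r..b + r}" using u(2) unfolding c(2) fst_conv by blast
    then have "\<bar>c - a\<bar> \<le> \<bar>r\<bar> + M" using m(3)[OF t] m(3)[OF cT] by (auto simp: abs_le_iff)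
    then have "c - a \<in> V" using V(2)[OF t cT] by blast
    moreover have "d - c \<in> \<Lambda>" using cT by (auto simp: \<Lambda>_def)
    moreover have "l' \<in> snd ` T" using cT by force
    ultimately show "u \<in> D" unfolding D_def ueq
      by (intro image_eqI[of _ _ "(c - a, d - c, l')"]) auto
  qed
  ultimately show ?thesis by blast
qed

text \<open>One inclusion is enough because \<open>S\<close> covers the line: a tile of
  \<open>S'\<close> near the interval overlaps some tile of \<open>S\<close>, which also lies in
  \<open>S'\<close> and so equals it. The margin 1 leaves room to find an interior overlap.\<close>

lemma agree_on_if_subset:
  assumes S: "is_tiling S" "is_tiling S'" and sub: "patch S {- (R + 1)..R + 1} \<subseteq> S'"
  shows "agree_on {- R..R} S S'"
  unfolding agree_on_iff
proof (intro allI impI iffI)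
  fix t assume "fst t \<inter> {- R..R} \<noteq> {}" "t \<in> S"
  then have "t \<in> patch S {- (R + 1)..R + 1}" by (fastforce simp: patch_def)
  then show "t \<in> S'" using sub by blast
next
  fix t assume t: "fst t \<inter> {- R..R} \<noteq> {}" "t \<in> S'"
  obtain a b l where ab: "a < b" "t = ({a..b}, l)" by (rule tile_interval[OF S(2) t(2)])
  obtain x where x: "a \<le> x" "x \<le> b" "- R \<le> x" "x \<le> R"
    using t(1) unfolding ab(2) fst_conv by (metis IntE atLeastAtMost_iff ex_in_conv)
  \<comment> \<open>Moving from \<open>x\<close> towards the midpoint by at most 1 reaches an
    interior point of the tile.\<close>
  define z where "z = (if x \<le> (a + b) / 2 then min (x + 1) ((a + b) / 2) else max (x - 1) ((a + b) / 2))"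
  have z: "a < z" "z < b" "\<bar>z - x\<bar> \<le> 1" using x ab(1) by (auto simp: z_def min_def max_def field_simps)
  obtain c d l' where c: "({c..d}, l') \<in> S" "c \<le> z" "z \<le> d" by (rule tiling_covers[OF S(1)])
  have "z \<in> {c..d} \<inter> {- (R + 1)..R + 1}" using c z x by auto
  then have "({c..d}, l') \<in> patch S {- (R + 1)..R + 1}" using c by (auto simp: patch_def)
  then have "({c..d}, l') \<in> S'" using sub by blast
  then have "a = c \<and> b = d \<and> l = l'" using tiles_overlap_eq[OF S(2), of a b l c d l'] t(2) ab c z by auto
  then show "t \<in> S" using c ab by simp
qed

text \<open>Repetitivity gives a length for each pattern separately. There are finitely many
  collared tiles up to translation, so one length serves them all, and the collar of the tile over
  \<open>x\<close> determines what is seen from \<open>x\<close>.\<close>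

lemma repetitive_recurrent:
  assumes T: "is_tiling T" and rep: "repetitive T"
  shows "\<exists>L>0. \<forall>x c. \<exists>y. c \<le> y \<and> y \<le> c + L \<and> agree_on {- R..R} (translate x T) (translate y T)"
proof -
  define r where "r = R + 1"
  obtain D where D: "finite D" "\<And>a b l. ({a..b}, l) \<in> T \<Longrightarrow> translate a (patch T {a - r..b + r}) \<subseteq> D"
    using finite_local_complexity[OF T, of r] by blast
  define P where "P = {translate a (patch T {a - r..b + r}) | a b l. ({a..b}, l) \<in> T}"
  have "P \<subseteq> Pow D" using D(2) by (auto simp: P_def)
  then have finP: "finite P" using D(1) by (meson finite_Pow_iff finite_subset)
  have "\<exists>L>0. \<forall>c. \<exists>s. translate s Q \<subseteq> T \<and> \<Union> (fst ` translate s Q) \<subseteq> {c..c + L}" if "Q \<in> P" for Q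
  proof -
    obtain a b l where Q: "({a..b}, l) \<in> T" "Q = translate a (patch T {a - r..b + r})"
      using \<open>Q \<in> P\<close> by (auto simp: P_def)
    have "finite Q" unfolding Q(2) by (rule finite_subset[OF D(2)[OF Q(1)] D(1)])
    then have "finite (translate (- a) Q)" by (simp add: translate_def)
    then have "finite (patch T {a - r..b + r})" by (simp add: Q(2))
    moreover have "patch T {a - r..b + r} \<subseteq> T" by (auto simp: patch_def)
    ultimately have "\<exists>L>0. \<forall>c. \<exists>s. translate s (patch T {a - r..b + r}) \<subseteq> T \<and>
        \<Union> (fst ` translate s (patch T {a - r..b + r})) \<subseteq> {c..c + L}"
      using rep unfolding repetitive_def by (elim allE[of _ "patch T {a - r..b + r}"]) simp
    then obtain L where L: "0 < L" "\<And>c. \<exists>s. translate s (patch T {a - r..b + r}) \<subseteq> T \<and>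
        \<Union> (fst ` translate s (patch T {a - r..b + r})) \<subseteq> {c..c + L}"
      by blast
    have "\<exists>s. translate s Q \<subseteq> T \<and> \<Union> (fst ` translate s Q) \<subseteq> {c..c + L}" for c
    proof -
      obtain s where s: "translate s (patch T {a - r..b + r}) \<subseteq> T \<and>
        \<Union> (fst ` translate s (patch T {a - r..b + r})) \<subseteq> {c..c + L}" using L(2) by blast
      have "translate (s - a) Q = translate s (patch T {a - r..b + r})" by (simp add: Q(2))
      then show ?thesis using s by metis
    qed
    then show ?thesis using L(1) by blast
  qed
  then obtain len where len: "\<And>Q. Q \<in> P \<Longrightarrow> 0 < len Q \<and> (\<forall>c. \<exists>s. translate s Q \<subseteq> T \<and> \<Union> (fst ` translate s Q) \<subseteq> {c..c + len Q})"
    by metis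
  define L where "L = 1 + sum len P"
  have L: "len Q \<le> L" if "Q \<in> P" for Q
    using member_le_sum[of Q P len] that finP len by (force simp: L_def)
  have "0 < L" unfolding L_def using sum_nonneg[of P len] len by (smt (verit))
  moreover have "\<exists>y. c \<le> y \<and> y \<le> c + L \<and> agree_on {- R..R} (translate x T) (translate y T)" for x c
  proof -
    obtain a b l where ab: "({a..b}, l) \<in> T" "a \<le> x" "x \<le> b" by (rule tiling_covers[OF T])
    define Q where "Q = translate a (patch T {a - r..b + r})"
    have "Q \<in> P" using ab(1) by (auto simp: P_def Q_def)
    then obtain s where s: "translate s Q \<subseteq> T" "\<Union> (fst ` translate s Q) \<subseteq> {c..c + len Q}" using len by blast
    define y where "y = x - (s + a)"
    show ?thesis
    proof (cases "0 \<le> r")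
      case True
      have "({a..b}, l) \<in> patch T {a - r..b + r}" using ab True by (force simp: patch_def)
      then have "({a - (s + a)..b - (s + a)}, l) \<in> translate s Q" by (simp add: Q_def in_translate_iff)
      then have "{a - (s + a)..b - (s + a)} \<subseteq> {c..c + len Q}" using s(2) by force
      moreover have "y \<in> {a - (s + a)..b - (s + a)}" using ab by (auto simp: y_def)
      ultimately have "c \<le> y" "y \<le> c + L" using L[OF \<open>Q \<in> P\<close>] by auto
      moreover have "patch (translate x T) {- (R + 1)..R + 1} \<subseteq> translate y T"
      proof -
        have "patch (translate x T) {- (R + 1)..R + 1} = translate x (patch T {x - r..x + r})"
          by (simp add: patch_translate r_def algebra_simps)
        also have "\<dots> \<subseteq> translate x (patch T {a - r..b + r})"
          by (rule translate_mono) (use ab in \<open>force simp: patch_def\<close>)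
        also have "\<dots> = translate y (translate s Q)" by (simp add: Q_def y_def)
        also have "\<dots> \<subseteq> translate y T" by (rule translate_mono[OF s(1)])
        finally show ?thesis .
      qed
      then have "agree_on {- R..R} (translate x T) (translate y T)"
        using T by (intro agree_on_if_subset) simp_all
      ultimately show ?thesis by blast
    next
      case False
      \<comment> \<open>For \<open>R < - 1\<close> the patch may miss even the tile over
        \<open>x\<close>, but then agreement is vacuous and \<open>c\<close> itself will do.\<close>
      then have "{- R..R} = {}" by (simp add: r_def)
      then have "agree_on {- R..R} (translate x T) (translate c T)" unfolding agree_on_iff by blast
      then show ?thesis using \<open>0 < L\<close> by force
    qed
  qed
  ultimately show ?thesis by blast
qed

section \<open>The hull of a tiling\<close>

lemma tiling_dist_less_agree:
  assumes "tiling_dist S S' < e" "e \<le> 1"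
  obtains s where "\<bar>s\<bar> \<le> e" "agree_on {- (1 / e - 1)..1 / e - 1} (translate s S) S'"
proof -
  obtain d where d: "within_dist d S S'" "d < e" by (rule tiling_dist_less[OF assms])
  then obtain s1 s2 where s: "\<bar>s1\<bar> \<le> d / 2" "\<bar>s2\<bar> \<le> d / 2"
    "agree_on {- (1 / d)..1 / d} (translate s1 S) (translate s2 S')" and d0: "0 < d"
    unfolding within_dist_def by blast
  have "1 / e \<le> 1 / d" using d d0 by (simp add: frac_le)
  then have "agree_on {- (1 / e - 1)..1 / e - 1} (translate (- s2) (translate s1 S)) (translate (- s2) (translate s2 S'))"
    using s(2) d(2) assms(2) by (intro agree_on_shift[OF s(3)]) auto
  moreover have "\<bar>s1 - s2\<bar> \<le> e" using s(1,2) d(2) by linarith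
  ultimately show thesis using that[of "s1 - s2"] by simp
qed

lemma agree_tiling_dist_le:
  assumes "agree_on {- R..R} (translate s S) S'" "\<bar>s\<bar> \<le> e / 2" "1 / e \<le> R" "0 < e" "e < 1"
  shows "tiling_dist S S' \<le> e"
proof (rule tiling_dist_le)
  have "agree_on {- (1 / e)..1 / e} (translate s S) (translate 0 S')"
    using agree_on_shrink[OF assms(1,3)] by simp
  then show "within_dist e S S'"
    unfolding within_dist_def using assms by (intro conjI exI[of _ s] exI[of _ 0]) auto
qed

lemma eq_if_agree_everywhere:
  assumes "is_tiling S" "is_tiling S'" and "\<And>R. agree_on {- R..R} S S'"
  shows "S = S'"
proof -
  have "S \<subseteq> S'" if S: "is_tiling S" and "\<And>R. agree_on {- R..R} S S'" for S S' :: "'a tiling"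
  proof
    fix t assume t: "t \<in> S"
    obtain a b l where ab: "a < b" "t = ({a..b}, l)" by (rule tile_interval[OF S t])
    then have "a \<in> fst t \<inter> {- \<bar>a\<bar>..\<bar>a\<bar>}" by auto
    then show "t \<in> S'" using that(2)[of "\<bar>a\<bar>"] t unfolding agree_on_iff by blast
  qed
  from this[of S S'] this[of S' S] show ?thesis using assms agree_on_sym by blast
qed

interpretation tilings: Metric_space "{T. is_tiling T}" tiling_dist
  by (rule Metric_space_tilings)

lemma mtopology_tilings: "tilings.mtopology = tiling_topology"
  by (simp add: tiling_topology_def)

lemma topspace_tiling_topology: "topspace tiling_topology = {T. is_tiling T}"
  unfolding mtopology_tilings[symmetric] by simp

text \<open>The small translation that the metric permits is absorbed into \<open>y\<close>, so that
  membership becomes exact agreement on every ball.\<close>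

lemma orbit_closure_iff:
  assumes T: "is_tiling T"
  shows "S \<in> orbit_closure T \<longleftrightarrow> is_tiling S \<and> (\<forall>R. \<exists>y. agree_on {- R..R} S (translate y T))"
proof -
  have *: "S \<in> orbit_closure T \<longleftrightarrow> is_tiling S \<and> (\<forall>r>0. \<exists>y. tiling_dist S (translate y T) < r)"
    unfolding orbit_closure_def mtopology_tilings[symmetric] tilings.metric_closure_of
    using T by auto
  show ?thesis
  proof
    assume L: "S \<in> orbit_closure T"
    have "\<exists>y. agree_on {- R..R} S (translate y T)" for R
    proof -
      define e where "e = 1 / (\<bar>R\<bar> + 2)"
      have e: "0 < e" "e \<le> 1" "1 / e - 1 = \<bar>R\<bar> + 1" by (auto simp: e_def)
      obtain y where "tiling_dist S (translate y T) < e" using L * e by blast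
      then obtain s where s: "\<bar>s\<bar> \<le> e" "agree_on {- (\<bar>R\<bar> + 1)..\<bar>R\<bar> + 1} (translate s S) (translate y T)"
        using tiling_dist_less_agree[OF _ e(2)] unfolding e(3) by blast
      have "agree_on {- R..R} S (translate (- s) (translate y T))"
        by (rule agree_on_shift_left[OF s(2)]) (use s(1) e in auto)
      then show ?thesis by auto
    qed
    then show "is_tiling S \<and> (\<forall>R. \<exists>y. agree_on {- R..R} S (translate y T))" using L * by blast
  next
    assume R: "is_tiling S \<and> (\<forall>R. \<exists>y. agree_on {- R..R} S (translate y T))"
    have "\<exists>y. tiling_dist S (translate y T) < r" if r: "0 < r" for r
    proof -
      define e where "e = min (r / 2) (1 / 2)"
      have e: "0 < e" "e < 1" "e < r" using r by (auto simp: e_def)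
      obtain y where "agree_on {- (1 / e)..1 / e} S (translate y T)" using R by blast
      then have "tiling_dist S (translate y T) \<le> e"
        using e by (intro agree_tiling_dist_le[of "1 / e" 0]) auto
      then show ?thesis using e(3) by (intro exI[of _ y]) simp
    qed
    then show "S \<in> orbit_closure T" using * R by blast
  qed
qed

locale tiling_hull =
  fixes \<Omega> :: "'l tiling set"
  assumes \<Omega>: "tiling_space \<Omega>"
begin

text \<open>The reference tiling of the theorem is an arbitrary element of the hull; repetitivity
  and non-periodicity are known for the generator and are carried to the other elements by their
  common patterns.\<close>

definition generator :: "'l tiling" where
  "generator = (SOME T. is_tiling T \<and> repetitive T \<and> \<not> periodic T \<and> \<Omega> = orbit_closure T)"

lemma generator: "is_tiling generator" "repetitive generator" "\<not> periodic generator"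
    "\<Omega> = orbit_closure generator"
proof -
  have *: "is_tiling generator \<and> repetitive generator \<and> \<not> periodic generator \<and> \<Omega> = orbit_closure generator"
    using someI_ex[OF \<Omega>[unfolded tiling_space_def]] unfolding generator_def .
  show "is_tiling generator" by (rule *[THEN conjunct1])
  show "repetitive generator" by (rule *[THEN conjunct2, THEN conjunct1])
  show "\<not> periodic generator" by (rule *[THEN conjunct2, THEN conjunct2, THEN conjunct1])
  show "\<Omega> = orbit_closure generator" by (rule *[THEN conjunct2, THEN conjunct2, THEN conjunct2])
qed

lemma hull_iff: "S \<in> \<Omega> \<longleftrightarrow> is_tiling S \<and> (\<forall>R. \<exists>y. agree_on {- R..R} S (translate y generator))"
  by (subst generator(4)) (rule orbit_closure_iff[OF generator(1)])

lemma hull_tiling: "S \<in> \<Omega> \<Longrightarrow> is_tiling S"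
  by (simp add: hull_iff)

lemma generator_in_hull: "generator \<in> \<Omega>"
  unfolding hull_iff using generator(1) by (auto intro: exI[of _ 0])

lemma hull_limit:
  assumes S: "is_tiling S" and "\<And>R. \<exists>S'\<in>\<Omega>. agree_on {- R..R} S S'"
  shows "S \<in> \<Omega>"
  unfolding hull_iff
proof (intro conjI allI S)
  fix R
  obtain S' where S': "S' \<in> \<Omega>" "agree_on {- R..R} S S'" using assms(2) by blast
  then obtain y where "agree_on {- R..R} S' (translate y generator)" unfolding hull_iff by blast
  then show "\<exists>y. agree_on {- R..R} S (translate y generator)" using agree_on_trans[OF S'(2)] by blast
qed

lemma hull_translate [simp]: "translate s S \<in> \<Omega> \<longleftrightarrow> S \<in> \<Omega>"
proof -
  have *: "translate s S \<in> \<Omega>" if S: "S \<in> \<Omega>" for s S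
    unfolding hull_iff
  proof (intro conjI allI)
    fix R
    obtain y where "agree_on {- (R + \<bar>s\<bar>)..R + \<bar>s\<bar>} S (translate y generator)" using S hull_iff by blast
    then have "agree_on {- R..R} (translate s S) (translate s (translate y generator))"
      by (rule agree_on_shift) simp
    then show "\<exists>y. agree_on {- R..R} (translate s S) (translate y generator)" by auto
  qed (use hull_tiling[OF S] in simp)
  show ?thesis using *[of S s] *[of "translate s S" "- s"] by auto
qed

text \<open>A long window of \<open>S'\<close> is a window of the generator, and there every pattern
  of \<open>S\<close> occurs within distance \<open>L\<close> of any place. The same
  \<open>L\<close> serves all pairs of elements.\<close>

lemma hull_minimal:
  "\<exists>L>0. \<forall>S\<in>\<Omega>. \<forall>S'\<in>\<Omega>. \<forall>c. \<exists>y. c \<le> y \<and> y \<le> c + L \<and> agree_on {- R..R} S (translate y S')"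
proof -
  obtain L where L: "0 < L" "\<And>x c. \<exists>y. c \<le> y \<and> y \<le> c + L \<and>
      agree_on {- R..R} (translate x generator) (translate y generator)"
    using repetitive_recurrent[OF generator(1,2), of R] by blast
  have "\<exists>y. c \<le> y \<and> y \<le> c + L \<and> agree_on {- R..R} S (translate y S')"
    if S: "S \<in> \<Omega>" "S' \<in> \<Omega>" for S S' c
  proof -
    \<comment> \<open>The window must contain the ball of radius \<open>R\<close> about every point
      of \<open>{c..c + L}\<close>.\<close>
    define K where "K = \<bar>R\<bar> + \<bar>c\<bar> + L"
    obtain x where x: "agree_on {- R..R} S (translate x generator)" using S hull_iff by blast
    obtain b where b: "agree_on {- K..K} S' (translate b generator)" using S hull_iff by blast
    obtain y where y: "b + c \<le> y" "y \<le> b + c + L"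
      "agree_on {- R..R} (translate x generator) (translate y generator)" using L(2) by blast
    have "agree_on {- R..R} (translate (y - b) S') (translate (y - b) (translate b generator))"
      by (rule agree_on_shift[OF b]) (use y L(1) in \<open>auto simp: K_def abs_le_iff\<close>)
    then have "agree_on {- R..R} (translate (y - b) S') (translate y generator)" by simp
    then have "agree_on {- R..R} S (translate (y - b) S')"
      using agree_on_trans[OF agree_on_trans[OF x y(3)] agree_on_sym] by blast
    then show ?thesis using y by (intro exI[of _ "y - b"]) auto
  qed
  then show ?thesis using L(1) by blast
qed

lemma hull_agree: "S \<in> \<Omega> \<Longrightarrow> S' \<in> \<Omega> \<Longrightarrow> \<exists>y. agree_on {- R..R} S (translate y S')"
  using hull_minimal[of R] by blast

lemma recurrent_line_hull:
  assumes T: "T \<in> \<Omega>"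
  shows "recurrent_line (\<lambda>R x y. agree_on {- R..R} (translate x T) (translate y T))"
proof
  fix R :: real
  have "translate x T \<in> \<Omega>" for x using T by simp
  then show "\<exists>L>0. \<forall>x a. \<exists>y\<ge>a. y \<le> a + L \<and> agree_on {- R..R} (translate x T) (translate y T)"
    using hull_minimal[of R] T by blast
next
  fix R R' s x y assume "agree_on {- R..R} (translate x T) (translate y T)" "R' + \<bar>s\<bar> \<le> R"
  from agree_on_shift[OF this]
  show "agree_on {- R'..R'} (translate (x + s) T) (translate (y + s) T)" by (simp add: add.commute)
qed (auto intro: agree_on_sym agree_on_trans)

text \<open>A period of one element passes to the generator, whose patterns all occur in that
  element. This is what makes displacements along an orbit well defined.\<close>

lemma hull_nonperiodic:
  assumes S: "S \<in> \<Omega>" and eq: "translate s S = translate s' S"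
  shows "s = s'"
proof (rule ccontr)
  assume "s \<noteq> s'"
  define p where "p = s - s'"
  have "translate (- s') (translate s S) = translate (- s') (translate s' S)" using eq by simp
  then have per: "translate p S = S" by (simp add: p_def)
  have "translate p generator = generator"
  proof (rule eq_if_agree_everywhere)
    fix R
    obtain y where y: "agree_on {- (R + \<bar>p\<bar>)..R + \<bar>p\<bar>} generator (translate y S)"
      using hull_agree[OF generator_in_hull S] by blast
    have "agree_on {- R..R} (translate p generator) (translate p (translate y S))"
      by (rule agree_on_shift[OF y]) simp
    moreover have "translate p (translate y S) = translate y (translate p S)" by (simp add: add.commute)
    ultimately show "agree_on {- R..R} (translate p generator) generator"
      using agree_on_sym[OF agree_on_shrink[OF y, of R]] unfolding per by (auto intro: agree_on_trans)
  qed (use generator(1) in auto)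
  moreover have "p \<noteq> 0" using \<open>s \<noteq> s'\<close> by (simp add: p_def)
  ultimately show False using generator(3) unfolding periodic_def by blast
qed

section \<open>Topology of the hull\<close>

lemma hull_topspace [simp]: "topspace (top_of_tilings \<Omega>) = \<Omega>"
  using hull_tiling by (auto simp: topspace_tiling_topology)

lemma Hausdorff_hull: "Hausdorff_space (top_of_tilings \<Omega>)"
  unfolding mtopology_tilings[symmetric] by (intro Hausdorff_space_subtopology tilings.Hausdorff_space_mtopology)

lemma continuous_map_into_hull:
  assumes "\<And>x. x \<in> topspace X \<Longrightarrow> H x \<in> \<Omega>"
    and "\<And>x d R. x \<in> topspace X \<Longrightarrow> 0 < d \<Longrightarrow>
      \<exists>U. openin X U \<and> x \<in> U \<and> (\<forall>y\<in>U. \<exists>s. \<bar>s\<bar> \<le> d \<and> agree_on {- R..R} (translate s (H x)) (H y))"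
  shows "continuous_map X (top_of_tilings \<Omega>) H"
  unfolding continuous_map_in_subtopology
proof
  show "H \<in> topspace X \<rightarrow> \<Omega>" using assms(1) by blast
  show "continuous_map X tiling_topology H"
    unfolding mtopology_tilings[symmetric] tilings.continuous_map_to_metric
  proof (intro ballI allI impI)
    fix x r :: real assume "0 < r"
    fix x assume x: "x \<in> topspace X"
    define e where "e = min (r / 2) (1 / 2)"
    have e: "0 < e" "e < 1" "e < r" using \<open>0 < r\<close> by (auto simp: e_def)
    obtain U where U: "openin X U" "x \<in> U"
      "\<And>y. y \<in> U \<Longrightarrow> \<exists>s. \<bar>s\<bar> \<le> e / 2 \<and> agree_on {- (1 / e)..1 / e} (translate s (H x)) (H y)"
      using assms(2)[OF x, of "e / 2" "1 / e"] e by auto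
    have "H y \<in> tilings.mball (H x) r" if y: "y \<in> U" for y
    proof -
      obtain s where s: "\<bar>s\<bar> \<le> e / 2" "agree_on {- (1 / e)..1 / e} (translate s (H x)) (H y)"
        using U(3)[OF y] by blast
      have "tiling_dist (H x) (H y) \<le> e" by (rule agree_tiling_dist_le[OF s(2,1)]) (use e in auto)
      moreover have "y \<in> topspace X" using y U(1) openin_subset by blast
      ultimately show ?thesis using e(3) assms(1) x hull_tiling by auto
    qed
    then show "\<exists>U. openin X U \<and> x \<in> U \<and> (\<forall>y\<in>U. H y \<in> tilings.mball (H x) r)" using U by blast
  qed
qed

text \<open>With its converse \<open>hull_openE\<close>, this describes a neighbourhood base at
  \<open>S\<close>: tilings that agree on a large ball with a small translate of \<open>S\<close>.
  Continuity arguments in the hull can work with these sets in place of the metric.\<close>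

lemma hull_neighbourhood:
  assumes S: "S \<in> \<Omega>" and d: "0 < d"
  obtains U where "openin (top_of_tilings \<Omega>) U" "S \<in> U"
    "\<And>S'. S' \<in> U \<Longrightarrow> \<exists>s. \<bar>s\<bar> \<le> d \<and> agree_on {- R..R} (translate s S) S'"
proof -
  define e where "e = min d (1 / (\<bar>R\<bar> + 2))"
  have e: "0 < e" "e \<le> d" using d by (auto simp: e_def)
  have "e \<le> 1 / (\<bar>R\<bar> + 2)" by (simp add: e_def)
  also have "\<dots> \<le> 1" by simp
  finally have e1: "e \<le> 1" .
  have eR: "R \<le> 1 / e - 1"
  proof -
    have "e * (\<bar>R\<bar> + 2) \<le> 1" using \<open>e \<le> 1 / (\<bar>R\<bar> + 2)\<close> by (simp add: field_simps)
    then have "\<bar>R\<bar> + 2 \<le> 1 / e" using e(1) by (simp add: field_simps)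
    then show ?thesis by linarith
  qed
  show thesis
  proof (rule that[of "tilings.mball S e \<inter> \<Omega>"])
    show "openin (top_of_tilings \<Omega>) (tilings.mball S e \<inter> \<Omega>)"
      unfolding mtopology_tilings[symmetric] by (intro openin_subtopology_Int) simp
    show "S \<in> tilings.mball S e \<inter> \<Omega>" using S hull_tiling e(1) by (simp add: tiling_dist_refl)
    fix S' assume "S' \<in> tilings.mball S e \<inter> \<Omega>"
    then have "tiling_dist S S' < e" by simp
    then obtain s where "\<bar>s\<bar> \<le> e" "agree_on {- (1 / e - 1)..1 / e - 1} (translate s S) S'"
      using tiling_dist_less_agree e1 by blast
    then show "\<exists>s. \<bar>s\<bar> \<le> d \<and> agree_on {- R..R} (translate s S) S'"
      using e eR agree_on_shrink by (meson order_trans)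
  qed
qed

lemma hull_continuous_mapD:
  assumes H: "continuous_map X (top_of_tilings \<Omega>) H" and x: "x \<in> topspace X" and d: "0 < d"
  obtains U where "openin X U" "x \<in> U"
    "\<And>y. y \<in> U \<Longrightarrow> \<exists>s. \<bar>s\<bar> \<le> d \<and> agree_on {- R..R} (translate s (H x)) (H y)"
proof -
  have "H x \<in> \<Omega>" using H x unfolding continuous_map_def by (auto simp: Pi_iff simp del: topspace_subtopology)
  then obtain U where U: "openin (top_of_tilings \<Omega>) U" "H x \<in> U"
    "\<And>S'. S' \<in> U \<Longrightarrow> \<exists>s. \<bar>s\<bar> \<le> d \<and> agree_on {- R..R} (translate s (H x)) S'"
    using hull_neighbourhood[OF _ d] by metis
  have "openin X {y \<in> topspace X. H y \<in> U}" using H U(1) by (rule openin_continuous_map_preimage)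
  then show thesis using that[of "{y \<in> topspace X. H y \<in> U}"] U x by auto
qed

lemma continuous_map_translate: "continuous_map (top_of_tilings \<Omega>) (top_of_tilings \<Omega>) (translate r)"
proof (rule continuous_map_into_hull)
  fix S d R assume "S \<in> topspace (top_of_tilings \<Omega>)" "0 < (d::real)"
  then obtain U where U: "openin (top_of_tilings \<Omega>) U" "S \<in> U"
    "\<And>S'. S' \<in> U \<Longrightarrow> \<exists>s. \<bar>s\<bar> \<le> d \<and> agree_on {- (R + \<bar>r\<bar>)..R + \<bar>r\<bar>} (translate s S) S'"
    using hull_neighbourhood[of S d "R + \<bar>r\<bar>"] by auto
  have "\<exists>s. \<bar>s\<bar> \<le> d \<and> agree_on {- R..R} (translate s (translate r S)) (translate r S')" if S': "S' \<in> U" for S'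
  proof -
    obtain s where s: "\<bar>s\<bar> \<le> d" "agree_on {- (R + \<bar>r\<bar>)..R + \<bar>r\<bar>} (translate s S) S'" using U(3)[OF S'] by blast
    have "agree_on {- R..R} (translate r (translate s S)) (translate r S')" by (rule agree_on_shift[OF s(2)]) simp
    then show ?thesis using s(1) by (auto simp: add.commute)
  qed
  then show "\<exists>U. openin (top_of_tilings \<Omega>) U \<and> S \<in> U \<and> (\<forall>S'\<in>U. \<exists>s. \<bar>s\<bar> \<le> d \<and> agree_on {- R..R} (translate s (translate r S)) (translate r S'))"
    using U by blast
qed auto

lemma hull_openE:
  assumes "openin (top_of_tilings \<Omega>) U" "S \<in> U"
  obtains d R where "0 < d"
    "\<And>S' s. S' \<in> \<Omega> \<Longrightarrow> \<bar>s\<bar> \<le> d \<Longrightarrow> agree_on {- R..R} (translate s S) S' \<Longrightarrow> S' \<in> U"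
proof -
  obtain V where V: "openin tilings.mtopology V" "U = V \<inter> \<Omega>" "S \<in> V"
    using assms unfolding openin_subtopology mtopology_tilings[symmetric] by blast
  then obtain r where r: "0 < r" "tilings.mball S r \<subseteq> V" unfolding tilings.openin_mtopology by blast
  define e where "e = min (r / 2) (1 / 2)"
  have e: "0 < e" "e < 1" "e < r" using r(1) by (auto simp: e_def)
  show thesis
  proof (rule that[of "e / 2" "1 / e"])
    show "0 < e / 2" using e(1) by simp
    fix S' s assume S': "S' \<in> \<Omega>" "\<bar>s\<bar> \<le> e / 2" "agree_on {- (1 / e)..1 / e} (translate s S) S'"
    have "tiling_dist S S' \<le> e" by (rule agree_tiling_dist_le[OF S'(3,2)]) (use e in auto)
    moreover have "S \<in> \<Omega>" using assms(2) V(2) by blast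
    ultimately show "S' \<in> U" using r(2) e(3) V(2) S'(1) hull_tiling by auto
  qed
qed

lemma hull_dense_orbit:
  assumes S: "S \<in> \<Omega>" "T \<in> \<Omega>"
  shows "S \<in> top_of_tilings \<Omega> closure_of range (\<lambda>x. translate x T)"
  unfolding in_closure_of
proof (intro conjI allI impI)
  show "S \<in> topspace (top_of_tilings \<Omega>)" using S(1) by (simp del: topspace_subtopology)
  fix U assume "S \<in> U \<and> openin (top_of_tilings \<Omega>) U"
  then obtain d R where d: "0 < (d::real)"
    "\<And>S' s. S' \<in> \<Omega> \<Longrightarrow> \<bar>s\<bar> \<le> d \<Longrightarrow> agree_on {- R..R} (translate s S) S' \<Longrightarrow> S' \<in> U"
    using hull_openE by metis
  obtain y where y: "agree_on {- R..R} S (translate y T)" using hull_agree[OF S] by blast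
  then have "translate y T \<in> U" using d(2)[of "translate y T" 0] d(1) S(2) by simp
  then show "\<exists>S'. S' \<in> range (\<lambda>x. translate x T) \<and> S' \<in> U" by blast
qed

end

section \<open>Paths in the hull\<close>

text \<open>Two placements of \<open>B\<close> that both carry the tile of \<open>A\<close> over 0,
  and differ by less than its length, would put two overlapping copies of this tile in
  \<open>B\<close>. Agreement at the single point 0 suffices.\<close>

lemma agree_offset_unique:
  assumes A: "is_tiling A"
  obtains m where "0 < m"
    "\<And>B s s'. is_tiling B \<Longrightarrow> agree_on {- 0..0} (translate s B) A \<Longrightarrow>
       agree_on {- 0..0} (translate s' B) A \<Longrightarrow> \<bar>s - s'\<bar> < m \<Longrightarrow> s = s'"
proof -
  obtain a b l where t: "({a..b}, l) \<in> A" "a \<le> 0" "0 \<le> b" "a < b" by (rule tiling_covers[OF A])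
  have "s = s'" if B: "is_tiling B" "agree_on {- 0..0} (translate s B) A"
    "agree_on {- 0..0} (translate s' B) A" and "\<bar>s - s'\<bar> < b - a" for B s s'
  proof -
    have "fst ({a..b}, l) \<inter> {- 0..0} \<noteq> {}" using t by auto
    then have "({a..b}, l) \<in> translate s B" "({a..b}, l) \<in> translate s' B"
      using B(2,3) t(1) unfolding agree_on_iff by blast+
    then have *: "({a + s..b + s}, l) \<in> B" "({a + s'..b + s'}, l) \<in> B" by (simp_all add: in_translate_iff)
    then have "a + s = a + s'" using tiles_overlap_eq[OF B(1) *] that(4) by linarith
    then show ?thesis by simp
  qed
  then show thesis using that[of "b - a"] t(4) by simp
qed

lemma locally_constant_connected:
  fixes X :: "real set" and P :: "real \<Rightarrow> bool"
  assumes "connected X" and step: "\<And>t. t \<in> X \<Longrightarrow> \<exists>d>0. \<forall>t'\<in>X. \<bar>t' - t\<bar> < d \<longrightarrow> P t' = P t"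
    and "a \<in> X" "b \<in> X" "P a"
  shows "P b"
proof -
  have op: "openin (top_of_set X) {t \<in> X. P t = c}" for c
    unfolding openin_euclidean_subtopology_iff
  proof (intro conjI ballI)
    fix x assume x: "x \<in> {t \<in> X. P t = c}"
    then obtain d where "0 < d" "\<And>t'. t' \<in> X \<Longrightarrow> \<bar>t' - x\<bar> < d \<Longrightarrow> P t' = P x"
      using step[of x] by blast
    then show "\<exists>e>0. \<forall>x'\<in>X. dist x' x < e \<longrightarrow> x' \<in> {t \<in> X. P t = c}"
      using x by (auto simp: dist_real_def)
  qed auto
  have "X - {t \<in> X. P t} = {t \<in> X. P t = False}" by auto
  then have "closedin (top_of_set X) {t \<in> X. P t}"
    using op[of False] by (simp add: closedin_def)
  moreover have "openin (top_of_set X) {t \<in> X. P t}" using op[of True] by simp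
  moreover have "a \<in> {t \<in> X. P t}" using assms by simp
  ultimately have "{t \<in> X. P t} = X" using assms(1) unfolding connected_clopen by blast
  then show ?thesis using assms(4) by blast
qed

context tiling_hull
begin

text \<open>The set of parameters at which the path agrees, up to the small translation, with its
  starting point out to radius \<open>R\<close> is clopen, for every \<open>R\<close>. So a path moves along its orbit.\<close>

lemma path_locally_in_orbit:
  fixes \<gamma> :: "real \<Rightarrow> 'l tiling"
  assumes \<gamma>: "continuous_map (top_of_set X) (top_of_tilings \<Omega>) \<gamma>" and X: "is_interval X"
    and t0: "t0 \<in> X" and \<epsilon>: "0 < \<epsilon>"
  obtains d where "0 < d" "\<And>t. t \<in> X \<Longrightarrow> \<bar>t - t0\<bar> < d \<Longrightarrow> \<exists>s. \<bar>s\<bar> < \<epsilon> \<and> \<gamma> t = translate s (\<gamma> t0)"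
proof -
  define A where "A = \<gamma> t0"
  have \<gamma>\<Omega>: "\<gamma> t \<in> \<Omega>" if "t \<in> X" for t
    using \<gamma> that unfolding continuous_map_def by (auto simp: Pi_iff simp del: topspace_subtopology)
  then have \<gamma>T: "is_tiling (\<gamma> t)" if "t \<in> X" for t using hull_tiling that by blast
  have near: "\<exists>d>0. \<forall>t'\<in>X. \<bar>t' - t\<bar> < d \<longrightarrow> (\<exists>s. \<bar>s\<bar> \<le> e \<and> agree_on {- R..R} (translate s (\<gamma> t')) (\<gamma> t))"
    if t: "t \<in> X" and e: "0 < e" for t e R
  proof -
    have "t \<in> topspace (top_of_set X)" using t by simp
    then obtain U where U: "openin (top_of_set X) U" "t \<in> U"
      "\<And>y. y \<in> U \<Longrightarrow> \<exists>s. \<bar>s\<bar> \<le> e \<and> agree_on {- (R + e)..R + e} (translate s (\<gamma> t)) (\<gamma> y)"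
      using hull_continuous_mapD[OF \<gamma> _ e, of t "R + e"] by metis
    obtain d where d: "0 < d" "\<And>t'. t' \<in> X \<Longrightarrow> dist t' t < d \<Longrightarrow> t' \<in> U"
      using U(1,2) unfolding openin_euclidean_subtopology_iff by blast
    have "\<exists>s. \<bar>s\<bar> \<le> e \<and> agree_on {- R..R} (translate s (\<gamma> t')) (\<gamma> t)" if t': "t' \<in> X" "\<bar>t' - t\<bar> < d" for t'
    proof -
      obtain s where s: "\<bar>s\<bar> \<le> e" "agree_on {- (R + e)..R + e} (translate s (\<gamma> t)) (\<gamma> t')"
        using U(3) d(2)[OF t'(1)] t'(2) by (auto simp: dist_real_def)
      have "agree_on {- R..R} (\<gamma> t) (translate (- s) (\<gamma> t'))"
        by (rule agree_on_shift_left[OF s(2)]) (use s(1) in simp)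
      then show ?thesis using s(1) agree_on_sym by (intro exI[of _ "- s"]) auto
    qed
    then show ?thesis using d(1) by blast
  qed
  obtain m where m: "0 < m" "\<And>B s s'. is_tiling B \<Longrightarrow> agree_on {- 0..0} (translate s B) A \<Longrightarrow>
       agree_on {- 0..0} (translate s' B) A \<Longrightarrow> \<bar>s - s'\<bar> < m \<Longrightarrow> s = s'"
    by (rule agree_offset_unique[OF \<gamma>T[OF t0, folded A_def]]) blast
  \<comment> \<open>Below, \<open>\<sigma> t + s\<close> is compared with
    \<open>\<sigma> t'\<close>; each of the three numbers is at most \<open>e\<close>, so a quarter
    of \<open>m\<close> keeps the difference under \<open>m\<close>.\<close>
  define e where "e = min (\<epsilon> / 2) (m / 4)"
  have e: "0 < e" "e < \<epsilon>" "4 * e \<le> m" using \<epsilon> m(1) by (auto simp: e_def)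
  obtain d where d: "0 < d" "\<And>t. t \<in> X \<Longrightarrow> \<bar>t - t0\<bar> < d \<Longrightarrow>
      \<exists>s. \<bar>s\<bar> \<le> e \<and> agree_on {- 0..0} (translate s (\<gamma> t)) A"
    using near[OF t0 e(1), of 0] unfolding A_def by blast
  define J where "J = X \<inter> {t0 - d<..<t0 + d}"
  have J: "t \<in> J \<longleftrightarrow> t \<in> X \<and> \<bar>t - t0\<bar> < d" for t by (auto simp: J_def abs_less_iff)
  have conn: "connected J"
    unfolding J_def using X by (intro is_interval_connected is_interval_Int) (auto simp: is_interval_oo)
  \<comment> \<open>Chosen pointwise, without continuity; uniqueness of small offsets makes the
    choices at nearby parameters consistent.\<close>
  define \<sigma> where "\<sigma> t = (SOME s. \<bar>s\<bar> \<le> e \<and> agree_on {- 0..0} (translate s (\<gamma> t)) A)" for t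
  have \<sigma>: "\<bar>\<sigma> t\<bar> \<le> e" "agree_on {- 0..0} (translate (\<sigma> t) (\<gamma> t)) A" if "t \<in> J" for t
    using someI_ex[OF d(2)] that unfolding J \<sigma>_def by blast+
  have step: "\<exists>d'>0. \<forall>t'\<in>J. \<bar>t' - t\<bar> < d' \<longrightarrow>
      (agree_on {- R..R} (translate (\<sigma> t') (\<gamma> t')) A \<longleftrightarrow> agree_on {- R..R} (translate (\<sigma> t) (\<gamma> t)) A)"
    if t: "t \<in> J" and R: "0 \<le> R" for t R
  proof -
    have tX: "t \<in> X" using t J by blast
    obtain d' where d': "0 < d'" "\<And>t'. t' \<in> X \<Longrightarrow> \<bar>t' - t\<bar> < d' \<Longrightarrow>
        \<exists>s. \<bar>s\<bar> \<le> e \<and> agree_on {- (R + e)..R + e} (translate s (\<gamma> t')) (\<gamma> t)"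
      using near[OF tX e(1), of "R + e"] by blast
    have "agree_on {- R..R} (translate (\<sigma> t') (\<gamma> t')) A \<longleftrightarrow> agree_on {- R..R} (translate (\<sigma> t) (\<gamma> t)) A"
      if t': "t' \<in> J" "\<bar>t' - t\<bar> < d'" for t'
    proof -
      obtain s where s: "\<bar>s\<bar> \<le> e" "agree_on {- (R + e)..R + e} (translate s (\<gamma> t')) (\<gamma> t)"
        using d'(2) t' J by blast
      have "agree_on {- R..R} (translate (\<sigma> t) (translate s (\<gamma> t'))) (translate (\<sigma> t) (\<gamma> t))"
        by (rule agree_on_shift[OF s(2)]) (use \<sigma>(1)[OF t] in simp)
      then have ag: "agree_on {- R..R} (translate (\<sigma> t + s) (\<gamma> t')) (translate (\<sigma> t) (\<gamma> t))" by simp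
      have "agree_on {- 0..0} (translate (\<sigma> t + s) (\<gamma> t')) A"
        by (rule agree_on_trans[OF agree_on_shrink[OF ag R] \<sigma>(2)[OF t]])
      moreover have "\<bar>\<sigma> t + s - \<sigma> t'\<bar> < m" using \<sigma>(1)[OF t] \<sigma>(1)[OF t'(1)] s(1) e m(1) by linarith
      moreover have "is_tiling (\<gamma> t')" using \<gamma>T t'(1) J by blast
      ultimately have "\<sigma> t + s = \<sigma> t'" using m(2) \<sigma>(2)[OF t'(1)] by blast
      then show ?thesis using ag by (simp add: agree_on_def)
    qed
    then show ?thesis using d'(1) by blast
  qed
  have t0J: "t0 \<in> J" using t0 d(1) J by simp
  have \<sigma>0: "\<sigma> t0 = 0"
    using m(2)[OF \<gamma>T[OF t0], of "\<sigma> t0" 0] \<sigma>[OF t0J] e m(1) by (simp add: A_def)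
  have all: "agree_on {- R..R} (translate (\<sigma> t) (\<gamma> t)) A" if t: "t \<in> J" and R: "0 \<le> R" for t R
  proof -
    have "agree_on {- R..R} (translate (\<sigma> t0) (\<gamma> t0)) A" by (simp add: \<sigma>0 A_def)
    with conn step[OF _ R] t0J t show ?thesis
      by (rule locally_constant_connected)
  qed
  have "\<exists>s. \<bar>s\<bar> < \<epsilon> \<and> \<gamma> t = translate s (\<gamma> t0)" if t: "t \<in> X" "\<bar>t - t0\<bar> < d" for t
  proof -
    have tJ: "t \<in> J" using t J by blast
    have "translate (\<sigma> t) (\<gamma> t) = A"
    proof (rule eq_if_agree_everywhere)
      show "agree_on {- R..R} (translate (\<sigma> t) (\<gamma> t)) A" for R
        using agree_on_shrink[OF all[OF tJ, of "\<bar>R\<bar>"], of R] by simp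
    qed (use \<gamma>T t t0 in \<open>auto simp: A_def\<close>)
    then have "translate (- \<sigma> t) A = translate (- \<sigma> t) (translate (\<sigma> t) (\<gamma> t))" by simp
    then have "\<gamma> t = translate (- \<sigma> t) A" by simp
    then show ?thesis using \<sigma>(1)[OF tJ] e(2) by (intro exI[of _ "- \<sigma> t"]) (auto simp: A_def)
  qed
  then show thesis using that d(1) by blast
qed

lemma path_in_orbit:
  fixes \<gamma> :: "real \<Rightarrow> 'l tiling"
  assumes \<gamma>: "continuous_map (top_of_set X) (top_of_tilings \<Omega>) \<gamma>" and X: "is_interval X"
    and ab: "a \<in> X" "b \<in> X"
  obtains s where "\<gamma> b = translate s (\<gamma> a)"
proof -
  let ?P = "\<lambda>t. \<exists>s. \<gamma> t = translate s (\<gamma> a)"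
  have conn: "connected X" using X by (rule is_interval_connected)
  have step: "\<exists>d>0. \<forall>t'\<in>X. \<bar>t' - t\<bar> < d \<longrightarrow> ?P t' = ?P t" if t: "t \<in> X" for t
  proof -
    obtain d where d: "0 < d" "\<And>t'. t' \<in> X \<Longrightarrow> \<bar>t' - t\<bar> < d \<Longrightarrow> \<exists>s. \<bar>s\<bar> < 1 \<and> \<gamma> t' = translate s (\<gamma> t)"
      using path_locally_in_orbit[OF \<gamma> X t, of 1] by (metis zero_less_one)
    have "?P t' = ?P t" if t': "t' \<in> X" "\<bar>t' - t\<bar> < d" for t'
    proof -
      obtain s where s: "\<gamma> t' = translate s (\<gamma> t)" using d(2)[OF t'] by blast
      then have "\<gamma> t = translate (- s) (\<gamma> t')" by simp
      then show ?thesis using s by (metis translate_translate)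
    qed
    then show ?thesis using d(1) by blast
  qed
  have "?P a" by (intro exI[of _ 0]) simp
  then have "?P b" using locally_constant_connected[of X ?P a b] conn step ab by blast
  then show thesis using that by blast
qed

lemma continuous_map_orbit:
  fixes X :: "real set"
  assumes S: "S \<in> \<Omega>" and h: "continuous_on X h"
  shows "continuous_map (top_of_set X) (top_of_tilings \<Omega>) (\<lambda>t. translate (h t) S)"
proof (rule continuous_map_into_hull)
  fix t :: real and d R :: real assume t: "t \<in> topspace (top_of_set X)" and d: "0 < d"
  then obtain e where e: "0 < e" "\<And>t'. t' \<in> X \<Longrightarrow> dist t' t < e \<Longrightarrow> dist (h t') (h t) < d"
    using h unfolding continuous_on_iff by (metis topspace_euclidean_subtopology)
  show "\<exists>U. openin (top_of_set X) U \<and> t \<in> U \<and>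
      (\<forall>t'\<in>U. \<exists>s. \<bar>s\<bar> \<le> d \<and> agree_on {- R..R} (translate s (translate (h t) S)) (translate (h t') S))"
  proof (intro exI[of _ "X \<inter> ball t e"] conjI ballI)
    show "openin (top_of_set X) (X \<inter> ball t e)" by (simp add: openin_open_Int)
    show "t \<in> X \<inter> ball t e" using t e by simp
    fix t' assume "t' \<in> X \<inter> ball t e"
    then have "\<bar>h t' - h t\<bar> \<le> d" using e(2)[of t'] by (auto simp: dist_commute dist_real_def)
    then show "\<exists>s. \<bar>s\<bar> \<le> d \<and> agree_on {- R..R} (translate s (translate (h t) S)) (translate (h t') S)"
      by (intro exI[of _ "h t' - h t"]) simp
  qed
qed (use S in simp)

lemma path_component_hull:
  assumes S: "S \<in> \<Omega>"
  shows "path_component_of (top_of_tilings \<Omega>) S S' \<longleftrightarrow> (\<exists>s. S' = translate s S)"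
proof
  assume "path_component_of (top_of_tilings \<Omega>) S S'"
  then obtain g where g0: "pathin (top_of_tilings \<Omega>) g \<and> g 0 = S \<and> g 1 = S'"
    unfolding path_component_of_def by (rule exE)
  then have g: "continuous_map (top_of_set {0..1}) (top_of_tilings \<Omega>) g" by (simp add: pathin_def)
  obtain s where "g 1 = translate s (g 0)" by (rule path_in_orbit[OF g(1), of 0 1]) (auto simp: is_interval_cc)
  then show "\<exists>s. S' = translate s S" using g0 by (intro exI[of _ s]) simp
next
  assume "\<exists>s. S' = translate s S"
  then obtain s where s: "S' = translate s S" by blast
  have "continuous_map (top_of_set {0..1}) (top_of_tilings \<Omega>) (\<lambda>t. translate (t * s) S)"
    by (intro continuous_map_orbit S continuous_intros)
  then show "path_component_of (top_of_tilings \<Omega>) S S'"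
    unfolding path_component_of_def pathin_def using s by (intro exI[of _ "\<lambda>t. translate (t * s) S"]) auto
qed

text \<open>Since path components are orbits, preserving them means having a displacement at every
  point; nothing is said about how it varies.\<close>

lemma preserves_path_components_iff:
  assumes "\<And>S. S \<in> \<Omega> \<Longrightarrow> H S \<in> \<Omega>"
  shows "(\<forall>C\<in>path_components_of (top_of_tilings \<Omega>). H ` C \<subseteq> C) \<longleftrightarrow> (\<forall>S\<in>\<Omega>. \<exists>s. H S = translate s S)"
proof -
  have comp: "path_components_of (top_of_tilings \<Omega>) = (\<lambda>S. {S'. \<exists>s. S' = translate s S}) ` \<Omega>"
    unfolding path_components_of_def hull_topspace by (intro image_cong) (auto simp: path_component_hull)
  show ?thesis
  proof
    assume L: "\<forall>C\<in>path_components_of (top_of_tilings \<Omega>). H ` C \<subseteq> C"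
    show "\<forall>S\<in>\<Omega>. \<exists>s. H S = translate s S"
    proof
      fix S assume "S \<in> \<Omega>"
      then have "H ` {S'. \<exists>s. S' = translate s S} \<subseteq> {S'. \<exists>s. S' = translate s S}"
        by (rule L[unfolded comp, THEN bspec, OF imageI])
      moreover have "S \<in> {S'. \<exists>s. S' = translate s S}" by (intro CollectI exI[of _ 0]) simp
      ultimately have "H S \<in> {S'. \<exists>s. S' = translate s S}" by blast
      then show "\<exists>s. H S = translate s S" by (rule CollectD)
    qed
  next
    assume R: "\<forall>S\<in>\<Omega>. \<exists>s. H S = translate s S"
    show "\<forall>C\<in>path_components_of (top_of_tilings \<Omega>). H ` C \<subseteq> C"
      unfolding comp
    proof (intro ballI, elim imageE, intro subsetI, elim imageE)
      fix C S x y assume *: "S \<in> \<Omega>" "C = {S'. \<exists>s. S' = translate s S}" "x = H y" "y \<in> C"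
      from *(4) obtain s where s: "y = translate s S" unfolding *(2) by (elim CollectE exE)
      then have "y \<in> \<Omega>" using *(1) by simp
      then obtain s' where "H y = translate s' y" using R by blast
      then have "x = translate (s' + s) S" by (simp add: *(3) s)
      then show "x \<in> C" unfolding *(2) by (intro CollectI exI)
    qed
  qed
qed

end

section \<open>Shape changes\<close>

lemma form_integral_eq:
  assumes "continuous_on UNIV g" "is_d F g"
  shows "form_integral g a b = F b - F a"
  unfolding form_integral_def
proof (rule interval_integral_FTC_finite)
  show "continuous_on {min a b..max a b} g" using assms(1) continuous_on_subset by blast
  show "(F has_vector_derivative g x) (at x within {min a b..max a b})" for x
    using assms(2) unfolding is_d_def
    by (metis has_field_derivative_at_within has_real_derivative_iff_has_vector_derivative)
qed

lemma form_integral_is_d: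
  assumes g: "continuous_on UNIV g"
  shows "is_d (form_integral g 0) g"
  unfolding is_d_def
proof
  fix x :: real
  define a b where "a = min 0 x - 1" and "b = max 0 x + 1"
  have "((\<lambda>u. LBINT y=ereal 0..ereal u. g y) has_vector_derivative g x) (at x within {a..b})"
    by (rule interval_integral_FTC2) (use g continuous_on_subset in \<open>auto simp: a_def b_def\<close>)
  moreover have "at x within {a..b} = at x"
    by (rule at_within_interior) (auto simp: a_def b_def)
  ultimately show "(form_integral g 0 has_real_derivative g x) (at x)"
    unfolding has_real_derivative_iff_has_vector_derivative form_integral_def[abs_def] by (simp only:)
qed

text \<open>\<open>M\<close> is the integral of \<open>\<mu>\<close> from 0. Bijectivity of
  \<open>M\<close> and a nowhere vanishing density are assumed instead of a sign, so that increasing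
  and decreasing \<open>M\<close> are treated together.\<close>

locale shape_change =
  fixes T :: "'l tiling" and \<mu> M :: "real \<Rightarrow> real" and R :: real
  assumes T: "is_tiling T" and R: "0 < R"
    and pe: "\<And>x y. agree_on {- R..R} (translate x T) (translate y T) \<Longrightarrow> \<mu> x = \<mu> y"
    and M_deriv: "\<And>x. (M has_real_derivative \<mu> x) (at x)"
    and \<mu>_nonzero: "\<And>x. \<mu> x \<noteq> 0" and M_inj: "inj M" and M_surj: "surj M" and M_0: "M 0 = 0"
begin

definition collar_label :: "real \<Rightarrow> real \<Rightarrow> 'l tiling" where
  "collar_label a b = translate a (patch T {a - R..b + R})"

definition changed :: "'l tiling tiling" where
  "changed = {(M ` {a..b}, collar_label a b) | a b l. ({a..b}, l) \<in> T}"

lemma M_cont: "continuous_on X M"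
  by (meson DERIV_isCont M_deriv continuous_at_imp_continuous_on)

lemma image_Icc:
  assumes "a < b" obtains p q where "p < q" "M ` {a..b} = {p..q}"
proof -
  have "connected (M ` {a..b})" "compact (M ` {a..b})"
    by (auto intro: connected_continuous_image compact_continuous_image M_cont)
  then obtain p q where pq: "M ` {a..b} = {p..q}"
    using connected_compact_interval_1 by (metis cbox_interval)
  have "M a \<in> {p..q}" "M b \<in> {p..q}" "M a \<noteq> M b"
    using assms M_inj by (auto simp flip: pq simp: inj_eq)
  then have "p < q" by auto
  then show thesis using that pq by blast
qed

text \<open>The collar contains the tile itself, moved to start at 0; as only one tile starts at a
  given vertex, the label determines the length.\<close>

lemma collar_label_eqD:
  assumes t: "({a..b}, l) \<in> T" "({a'..b'}, l') \<in> T" and eq: "collar_label a b = collar_label a' b'"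
  shows "b' = a' + (b - a)" "agree_on {- R..b - a + R} (translate a T) (translate a' T)"
proof -
  have ab: "a < b" "a' < b'" using tile_nondegenerate[OF T] t by auto
  have "({a..b}, l) \<in> patch T {a - R..b + R}" using t(1) ab(1) R by (auto simp: patch_def)
  then have "({0..b - a}, l) \<in> collar_label a b" by (simp add: collar_label_def in_translate_iff)
  then have "({0..b - a}, l) \<in> translate a' (patch T {a' - R..b' + R})"
    by (simp only: eq) (simp only: collar_label_def)
  then have "({a'..b - a + a'}, l) \<in> T" by (simp add: in_translate_iff patch_def)
  then show b': "b' = a' + (b - a)" using tiles_overlap_eq[OF T t(2)] ab by force
  have "collar_label a b = patch (translate a T) {- R..b - a + R}" for a b
    by (simp add: collar_label_def patch_translate algebra_simps)
  then show "agree_on {- R..b - a + R} (translate a T) (translate a' T)"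
    using eq b' by (simp add: agree_on_def)
qed

lemma collar_label_eq_increment:
  assumes t: "({a..b}, l) \<in> T" "({a'..b'}, l') \<in> T" and eq: "collar_label a b = collar_label a' b'"
    and u: "u \<in> {0..b - a}"
  shows "agree_on {- R..R} (translate (a + u) T) (translate (a' + u) T)"
    and "M (a' + u) = M (a + u) + (M a' - M a)"
proof -
  note ag = collar_label_eqD(2)[OF t eq]
  have shift: "agree_on {- R..R} (translate (a + u) T) (translate (a' + u) T)" if "u \<in> {0..b - a}" for u
    using agree_on_translate[OF ag, of u "{- R..R}"] that by (auto simp: add.commute)
  show "agree_on {- R..R} (translate (a + u) T) (translate (a' + u) T)" by (rule shift[OF u])
  show "M (a' + u) = M (a + u) + (M a' - M a)"
    using equal_increments[OF M_deriv _ _ pe[OF shift] u] u by simp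
qed

text \<open>This is why the collar is needed: the integral of \<open>\<mu>\<close> over a tile
  depends on the surroundings out to \<open>R\<close>, and only the collared label fixes the new
  length.\<close>

lemma collar_label_eq_image:
  assumes t: "({a..b}, l) \<in> T" "({a'..b'}, l') \<in> T" and eq: "collar_label a b = collar_label a' b'"
  shows "M ` {a'..b'} = (\<lambda>v. v + (M a' - M a)) ` M ` {a..b}"
proof -
  have b': "b' = a' + (b - a)" by (rule collar_label_eqD(1)[OF t eq])
  have sh: "{c..c + w} = (\<lambda>u. c + u) ` {0..w}" for c w :: real by simp
  have "M ` {a'..b'} = (\<lambda>u. M (a' + u)) ` {0..b - a}" unfolding b' sh by (simp only: image_image)
  also have "\<dots> = (\<lambda>u. M (a + u) + (M a' - M a)) ` {0..b - a}"
    by (intro image_cong collar_label_eq_increment(2)[OF t eq]) auto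
  also have "\<dots> = (\<lambda>v. v + (M a' - M a)) ` M ` (\<lambda>u. a + u) ` {0..b - a}" by (simp only: image_image)
  also have "\<dots> = (\<lambda>v. v + (M a' - M a)) ` M ` {a..b}" using sh[of a "b - a"] by (simp del: image_add_atLeastAtMost)
  finally show ?thesis .
qed

lemma interior_image:
  assumes "M x \<in> interior (M ` I)" shows "x \<in> interior I"
proof (rule interiorI)
  show "open (M -` interior (M ` I))" by (rule open_vimage[OF open_interior M_cont])
  show "x \<in> M -` interior (M ` I)" using assms by simp
  show "M -` interior (M ` I) \<subseteq> I"
  proof
    fix y assume "y \<in> M -` interior (M ` I)"
    then have "M y \<in> M ` I" using interior_subset by blast
    then show "y \<in> I" using M_inj by (simp add: inj_image_mem_iff)
  qed
qed

lemma changedE: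
  assumes "t \<in> changed"
  obtains a b l where "t = (M ` {a..b}, collar_label a b)" "({a..b}, l) \<in> T"
  using assms unfolding changed_def by blast

lemma is_tiling_changed: "is_tiling changed"
proof (rule is_tilingI)
  fix t assume "t \<in> changed"
  then obtain a b l where "t = (M ` {a..b}, collar_label a b)" "({a..b}, l) \<in> T" by (auto simp: changed_def)
  then show "\<exists>p q. p < q \<and> fst t = {p..q}" using tile_nondegenerate[OF T] image_Icc by (metis fst_conv)
next
  obtain D where D: "finite D" "\<And>a b l. ({a..b}, l) \<in> T \<Longrightarrow> translate a (patch T {a - R..b + R}) \<subseteq> D"
    using finite_local_complexity[OF T, of R] by blast
  have "snd ` changed \<subseteq> Pow D"
  proof
    fix \<Lambda> assume "\<Lambda> \<in> snd ` changed"
    then obtain a b l where "\<Lambda> = collar_label a b" "({a..b}, l) \<in> T" by (auto simp: changed_def)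
    then show "\<Lambda> \<in> Pow D" using D(2) by (simp add: collar_label_def)
  qed
  then show "finite (snd ` changed)" using D(1) by (meson finite_Pow_iff finite_subset)
next
  fix t t' assume "t \<in> changed" "t' \<in> changed" and eq: "snd t = snd t'"
  obtain a b l where t: "t = (M ` {a..b}, collar_label a b)" "({a..b}, l) \<in> T"
    by (rule changedE[OF \<open>t \<in> changed\<close>])
  obtain a' b' l' where t': "t' = (M ` {a'..b'}, collar_label a' b')" "({a'..b'}, l') \<in> T"
    by (rule changedE[OF \<open>t' \<in> changed\<close>])
  have "collar_label a b = collar_label a' b'" using eq t(1) t'(1) by simp
  then have im: "fst t' = (\<lambda>v. v + (M a' - M a)) ` fst t"
    unfolding t(1) t'(1) fst_conv by (rule collar_label_eq_image[OF t(2) t'(2)])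
  obtain p q where "p < q" "fst t = {p..q}" using image_Icc[of a b] tile_nondegenerate[OF T t(2)] t(1) by auto
  then show "measure lebesgue (fst t) = measure lebesgue (fst t')" by (simp add: im)
next
  fix t t' assume "t \<in> changed" "t' \<in> changed" and neq: "t \<noteq> t'"
  obtain a b l where t: "t = (M ` {a..b}, collar_label a b)" "({a..b}, l) \<in> T"
    by (rule changedE[OF \<open>t \<in> changed\<close>])
  obtain a' b' l' where t': "t' = (M ` {a'..b'}, collar_label a' b')" "({a'..b'}, l') \<in> T"
    by (rule changedE[OF \<open>t' \<in> changed\<close>])
  have "({a..b}, l) \<noteq> ({a'..b'}, l')"
  proof
    assume "({a..b}, l) = ({a'..b'}, l')"
    then have "a = a'" "b = b'" using tile_nondegenerate[OF T t(2)] by (auto simp: Icc_eq_Icc)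
    then show False using neq t(1) t'(1) by simp
  qed
  then have "interior {a..b} \<inter> interior {a'..b'} = {}" using is_tiling_disjoint[OF T t(2) t'(2)] by simp
  moreover have "\<exists>x. x \<in> interior {a..b} \<inter> interior {a'..b'}" if v: "v \<in> interior (fst t) \<inter> interior (fst t')" for v
  proof -
    obtain x where x: "v = M x" using M_surj by (metis surj_def)
    have "M x \<in> interior (M ` {a..b})" "M x \<in> interior (M ` {a'..b'})"
      using v unfolding x t(1) t'(1) fst_conv by blast+
    then show ?thesis using interior_image by blast
  qed
  ultimately show "interior (fst t) \<inter> interior (fst t') = {}" by blast
next
  fix v
  obtain x where x: "v = M x" using M_surj by (metis surj_def)
  obtain a b l where "({a..b}, l) \<in> T" "a \<le> x" "x \<le> b" by (rule tiling_covers[OF T])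
  then have "(M ` {a..b}, collar_label a b) \<in> changed" "v \<in> M ` {a..b}"
    using x by (auto simp: changed_def)
  then show "v \<in> \<Union> (fst ` changed)" by force
qed

text \<open>If the changed tiling agrees near 0 with its translate by \<open>z\<close>, then \<open>x \<mapsto> M\<^sup>-\<^sup>1 (M x + z)\<close>
  has derivative \<open>\<mu> x / \<mu> (M\<^sup>-\<^sup>1 (M x + z)) = 1\<close> near 0, so \<open>T\<close> agrees near 0 with a translate
  of itself.\<close>

lemma changed_agree:
  assumes W: "\<And>x. \<bar>x\<bar> \<le> r \<Longrightarrow> \<bar>M x\<bar> \<le> W" and ag: "agree_on {- W..W} changed (translate z changed)"
    and r: "0 \<le> r"
  obtains y where "M y = z" "agree_on {- r..r} T (translate y T)"
proof -
  define G where "G x = inv M (M x + z)" for x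
  have MG: "M (G x) = M x + z" for x by (simp add: G_def M_surj surj_f_inv_f)
  have local: "agree_on {- R..R} (translate x T) (translate (G x) T)" if x: "\<bar>x\<bar> \<le> r" for x
  proof -
    obtain a b l where t: "({a..b}, l) \<in> T" "a \<le> x" "x \<le> b" "a < b" by (rule tiling_covers[OF T])
    have "M x \<in> M ` {a..b}" using t by auto
    moreover have "M x \<in> {- W..W}" using W[OF x] by (auto simp: abs_le_iff)
    moreover have "(M ` {a..b}, collar_label a b) \<in> changed" using t by (auto simp: changed_def)
    ultimately have "(M ` {a..b}, collar_label a b) \<in> translate z changed"
      using ag unfolding agree_on_iff by (metis IntI empty_iff fst_conv)
    then obtain a' b' l' where t': "({a'..b'}, l') \<in> T" "collar_label a b = collar_label a' b'"
      "(\<lambda>v. v + z) ` M ` {a..b} = M ` {a'..b'}"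
      by (auto simp: in_translate_iff tile_translate_def changed_def)
    note eq = t(1) t'(1,2)
    obtain p q where pq: "p < q" "M ` {a..b} = {p..q}" by (rule image_Icc[OF t(4)])
    have "(\<lambda>v. v + z) ` {p..q} = (\<lambda>v. v + (M a' - M a)) ` {p..q}"
      using collar_label_eq_image[OF eq] t'(3) pq(2) by simp
    \<comment> \<open>Two translates of one bounded interval coincide only for equal
      translations.\<close>
    then have z: "z = M a' - M a" using pq(1) by (simp add: Icc_eq_Icc)
    have u: "x - a \<in> {0..b - a}" using t by auto
    have "M (a' + (x - a)) = M (G x)" using collar_label_eq_increment(2)[OF eq u] z MG by simp
    then have "a' + (x - a) = G x" using M_inj by (simp add: inj_eq)
    then show ?thesis using collar_label_eq_increment(1)[OF eq u] by simp
  qed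
  have deriv: "((\<lambda>x. G x - x) has_real_derivative 0) (at x within {- r..r})" if x: "x \<in> {- r..r}" for x
  proof -
    have x': "\<bar>x\<bar> \<le> r" using x by auto
    have "isCont (inv M) (M (G x))"
      by (rule isCont_inverse_function[of 1]) (auto simp: M_inj intro: DERIV_isCont M_deriv)
    then have "isCont (inv M) (M x + z)" by (simp add: MG)
    moreover have "(M has_real_derivative \<mu> (G x)) (at (inv M (M x + z)))"
      using M_deriv[of "G x"] by (simp add: G_def)
    ultimately have "(inv M has_real_derivative inverse (\<mu> (G x))) (at (M x + z))"
      using DERIV_inverse_function[where f = M and g = "inv M" and a = "M x + z - 1" and b = "M x + z + 1"]
      by (simp add: M_surj surj_f_inv_f \<mu>_nonzero)
    moreover have "((\<lambda>x. M x + z) has_real_derivative \<mu> x) (at x)"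
      by (auto intro!: derivative_eq_intros M_deriv)
    ultimately have "(G has_real_derivative inverse (\<mu> (G x)) * \<mu> x) (at x)"
      unfolding G_def by (rule DERIV_chain2)
    moreover have "\<mu> (G x) = \<mu> x" using pe[OF local[OF x']] by simp
    ultimately have "(G has_real_derivative 1) (at x)" using \<mu>_nonzero by simp
    then have "((\<lambda>x. G x - x) has_real_derivative 1 - 1) (at x)" by (intro DERIV_diff DERIV_ident)
    then show ?thesis by (simp add: has_field_derivative_at_within)
  qed
  then obtain c where c: "\<And>x. x \<in> {- r..r} \<Longrightarrow> G x - x = c"
    using has_field_derivative_zero_constant[of "{- r..r}" "\<lambda>x. G x - x"]
    by (metis (no_types, lifting) convex_real_interval(5))
  have G: "G x = x + G 0" if "\<bar>x\<bar> \<le> r" for x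
  proof -
    have "x \<in> {- r..r}" "0 \<in> {- r..r}" using that r by auto
    from c[OF this(1)] c[OF this(2)] show ?thesis by simp
  qed
  have "agree_on {- r..r} T (translate (G 0) T)"
    unfolding agree_on_iff
  proof (intro allI impI)
    \<comment> \<open>Seen from a point \<open>x\<close> of \<open>t\<close>, the membership of
      \<open>t\<close> is decided by \<open>local\<close>, and the offset \<open>G x - x\<close> no
      longer depends on \<open>x\<close>.\<close>
    fix t :: "'l tile" assume "fst t \<inter> {- r..r} \<noteq> {}"
    then obtain x where x: "x \<in> fst t" "\<bar>x\<bar> \<le> r" by fastforce
    have "fst (tile_translate x t) \<inter> {- R..R} \<noteq> {}" using x(1) R by (force simp: tile_translate_def)
    then have "tile_translate x t \<in> translate x T \<longleftrightarrow> tile_translate x t \<in> translate x (translate (G 0) T)"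
      using local[OF x(2)] unfolding G[OF x(2)] agree_on_iff translate_translate by blast
    then show "t \<in> T \<longleftrightarrow> t \<in> translate (G 0) T" by (simp only: in_translate_iff tile_translate_uminus)
  qed
  then show thesis using that MG[of 0] M_0 by simp
qed

text \<open>Minimality is applied to the translate of the changed tiling by \<open>t\<close>: its
  integer translates come back near the changed tiling. The residual small shift \<open>s\<close>
  becomes the error in \<open>M y\<close>.\<close>

lemma unit_minimal_dense:
  assumes min: "minimal_under_unit_translation (orbit_closure changed)" and e: "0 < e"
  obtains y and n :: int where "agree_on {- r..r} T (translate y T)" "\<bar>M y - t - of_int n\<bar> < e"
proof -
  define \<Omega>' where "\<Omega>' = orbit_closure changed"
  define r' where "r' = \<bar>r\<bar>"
  have in': "translate s changed \<in> \<Omega>'" for s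
    unfolding \<Omega>'_def orbit_closure_iff[OF is_tiling_changed] using is_tiling_changed by (auto intro!: exI[of _ s])
  have "compact (M ` {- r'..r'})" by (intro compact_continuous_image M_cont) simp
  then obtain W where W: "\<forall>v\<in>M ` {- r'..r'}. \<bar>v\<bar> \<le> W"
    using compact_imp_bounded[of "M ` {- r'..r'}"] unfolding bounded_real by blast
  define W' where "W' = \<bar>W\<bar>"
  have W': "\<bar>M x\<bar> \<le> W'" if "\<bar>x\<bar> \<le> r'" for x
  proof -
    have "M x \<in> M ` {- r'..r'}" using that by (intro imageI) auto
    then show ?thesis using W by (force simp: W'_def)
  qed
  \<comment> \<open>At scale \<open>d\<close> the tilings agree out to \<open>1 / d - 1\<close>,
    which is at least \<open>W' + 1\<close>; undoing the shift, of size at most 1, leaves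
    \<open>W'\<close>.\<close>
  define d where "d = min (e / 2) (1 / (W' + 2))"
  have d: "0 < d" "d < e" using e by (auto simp: d_def W'_def)
  have dW: "d \<le> 1 / (W' + 2)" by (simp add: d_def)
  also have "1 / (W' + 2) \<le> 1" by (simp add: W'_def)
  finally have d1: "d \<le> 1" .
  have "d * (W' + 2) \<le> 1" using dW by (simp add: field_simps W'_def)
  then have "W' + 2 \<le> 1 / d" using d(1) by (simp add: field_simps)
  have "top_of_tilings \<Omega>' closure_of range (\<lambda>n::int. translate (of_int n) (translate t changed)) = \<Omega>'"
    using min in'[of t] unfolding minimal_under_unit_translation_def \<Omega>'_def by blast
  then have "changed \<in> top_of_tilings \<Omega>' closure_of range (\<lambda>n::int. translate (of_int n) (translate t changed))"
    using in'[of 0] by simp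
  then have "changed \<in> tilings.mtopology closure_of range (\<lambda>n::int. translate (of_int n) (translate t changed))"
    unfolding mtopology_tilings using closure_of_subtopology_subset by fast
  then obtain n :: int where n: "tiling_dist changed (translate (of_int n) (translate t changed)) < d"
    using d(1) unfolding tilings.metric_closure_of by auto
  obtain s where s: "\<bar>s\<bar> \<le> d"
    "agree_on {- (1 / d - 1)..1 / d - 1} (translate s changed) (translate (of_int n) (translate t changed))"
    by (rule tiling_dist_less_agree[OF n d1])
  have "agree_on {- W'..W'} changed (translate (- s) (translate (of_int n) (translate t changed)))"
    by (rule agree_on_shift_left[OF s(2)]) (use s(1) d1 \<open>W' + 2 \<le> 1 / d\<close> in auto)
  then have ag: "agree_on {- W'..W'} changed (translate (t + of_int n - s) changed)"
    by (simp add: algebra_simps)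
  show thesis
  proof (rule changed_agree[OF _ ag, of r'])
    show "\<bar>M x\<bar> \<le> W'" if "\<bar>x\<bar> \<le> r'" for x by (rule W'[OF that])
    show "0 \<le> r'" by (simp add: r'_def)
    fix y assume y: "M y = t + of_int n - s" "agree_on {- r'..r'} T (translate y T)"
    have "agree_on {- r..r} T (translate y T)" by (rule agree_on_shrink[OF y(2)]) (simp add: r'_def)
    moreover have "\<bar>M y - t - of_int n\<bar> < e" using y(1) s(1) d(2) by simp
    ultimately show thesis by (rule that)
  qed
qed

lemma shape_change_tiling_eq:
  assumes "form_integral \<mu> 0 = M"
  shows "shape_change_tiling \<mu> (collar R T) = changed"
  unfolding shape_change_tiling_def collar_def changed_def collar_label_def assms by force

end

text \<open>Applying \<open>N\<close> more iterates makes a possibly negative exponent natural;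
  strict monotonicity of the powers then allows \<open>N\<close> to be cancelled in
  inequalities.\<close>

lemma funpow_int_iterate:
  assumes f: "bij f" and j: "0 \<le> j + int N"
  shows "(f ^^ N) (int_iterate f j x) = (f ^^ nat (j + int N)) x"
proof (cases "0 \<le> j")
  case True
  then have "nat (j + int N) = N + nat j" by simp
  then show ?thesis using True by (simp add: int_iterate_def funpow_add)
next
  case False
  then have N: "N = nat (j + int N) + nat (- j)" using j by simp
  have "(f ^^ N) (int_iterate f j x) = (f ^^ nat (j + int N)) ((f ^^ nat (- j)) ((inv f ^^ nat (- j)) x))"
    using False by (subst N) (simp add: int_iterate_def funpow_add)
  then show ?thesis using fn_o_inv_fn_is_id[OF f, of "nat (- j)"] by (simp add: fun_eq_iff)
qed

lemma int_iterate_inv: "bij f \<Longrightarrow> int_iterate (inv f) n = int_iterate f (- n)"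
  by (auto simp: int_iterate_def inv_inv_eq)

lemma continuous_on_inv_strict_mono:
  fixes f :: "real \<Rightarrow> real"
  assumes "strict_mono f" "surj f" "continuous_on UNIV f"
  shows "continuous_on UNIV (inv f)"
proof -
  have inj: "inj f" by (rule strict_mono_imp_inj_on[OF assms(1)])
  have "isCont (inv f) y" for y
  proof -
    obtain x where "y = f x" using assms(2) by (metis surj_def)
    moreover have "isCont (inv f) (f x)"
      by (rule isCont_inverse_function[of 1])
        (use assms(3) in \<open>simp_all add: inj continuous_on_eq_continuous_at\<close>)
    ultimately show ?thesis by simp
  qed
  then show ?thesis by (simp add: continuous_at_imp_continuous_on)
qed

context recurrent_line
begin

text \<open>\<open>open_segment\<close> forgets the order of its ends, so the direction of
  \<open>f\<close> must be found before the rotation form can be read as \<open>order\<close>: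
  \<open>f\<close> has no fixed point, and a return to the right of 0 shows that some point moves
  right.\<close>

lemma rotation_height_positive:
  assumes f: "strict_mono f" "surj f" "continuous_on UNIV f" and fpe: "pe Rf (\<lambda>x. f x - x)"
    and M: "\<And>x. (M has_real_derivative \<mu> x) (at x)"
    and \<mu>: "pe R\<mu> \<mu>" "continuous_on UNIV \<mu>" "\<And>x. 0 < \<mu> x"
    and rot: "\<And>x1 x2 n m. rel R x1 x2 \<Longrightarrow> of_int n < M x2 - M x1 \<Longrightarrow> M x2 - M x1 < of_int m \<Longrightarrow>
      x2 \<in> open_segment (int_iterate f n x1) (int_iterate f m x1)"
    and dense: "\<And>t e R. 0 < e \<Longrightarrow> \<exists>y n::int. rel R 0 y \<and> \<bar>M y - t - of_int n\<bar> < e"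
  obtains \<kappa> where "continuous_on UNIV \<kappa>" "\<And>x. \<kappa> (f x) = \<kappa> x + 1" "weakly_pe (\<lambda>x. \<kappa> x - M x)"
proof -
  have bij: "bij f" using f(2) strict_mono_imp_inj_on[OF f(1)] by (simp add: bij_def)
  have Mmono: "M x < M y" if "x < y" for x y
    using that DERIV_pos_imp_increasing[OF that] M \<mu>(3) by blast
  \<comment> \<open>A fixed point would make both ends of the segment equal, although the trivial
    return \<open>x1 = x2 = x\<close>, with integral 0, lies strictly inside.\<close>
  have nofix: "f x \<noteq> x" for x
  proof
    assume "f x = x"
    moreover have "x \<in> open_segment (int_iterate f (- 1) x) (int_iterate f 1 x)" by (rule rot[OF rel_refl]) auto
    ultimately show False by (simp add: int_iterate_def open_segment_def)
  qed
  obtain L where L: "0 < L" "\<And>x a. \<exists>y. a \<le> y \<and> y \<le> a + L \<and> rel R x y" using recurrent by blast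
  \<comment> \<open>The integral from 0 to \<open>x2\<close> is positive, so 0 is admissible as
    lower exponent and \<open>x2\<close> lies strictly between 0 and the \<open>m\<close>-th image
    of 0. Hence this image is to the right of 0.\<close>
  obtain x2 where x2: "1 \<le> x2" "rel R 0 x2" using L(2) by blast
  define m where "m = \<lfloor>M x2 - M 0\<rfloor> + 1"
  have m: "M x2 - M 0 < of_int m" "0 < m"
    using Mmono[of 0 x2] x2(1) by (auto simp: m_def)
  have "x2 \<in> open_segment (int_iterate f 0 0) (int_iterate f m 0)"
    by (rule rot[OF x2(2)]) (use Mmono[of 0 x2] x2(1) m in auto)
  then have "x2 \<in> open_segment 0 ((f ^^ nat m) 0)" using m(2) by (simp add: int_iterate_def)
  then have fm: "0 < (f ^^ nat m) 0"
    using x2(1) by (auto simp: open_segment_eq_real_ivl split: if_splits)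
  have "\<exists>z. z < f z"
  proof (rule ccontr)
    assume "\<not> ?thesis"
    then have "f z \<le> z" for z by (simp add: not_less)
    then have "(f ^^ n) 0 \<le> 0" for n by (induction n) (auto intro: order_trans)
    then show False using fm by (simp add: not_less[symmetric])
  qed
  then obtain z where z: "z < f z" by blast
  have pos: "x < f x" for x
  proof (rule ccontr)
    assume "\<not> x < f x"
    moreover have "connected (range (\<lambda>x. f x - x))"
      by (intro connected_continuous_image continuous_intros f(3)) simp
    ultimately have "0 \<in> range (\<lambda>x. f x - x)"
      using z connectedD_interval[of "range (\<lambda>x. f x - x)" "f x - x" "f z - z" 0] by auto
    then show False using nofix by auto
  qed
  have lt: "(f ^^ p) x < (f ^^ q) x" if "p < q" for p q x
    using that by (induction q) (auto simp: less_Suc_eq intro: less_trans pos)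
  have ord: "(f ^^ n) y < (f ^^ n') y'"
    if y: "rel R 0 y" "rel R 0 y'" and le: "M y + real n < M y' + real n'" for y y' n n'
  proof -
    define j where "j = int n - int n'"
    define k where "k = \<lfloor>M y' - M y\<rfloor> + 1"
    have jk: "of_int j < M y' - M y" "M y' - M y < of_int k"
      using le by (auto simp: j_def k_def)
    then have "j < k" by linarith
    \<comment> \<open>Adding \<open>n' + \<bar>k\<bar>\<close> makes both \<open>j\<close> and
      \<open>k\<close> nonnegative, so that \<open>lt\<close> applies.\<close>
    have "(f ^^ (n' + nat \<bar>k\<bar>)) (int_iterate f j y) < (f ^^ (n' + nat \<bar>k\<bar>)) (int_iterate f k y)"
      using \<open>j < k\<close> by (subst (1 2) funpow_int_iterate[OF bij]) (auto simp: j_def intro!: lt)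
    then have "int_iterate f j y < int_iterate f k y"
      using strict_mono_less[OF strict_mono_funpow[OF f(1)]] by blast
    moreover have "y' \<in> open_segment (int_iterate f j y) (int_iterate f k y)"
      by (rule rot[OF rel_trans[OF rel_sym[OF y(1)] y(2)] jk])
    ultimately have "int_iterate f j y < y'" by (simp add: open_segment_eq_real_ivl)
    then have "(f ^^ n') (int_iterate f j y) < (f ^^ n') y'"
      using strict_mono_less[OF strict_mono_funpow[OF f(1)]] by blast
    moreover have "(f ^^ n') (int_iterate f j y) = (f ^^ n) y"
      using funpow_int_iterate[OF bij, of j n' y] by (simp add: j_def)
    ultimately show ?thesis by simp
  qed
  interpret ordered_orbit rel f M \<mu> R Rf R\<mu>
    by unfold_locales (use f fpe M \<mu> ord dense in blast)+
  show thesis by (rule that[OF continuous_height height_f weakly_pe_height])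
qed

text \<open>For negative \<open>\<mu>\<close> the map \<open>f\<close> moves points to the left, and \<open>inv f\<close> together with \<open>- M\<close>
  satisfies the hypotheses of the positive case.\<close>

lemma rotation_height:
  assumes f: "strict_mono f" "surj f" "continuous_on UNIV f" and fpe: "pe Rf (\<lambda>x. f x - x)"
    and M: "\<And>x. (M has_real_derivative \<mu> x) (at x)"
    and \<mu>: "pe R\<mu> \<mu>" "continuous_on UNIV \<mu>" and sign: "(\<forall>x. 0 < \<mu> x) \<or> (\<forall>x. \<mu> x < 0)"
    and rot: "\<And>x1 x2 n m. rel R x1 x2 \<Longrightarrow> of_int n < M x2 - M x1 \<Longrightarrow> M x2 - M x1 < of_int m \<Longrightarrow>
      x2 \<in> open_segment (int_iterate f n x1) (int_iterate f m x1)"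
    and dense: "\<And>t e R. 0 < e \<Longrightarrow> \<exists>y n::int. rel R 0 y \<and> \<bar>M y - t - of_int n\<bar> < e"
  obtains \<kappa> where "continuous_on UNIV \<kappa>" "\<And>x. \<kappa> (f x) = \<kappa> x + 1" "weakly_pe (\<lambda>x. \<kappa> x - M x)"
proof (cases "\<forall>x. 0 < \<mu> x")
  case True
  then show thesis by (intro rotation_height_positive[OF f fpe M \<mu> _ rot dense that]) auto
next
  case False
  then have neg: "\<And>x. \<mu> x < 0" using sign by blast
  have inj: "inj f" by (rule strict_mono_imp_inj_on[OF f(1)])
  have bij: "bij f" using inj f(2) by (simp add: bij_def)
  have inv: "inv f (f x) = x" "f (inv f x) = x" for x using inj f(2) by (auto simp: surj_f_inv_f)
  have "continuous_on UNIV (\<lambda>x. f x - x)" by (intro continuous_intros f(3))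
  then obtain B where B: "0 < B" "\<And>x. \<bar>f x - x\<bar> \<le> B"
    using weakly_pe_bounded[OF _ pe_weakly_pe[OF fpe]] by blast
  have mono: "strict_mono (inv f)"
    using f(1) inv(2) by (metis (no_types, lifting) strict_mono_less strict_monoI)
  \<comment> \<open>\<open>inv f x\<close> lies within \<open>B\<close> of \<open>x\<close>, and the
    pattern around it out to \<open>Rf\<close> is what determines the displacement.\<close>
  have pe': "pe (Rf + B) (\<lambda>x. inv f x - x)"
    unfolding pe_def
  proof (intro allI impI)
    fix x y assume xy: "rel (Rf + B) x y"
    define s where "s = inv f x - x"
    have "\<bar>s\<bar> \<le> B" using B(2)[of "inv f x"] by (simp add: inv s_def abs_minus_commute)
    then have "rel Rf (x + s) (y + s)" by (intro rel_shift[OF xy]) simp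
    then have "f (x + s) - (x + s) = f (y + s) - (y + s)" using fpe by (simp add: pe_def)
    then have "f (y + s) = y" by (simp add: s_def inv)
    then have "inv f y = y + s" using inv(1) by metis
    then show "inv f x - x = inv f y - y" by (simp add: s_def)
  qed
  obtain \<kappa> where \<kappa>: "continuous_on UNIV \<kappa>" "\<And>x. \<kappa> (inv f x) = \<kappa> x + 1" "weakly_pe (\<lambda>x. \<kappa> x - (- M x))"
  proof (rule rotation_height_positive[of "inv f" "Rf + B" "\<lambda>x. - M x" "\<lambda>x. - \<mu> x" R\<mu> R])
    show "surj (inv f)" using inj by (rule inj_imp_surj_inv)
    show "continuous_on UNIV (inv f)" by (rule continuous_on_inv_strict_mono[OF f])
    show "((\<lambda>x. - M x) has_real_derivative - \<mu> x) (at x)" for x by (rule DERIV_minus[OF M])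
    show "pe R\<mu> (\<lambda>x. - \<mu> x)" using \<mu>(1) by (auto simp: pe_def)
    show "continuous_on UNIV (\<lambda>x. - \<mu> x)" by (intro continuous_intros \<mu>(2))
    \<comment> \<open>The sign change of \<open>M\<close> exchanges the two bounds, and passing to
      \<open>inv f\<close> changes the sign of the exponents.\<close>
    show "x2 \<in> open_segment (int_iterate (inv f) n x1) (int_iterate (inv f) m x1)"
      if "rel R x1 x2" "of_int n < - M x2 - - M x1" "- M x2 - - M x1 < of_int m" for x1 x2 n m
      using rot[OF that(1), of "- m" "- n"] that(2,3)
      by (simp add: int_iterate_inv[OF bij] open_segment_commute)
    show "\<exists>y n::int. rel R 0 y \<and> \<bar>- M y - t - of_int n\<bar> < e" if "0 < e" for t e R
    proof -
      obtain y and n :: int where y: "rel R 0 y" "\<bar>M y - (- t) - of_int n\<bar> < e" using dense[OF \<open>0 < e\<close>] by blast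
      then have "\<bar>- M y - t - of_int (- n)\<bar> < e" by (simp add: abs_if split: if_splits)
      then show ?thesis using y(1) by blast
    qed
  qed (use mono pe' neg in auto)
  show thesis
  proof (rule that[of "\<lambda>x. - \<kappa> x"])
    show "continuous_on UNIV (\<lambda>x. - \<kappa> x)" by (intro continuous_intros \<kappa>(1))
    show "- \<kappa> (f x) = - \<kappa> x + 1" for x using \<kappa>(2)[of "f x"] by (simp add: inv)
    show "weakly_pe (\<lambda>x. - \<kappa> x - M x)" using weakly_pe_cmult[OF \<kappa>(3), of "- 1"] by simp
  qed
qed

end

section \<open>Cohomology and rotation classes\<close>

lemma sPE_const: "sPE T (\<lambda>x. c)"
  by (auto simp: sPE_def PE_radius_def intro: exI[of _ 1])

lemma sPE_add:
  assumes "sPE T \<phi>" "sPE T \<psi>" shows "sPE T (\<lambda>x. \<phi> x + \<psi> x)"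
proof -
  obtain R1 R2 where R: "0 < R1" "PE_radius T R1 \<phi>" "0 < R2" "PE_radius T R2 \<psi>"
    using assms unfolding sPE_def by blast
  have "PE_radius T (max R1 R2) (\<lambda>x. \<phi> x + \<psi> x)"
    unfolding PE_radius_def
  proof (intro conjI allI impI)
    show "continuous_on UNIV (\<lambda>x. \<phi> x + \<psi> x)"
      using R unfolding PE_radius_def by (intro continuous_on_add) auto
    fix x y assume "agree_on {- max R1 R2..max R1 R2} (translate x T) (translate y T)"
    then have "agree_on {- R1..R1} (translate x T) (translate y T)"
      "agree_on {- R2..R2} (translate x T) (translate y T)"
      by (auto intro: agree_on_shrink)
    then have "\<phi> x = \<phi> y" "\<psi> x = \<psi> y" using R(2,4) unfolding PE_radius_def by blast+
    then show "\<phi> x + \<psi> x = \<phi> y + \<psi> y" by simp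
  qed
  then show ?thesis using R(1) unfolding sPE_def by (intro exI[of _ "max R1 R2"]) simp
qed

lemma sPE_minus:
  assumes "sPE T \<phi>" shows "sPE T (\<lambda>x. - \<phi> x)"
proof -
  obtain R where R: "0 < R" "PE_radius T R \<phi>" using assms unfolding sPE_def by blast
  then have "PE_radius T R (\<lambda>x. - \<phi> x)"
    unfolding PE_radius_def by (metis continuous_on_minus)
  then show ?thesis using R(1) unfolding sPE_def by blast
qed

lemma sPE_diff: "sPE T \<phi> \<Longrightarrow> sPE T \<psi> \<Longrightarrow> sPE T (\<lambda>x. \<phi> x - \<psi> x)"
  using sPE_add[of T \<phi> "\<lambda>x. - \<psi> x"] sPE_minus[of T \<psi>] by simp

lemma wPE_add_sPE:
  assumes "wPE T \<phi>" "sPE T \<psi>" shows "wPE T (\<lambda>x. \<phi> x + \<psi> x)"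
proof -
  obtain f where f: "\<And>n. sPE T (f n)" "uniform_limit UNIV f \<phi> sequentially"
    using assms(1) unfolding wPE_def by blast
  have "uniform_limit UNIV (\<lambda>n x. f n x + \<psi> x) (\<lambda>x. \<phi> x + \<psi> x) sequentially"
    by (intro uniform_limit_add f(2) uniform_limit_const)
  then show ?thesis unfolding wPE_def using sPE_add[OF f(1) assms(2)] by (intro exI[of _ "\<lambda>n x. f n x + \<psi> x"]) simp
qed

lemma is_d_add: "is_d \<phi> f \<Longrightarrow> is_d \<psi> g \<Longrightarrow> is_d (\<lambda>x. \<phi> x + \<psi> x) (\<lambda>x. f x + g x)"
  unfolding is_d_def by (auto intro: DERIV_add)

lemma is_d_minus: "is_d \<phi> f \<Longrightarrow> is_d (\<lambda>x. - \<phi> x) (\<lambda>x. - f x)"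
  unfolding is_d_def by (auto intro: DERIV_minus)

lemma is_d_const: "is_d (\<lambda>x. c) (\<lambda>x. 0)"
  unfolding is_d_def by simp

lemma is_d_eq:
  assumes "is_d \<phi> f" "is_d \<psi> f" shows "\<phi> x - \<phi> y = \<psi> x - \<psi> y"
proof -
  have "is_d (\<lambda>x. \<phi> x + - \<psi> x) (\<lambda>x. f x + - f x)" by (intro is_d_add is_d_minus assms)
  then have "\<forall>x. ((\<lambda>x. \<phi> x + - \<psi> x) has_real_derivative 0) (at x)" by (simp add: is_d_def)
  from DERIV_isconst_all[OF this, of x y] show ?thesis by simp
qed

lemma form_class_iff:
  "h \<in> form_class T g \<longleftrightarrow> sPE T g \<and> sPE T h \<and> (\<exists>\<phi>. sPE T \<phi> \<and> is_d \<phi> (\<lambda>x. h x - g x))"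
  unfolding form_class_def cohomologous_def sPE_forms_def by simp

lemma form_class_refl: "sPE T g \<Longrightarrow> g \<in> form_class T g"
  unfolding form_class_iff using sPE_const[of T 0] is_d_const[of 0] by auto

lemma form_class_sym: "h \<in> form_class T g \<Longrightarrow> g \<in> form_class T h"
  unfolding form_class_iff using sPE_minus is_d_minus by fastforce

lemma form_class_trans:
  assumes "h \<in> form_class T g" "k \<in> form_class T h" shows "k \<in> form_class T g"
proof -
  obtain \<phi> \<psi> where "sPE T \<phi>" "is_d \<phi> (\<lambda>x. h x - g x)" "sPE T \<psi>" "is_d \<psi> (\<lambda>x. k x - h x)"
    using assms unfolding form_class_iff by blast
  then have "sPE T (\<lambda>x. \<phi> x + \<psi> x)" "is_d (\<lambda>x. \<phi> x + \<psi> x) (\<lambda>x. k x - g x)"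
    using sPE_add is_d_add[of \<phi> "\<lambda>x. h x - g x" \<psi> "\<lambda>x. k x - h x"] by simp_all
  then show ?thesis using assms unfolding form_class_iff by blast
qed

lemma form_class_eq: "h \<in> form_class T g \<Longrightarrow> form_class T h = form_class T g"
  using form_class_sym form_class_trans by blast

text \<open>Changing a representative adds a strongly pattern equivariant primitive, which
  \<open>wPE\<close> absorbs; so membership of the class becomes a condition on a primitive of the
  single form \<open>\<mu>\<close>.\<close>

lemma in_dx_plus_AN_iff:
  assumes \<mu>: "sPE T \<mu>"
  shows "form_class T \<mu> \<in> subspace_sum (dx_line T) (H1_AN T) \<longleftrightarrow>
    (\<exists>c \<psi>. wPE T \<psi> \<and> is_d \<psi> (\<lambda>x. \<mu> x - c))"
proof
  assume "form_class T \<mu> \<in> subspace_sum (dx_line T) (H1_AN T)"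
  then obtain c A where A: "A \<in> H1_AN T" and eq: "form_class T \<mu> = class_add (form_class T (\<lambda>x. c)) A"
    unfolding subspace_sum_def dx_line_def by blast
  obtain \<alpha> g where \<alpha>: "A \<in> H1 T" "\<alpha> \<in> A" "wPE T g" "is_d g \<alpha>" using A unfolding H1_AN_def by blast
  obtain a0 where a0: "A = form_class T a0" using \<alpha>(1) unfolding H1_def form_class_def quotient_def by blast
  have "\<mu> \<in> class_add (form_class T (\<lambda>x. c)) A" using form_class_refl[OF \<mu>] eq by simp
  then obtain a b where ab: "\<mu> = (\<lambda>x. a x + b x)" "a \<in> form_class T (\<lambda>x. c)" "b \<in> form_class T a0"
    unfolding class_add_def a0 by blast
  have "b \<in> form_class T \<alpha>" using ab(3) \<alpha>(2) form_class_eq unfolding a0 by blast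
  then obtain \<phi> where \<phi>: "sPE T \<phi>" "is_d \<phi> (\<lambda>x. b x - \<alpha> x)" unfolding form_class_iff by blast
  obtain \<phi>' where \<phi>': "sPE T \<phi>'" "is_d \<phi>' (\<lambda>x. a x - c)" using ab(2) unfolding form_class_iff by blast
  have "wPE T (\<lambda>x. g x + \<phi> x + \<phi>' x)" by (intro wPE_add_sPE \<alpha>(3) \<phi>(1) \<phi>'(1))
  moreover have "is_d (\<lambda>x. g x + \<phi> x + \<phi>' x) (\<lambda>x. \<alpha> x + (b x - \<alpha> x) + (a x - c))"
    by (intro is_d_add \<alpha>(4) \<phi>(2) \<phi>'(2))
  then have "is_d (\<lambda>x. g x + \<phi> x + \<phi>' x) (\<lambda>x. \<mu> x - c)" by (simp add: ab(1) algebra_simps)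
  ultimately show "\<exists>c \<psi>. wPE T \<psi> \<and> is_d \<psi> (\<lambda>x. \<mu> x - c)" by blast
next
  assume "\<exists>c \<psi>. wPE T \<psi> \<and> is_d \<psi> (\<lambda>x. \<mu> x - c)"
  then obtain c \<psi> where \<psi>: "wPE T \<psi>" "is_d \<psi> (\<lambda>x. \<mu> x - c)" by blast
  define A where "A = form_class T (\<lambda>x. \<mu> x - c)"
  have s: "sPE T (\<lambda>x. \<mu> x - c)" by (intro sPE_diff \<mu> sPE_const)
  then have "A \<in> H1 T" unfolding A_def H1_def form_class_def sPE_forms_def by (intro quotientI) simp
  moreover have "(\<lambda>x. \<mu> x - c) \<in> A" unfolding A_def by (rule form_class_refl[OF s])
  ultimately have "A \<in> H1_AN T" using \<psi> unfolding H1_AN_def by blast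
  moreover have "form_class T \<mu> = class_add (form_class T (\<lambda>x. c)) A"
  proof (intro equalityI subsetI)
    fix h assume h: "h \<in> form_class T \<mu>"
    then have "sPE T (\<lambda>x. h x - c)" by (intro sPE_diff sPE_const) (simp add: form_class_iff)
    moreover have "(\<lambda>x. (h x - c) - (\<mu> x - c)) = (\<lambda>x. h x - \<mu> x)" by simp
    ultimately have "(\<lambda>x. h x - c) \<in> A" using h s unfolding A_def form_class_iff by simp
    moreover have "(\<lambda>x. c) \<in> form_class T (\<lambda>x. c)" by (rule form_class_refl[OF sPE_const])
    ultimately show "h \<in> class_add (form_class T (\<lambda>x. c)) A" unfolding class_add_def
      by (intro CollectI exI[of _ "\<lambda>x. c"] exI[of _ "\<lambda>x. h x - c"]) auto
  next
    fix h assume "h \<in> class_add (form_class T (\<lambda>x. c)) A"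
    then obtain a b where ab: "h = (\<lambda>x. a x + b x)" "a \<in> form_class T (\<lambda>x. c)" "b \<in> A"
      unfolding class_add_def by blast
    obtain \<phi> \<phi>' where \<phi>: "sPE T \<phi>" "is_d \<phi> (\<lambda>x. a x - c)" "sPE T \<phi>'" "is_d \<phi>' (\<lambda>x. b x - (\<mu> x - c))"
      using ab(2,3) unfolding A_def form_class_iff by blast
    have "is_d (\<lambda>x. \<phi> x + \<phi>' x) (\<lambda>x. (a x - c) + (b x - (\<mu> x - c)))" by (intro is_d_add \<phi>)
    then have "is_d (\<lambda>x. \<phi> x + \<phi>' x) (\<lambda>x. h x - \<mu> x)" by (simp add: ab(1) algebra_simps)
    moreover have "sPE T h" unfolding ab(1) using ab(2,3) unfolding A_def form_class_iff by (intro sPE_add) auto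
    ultimately show "h \<in> form_class T \<mu>" unfolding form_class_iff using \<mu> sPE_add[OF \<phi>(1,3)] by blast
  qed
  ultimately show "form_class T \<mu> \<in> subspace_sum (dx_line T) (H1_AN T)"
    unfolding subspace_sum_def dx_line_def by blast
qed

text \<open>The integral changes by \<open>\<phi> x2 - \<phi> x1\<close>, which vanishes once the
  patterns agree out to the radius of \<open>\<phi>\<close>.\<close>

lemma rotation_form_cohomologous:
  assumes rot: "rotation_form F T \<mu>" and \<nu>: "\<nu> \<in> form_class T \<mu>"
  shows "rotation_form F T \<nu>"
proof -
  obtain \<phi> where \<phi>: "sPE T \<phi>" "is_d \<phi> (\<lambda>x. \<nu> x - \<mu> x)" and s: "sPE T \<mu>" "sPE T \<nu>"
    using \<nu> unfolding form_class_iff by blast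
  have c: "continuous_on UNIV \<mu>" "continuous_on UNIV \<nu>" using s unfolding sPE_def PE_radius_def by blast+
  obtain R1 where R1: "0 < R1" "\<And>x1 x2 n m. agree_on {- R1..R1} (translate x1 T) (translate x2 T) \<Longrightarrow>
      of_int n < form_integral \<mu> x1 x2 \<Longrightarrow> form_integral \<mu> x1 x2 < of_int m \<Longrightarrow>
      x2 \<in> open_segment (int_iterate (orbit_map F T) n x1) (int_iterate (orbit_map F T) m x1)"
    using rot unfolding rotation_form_def by blast
  obtain R2 where R2: "\<And>x y. agree_on {- R2..R2} (translate x T) (translate y T) \<Longrightarrow> \<phi> x = \<phi> y"
    using \<phi>(1) unfolding sPE_def PE_radius_def by blast
  have d: "is_d (\<lambda>x. form_integral \<mu> 0 x + \<phi> x) \<nu>"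
    using is_d_add[OF form_integral_is_d[OF c(1)] \<phi>(2)] by simp
  have eq: "form_integral \<nu> x1 x2 = form_integral \<mu> x1 x2 + (\<phi> x2 - \<phi> x1)" for x1 x2
    using form_integral_eq[OF c(2) d] form_integral_eq[OF c(1) form_integral_is_d[OF c(1)], of x1 x2] by simp
  have "x2 \<in> open_segment (int_iterate (orbit_map F T) n x1) (int_iterate (orbit_map F T) m x1)"
    if ag: "agree_on {- max R1 R2..max R1 R2} (translate x1 T) (translate x2 T)"
      and nm: "of_int n < form_integral \<nu> x1 x2" "form_integral \<nu> x1 x2 < of_int m" for x1 x2 n m
  proof -
    have "\<phi> x1 = \<phi> x2" by (rule R2[OF agree_on_shrink[OF ag]]) simp
    then show ?thesis using R1(2)[OF agree_on_shrink[OF ag]] nm eq by simp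
  qed
  then show ?thesis unfolding rotation_form_def using s(2) R1(1) by (intro conjI exI[of _ "max R1 R2"]) auto
qed

text \<open>A continuous injection of the line is strictly monotone, and a decreasing one would
  violate the bound between 0 and \<open>2 * B + 1\<close>. Surjectivity is the intermediate value
  theorem on \<open>{y - B..y + B}\<close>.\<close>

lemma bounded_displacement_homeo:
  fixes f :: "real \<Rightarrow> real"
  assumes "inj f" and f: "continuous_on UNIV f" and B: "\<And>x. \<bar>f x - x\<bar> \<le> B"
  shows "strict_mono f" "surj f"
proof -
  have B0: "0 \<le> B" using B[of 0] by linarith
  have "strict_mono f \<or> strict_antimono_on UNIV f"
    using assms(1) injective_eq_monotone_map[OF _ f] by (simp add: is_interval_univ)
  moreover have "\<not> strict_antimono_on UNIV f"
  proof
    assume "strict_antimono_on UNIV f"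
    then have "f (2 * B + 1) < f 0" using B0 by (auto simp: monotone_on_def)
    then show False using B[of 0] B[of "2 * B + 1"] by (auto simp: abs_le_iff)
  qed
  ultimately show "strict_mono f" by blast
  have "\<exists>x. f x = y" for y
  proof -
    have "f (y - B) \<le> y" "y \<le> f (y + B)" using B[of "y - B"] B[of "y + B"] by (auto simp: abs_le_iff)
    then show ?thesis using IVT'[of f "y - B" y "y + B"] B0 continuous_on_subset[OF f] by auto
  qed
  then show "surj f" by (metis surj_def)
qed

section \<open>The map on one orbit and its height function\<close>

context tiling_hull
begin

lemma orbit_map:
  assumes T: "T \<in> \<Omega>" and F: "F \<in> homeos_sPE \<Omega>"
  shows "F (translate x T) = translate (orbit_map F T x) T"
    "sPE T (\<lambda>x. orbit_map F T x - x)" "inj (orbit_map F T)"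
proof -
  obtain \<Phi> where \<Phi>: "\<And>S. S \<in> \<Omega> \<Longrightarrow> F S = translate (\<Phi> S) S" "sPE_on_space \<Omega> \<Phi>"
    using F unfolding homeos_sPE_def by blast
  have Fx: "F (translate x T) = translate (x + \<Phi> (translate x T)) T" for x
    using \<Phi>(1)[of "translate x T"] T by (simp add: add.commute)
  \<comment> \<open>Non-periodicity gives the uniqueness that \<open>THE\<close> requires.\<close>
  have eq: "orbit_map F T x = x + \<Phi> (translate x T)" for x
    unfolding orbit_map_def Fx using hull_nonperiodic[OF T] by (intro the_equality) auto
  show orb: "F (translate x T) = translate (orbit_map F T x) T" for x unfolding eq by (rule Fx)
  show "sPE T (\<lambda>x. orbit_map F T x - x)" using \<Phi>(2) T unfolding sPE_on_space_def eq by simp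
  have "homeomorphic_map (top_of_tilings \<Omega>) (top_of_tilings \<Omega>) F" using F unfolding homeos_sPE_def by blast
  then have inj: "inj_on F \<Omega>" using homeomorphic_imp_injective_map hull_topspace by metis
  show "inj (orbit_map F T)"
  proof (rule injI)
    fix x y assume "orbit_map F T x = orbit_map F T y"
    then have "F (translate x T) = F (translate y T)" by (simp add: orb)
    then have "translate x T = translate y T" using inj T by (simp add: inj_on_eq_iff)
    then show "x = y" by (rule hull_nonperiodic[OF T])
  qed
qed

lemma orbit_map_homeo:
  assumes T: "T \<in> \<Omega>" and F: "F \<in> homeos_sPE \<Omega>"
  shows "strict_mono (orbit_map F T)" "surj (orbit_map F T)" "continuous_on UNIV (orbit_map F T)"
proof -
  define rel where "rel = (\<lambda>R x y. agree_on {- R..R} (translate x T) (translate y T))"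
  interpret recurrent_line rel unfolding rel_def by (rule recurrent_line_hull[OF T])
  obtain R where "PE_radius T R (\<lambda>x. orbit_map F T x - x)" using orbit_map(2)[OF T F] unfolding sPE_def by blast
  then have pe: "pe R (\<lambda>x. orbit_map F T x - x)" and cont: "continuous_on UNIV (\<lambda>x. orbit_map F T x - x)"
    unfolding PE_radius_def pe_def by (auto simp: rel_def)
  obtain B where B: "\<And>x. \<bar>orbit_map F T x - x\<bar> \<le> B"
    using weakly_pe_bounded[OF cont pe_weakly_pe[OF pe]] by blast
  show cont': "continuous_on UNIV (orbit_map F T)"
    using continuous_on_add[OF cont continuous_on_id] by simp
  show "strict_mono (orbit_map F T)" "surj (orbit_map F T)"
    using bounded_displacement_homeo[OF orbit_map(3)[OF T F] cont' B] by blast+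
qed

text \<open>Collects on the line all that both directions use. The bound
  \<open>m * \<bar>x\<bar> \<le> \<bar>M x\<bar>\<close> serves twice: it excludes
  \<open>c = 0\<close> in one direction and makes the fundamental domain of the map bounded in the
  other.\<close>

lemma rotation_class_height:
  assumes T: "T \<in> \<Omega>" and F: "F \<in> homeos_sPE \<Omega>" and rot: "rotation_form F T \<mu>"
    and irr: "irrational_class T (form_class T \<mu>)"
  obtains \<nu> M \<kappa> m where "\<nu> \<in> form_class T \<mu>" "is_d M \<nu>" "M 0 = 0" "0 < m" "\<And>x. m * \<bar>x\<bar> \<le> \<bar>M x\<bar>"
    "continuous_on UNIV \<kappa>" "\<And>x. \<kappa> (orbit_map F T x) = \<kappa> x + 1"
    "recurrent_line.weakly_pe (\<lambda>R x y. agree_on {- R..R} (translate x T) (translate y T)) (\<lambda>x. \<kappa> x - M x)"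
proof -
  define rel where "rel = (\<lambda>R x y. agree_on {- R..R} (translate x T) (translate y T))"
  interpret recurrent_line rel unfolding rel_def by (rule recurrent_line_hull[OF T])
  obtain \<nu> R where \<nu>: "\<nu> \<in> form_class T \<mu>" "0 < R" "PE_radius T R \<nu>" "(\<forall>x. 0 < \<nu> x) \<or> (\<forall>x. \<nu> x < 0)"
    and min: "minimal_under_unit_translation (shape_change_space R \<nu> T)"
    using irr unfolding irrational_class_def by blast
  have cont: "continuous_on UNIV \<nu>" and pe: "pe R \<nu>" using \<nu>(3) unfolding PE_radius_def pe_def by (auto simp: rel_def)
  define M where "M = form_integral \<nu> 0"
  have M: "is_d M \<nu>" unfolding M_def by (rule form_integral_is_d[OF cont])
  then have Md: "(M has_real_derivative \<nu> x) (at x)" for x by (simp add: is_d_def)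
  have diff: "form_integral \<nu> a b = M b - M a" for a b by (rule form_integral_eq[OF cont M])
  have M0: "M 0 = 0" using diff[of 0 0] unfolding M_def by simp
  \<comment> \<open>The absolute value yields one lower bound on the slope for both signs.\<close>
  have "continuous_on UNIV (\<lambda>x. \<bar>\<nu> x\<bar>)" "pe R (\<lambda>x. \<bar>\<nu> x\<bar>)" "\<And>x. 0 < \<bar>\<nu> x\<bar>"
    using pe \<nu>(4) by (auto intro!: continuous_intros cont simp: pe_def) (metis order_less_irrefl)+
  then obtain m where m: "0 < m" "\<And>x. m \<le> \<bar>\<nu> x\<bar>" using pe_positive_lower_bound by blast
  have low: "m * \<bar>x - y\<bar> \<le> \<bar>M x - M y\<bar>" for x y
  proof (cases "x = y")
    case False
    have *: "m * \<bar>b - a\<bar> \<le> \<bar>M b - M a\<bar>" if "a < b" for a b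
    proof -
      obtain z where "M b - M a = (b - a) * \<nu> z" using MVT2[OF \<open>a < b\<close> Md] by blast
      then show ?thesis using m(2)[of z] that by (simp add: abs_mult mult.commute mult_left_mono)
    qed
    show ?thesis using *[of x y] *[of y x] False by (cases "x < y") (auto simp: abs_minus_commute)
  qed simp
  have inj: "inj M"
  proof (rule injI)
    fix x y assume "M x = M y"
    then have "m * \<bar>x - y\<bar> \<le> 0" using low[of x y] by simp
    then show "x = y" using m(1) by (simp add: mult_le_0_iff)
  qed
  have Mc: "continuous_on UNIV M" by (meson DERIV_isCont Md continuous_at_imp_continuous_on)
  have surj: "surj M"
  proof -
    have "\<exists>x. M x = v" for v
    proof -
      \<comment> \<open>At \<open>r\<close> and \<open>- r\<close> linear growth makes
        \<open>M\<close> at least \<open>\<bar>v\<bar>\<close> in absolute value, with opposite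
        signs, so these values enclose \<open>v\<close>.\<close>
      define r where "r = \<bar>v\<bar> / m"
      have r: "0 \<le> r" "m * r = \<bar>v\<bar>" using m(1) by (auto simp: r_def)
      have "\<bar>v\<bar> \<le> \<bar>M r\<bar>" "\<bar>v\<bar> \<le> \<bar>M (- r)\<bar>" using low[of r 0] low[of "- r" 0] r M0 by auto
      moreover have "0 \<le> M r \<and> M (- r) \<le> 0 \<or> M r \<le> 0 \<and> 0 \<le> M (- r)"
      proof (cases "\<forall>x. 0 < \<nu> x")
        case True
        then have "M a \<le> M b" if "a \<le> b" for a b
          using DERIV_nonneg_imp_nondecreasing[OF that] Md by (metis less_imp_le)
        then show ?thesis using r(1) M0 by (metis neg_le_0_iff_le)
      next
        case False
        then have "\<nu> x \<le> 0" for x using \<nu>(4) less_imp_le by blast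
        then have "M b \<le> M a" if "a \<le> b" for a b
          using DERIV_nonpos_imp_nonincreasing[OF that] Md by metis
        then show ?thesis using r(1) M0 by (metis neg_le_0_iff_le)
      qed
      ultimately have "M (- r) \<le> v \<and> v \<le> M r \<or> M r \<le> v \<and> v \<le> M (- r)" by linarith
      moreover have "- r \<le> r" using r(1) by simp
      moreover have "continuous_on {- r..r} M" using Mc continuous_on_subset by blast
      ultimately show ?thesis using IVT'[of M "- r" v r] IVT2'[of M r v "- r"] by blast
    qed
    then show ?thesis by (metis surj_def)
  qed
  have "\<And>x y. agree_on {- R..R} (translate x T) (translate y T) \<Longrightarrow> \<nu> x = \<nu> y"
    using \<nu>(3) unfolding PE_radius_def by blast
  moreover have nz: "\<nu> x \<noteq> 0" for x using \<nu>(4) by (metis less_irrefl)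
  ultimately interpret sc: shape_change T \<nu> M R
    using hull_tiling[OF T] \<nu>(2) nz Md inj surj M0 by unfold_locales auto
  have "minimal_under_unit_translation (orbit_closure sc.changed)"
    using min sc.shape_change_tiling_eq[OF M_def[symmetric]] unfolding shape_change_space_def by simp
  then have dense: "\<exists>y n::int. rel r 0 y \<and> \<bar>M y - t - of_int n\<bar> < e" if "0 < e" for t e r
    using sc.unit_minimal_dense[OF _ that] unfolding rel_def by (metis translate_0)
  obtain R0 where R0: "\<And>x1 x2 n m. rel R0 x1 x2 \<Longrightarrow> of_int n < M x2 - M x1 \<Longrightarrow> M x2 - M x1 < of_int m \<Longrightarrow>
      x2 \<in> open_segment (int_iterate (orbit_map F T) n x1) (int_iterate (orbit_map F T) m x1)"
    using rotation_form_cohomologous[OF rot \<nu>(1)] unfolding rotation_form_def diff rel_def by blast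
  obtain Rf where "PE_radius T Rf (\<lambda>x. orbit_map F T x - x)" using orbit_map(2)[OF T F] unfolding sPE_def by blast
  then have fpe: "pe Rf (\<lambda>x. orbit_map F T x - x)" unfolding PE_radius_def pe_def by (auto simp: rel_def)
  obtain \<kappa> where "continuous_on UNIV \<kappa>" "\<And>x. \<kappa> (orbit_map F T x) = \<kappa> x + 1" "weakly_pe (\<lambda>x. \<kappa> x - M x)"
    by (rule rotation_height[OF orbit_map_homeo[OF T F] fpe Md pe cont \<nu>(4) R0 dense]) auto
  then show thesis using that \<nu>(1) M M0 m(1) low[of _ 0] unfolding rel_def by simp
qed

end

section \<open>Semi-conjugacies\<close>

text \<open>Completeness in terms of exact agreement: the limit consists of the tiles that are
  eventually present, and the common label set keeps its alphabet finite.\<close>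

lemma exact_limit_tiling:
  assumes U: "\<And>n. is_tiling (U n)" "\<And>n. snd ` U n = \<Lambda>"
    and ag: "\<And>n. agree_on {- R n..R n} (U n) (U (Suc n))"
    and R: "\<And>n. R n \<le> R (Suc n)" "\<And>n. real n \<le> R n"
  obtains S where "is_tiling S" "\<And>n. agree_on {- R n..R n} S (U n)"
proof -
  define S where "S = {t. \<exists>N. \<forall>n\<ge>N. t \<in> U n}"
  have mono: "R n \<le> R m" if "n \<le> m" for n m using lift_Suc_mono_le[of R] R(1) that by blast
  have stable: "agree_on {- R n..R n} (U n) (U m)" if "n \<le> m" for n m
    using that
  proof (induction m)
    case (Suc m)
    show ?case
    proof (cases "n = Suc m")
      case False
      then have "agree_on {- R n..R n} (U n) (U m)" "agree_on {- R n..R n} (U m) (U (Suc m))"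
        using Suc agree_on_shrink[OF ag mono, of n m] by auto
      then show ?thesis by (rule agree_on_trans)
    qed simp
  qed simp
  have agS: "agree_on {- R n..R n} S (U n)" for n
    unfolding agree_on_iff
  proof (intro allI impI)
    fix t :: "real set \<times> 'a" assume t: "fst t \<inter> {- R n..R n} \<noteq> {}"
    have *: "t \<in> U m \<longleftrightarrow> t \<in> U n" if "n \<le> m" for m
      using stable[OF that] t unfolding agree_on_iff by blast
    show "t \<in> S \<longleftrightarrow> t \<in> U n"
    proof
      assume "t \<in> S"
      then obtain N where "\<And>m. N \<le> m \<Longrightarrow> t \<in> U m" unfolding S_def by blast
      then show "t \<in> U n" using *[of "max N n"] by simp
    next
      assume "t \<in> U n"
      then show "t \<in> S" unfolding S_def using * by blast
    qed
  qed
  have two: "\<exists>n. t \<in> U n \<and> t' \<in> U n" if t: "t \<in> S" "t' \<in> S" for t t'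
  proof -
    obtain N N' where "\<And>m. N \<le> m \<Longrightarrow> t \<in> U m" "\<And>m. N' \<le> m \<Longrightarrow> t' \<in> U m"
      using t unfolding S_def by blast
    then have "t \<in> U (max N N')" "t' \<in> U (max N N')" by simp_all
    then show ?thesis by blast
  qed
  have "is_tiling S"
  proof (rule is_tilingI)
    fix t assume "t \<in> S"
    then obtain n where "t \<in> U n" using two by blast
    then show "\<exists>a b. a < b \<and> fst t = {a..b}" using tile_interval[OF U(1)] by (metis fst_conv)
  next
    have "snd ` S \<subseteq> \<Lambda>" using two U(2) by blast
    moreover have "finite \<Lambda>" using is_tiling_finite_labels[OF U(1)[of 0]] U(2) by simp
    ultimately show "finite (snd ` S)" by (rule finite_subset)
  next
    fix t t' assume t: "t \<in> S" "t' \<in> S"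
    then obtain n where n: "t \<in> U n" "t' \<in> U n" using two by blast
    then show "measure lebesgue (fst t) = measure lebesgue (fst t')" if "snd t = snd t'"
      using is_tiling_lengths[OF U(1)] that by blast
    show "interior (fst t) \<inter> interior (fst t') = {}" if "t \<noteq> t'"
      by (rule is_tiling_disjoint[OF U(1) n that])
  next
    fix x :: real
    obtain n where n: "\<bar>x\<bar> \<le> real n" using real_arch_simple by blast
    obtain a b l where t: "({a..b}, l) \<in> U n" "a \<le> x" "x \<le> b" by (rule tiling_covers[OF U(1)])
    have "x \<in> {a..b} \<inter> {- R n..R n}" using t n R(2)[of n] by auto
    then have "({a..b}, l) \<in> S" using agS[of n] t(1) unfolding agree_on_iff by (metis empty_iff fst_conv)
    then show "x \<in> \<Union> (fst ` S)" using t by force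
  qed
  then show thesis using that agS by blast
qed

section \<open>Extension from an orbit to the hull\<close>

context tiling_hull
begin

text \<open>\<open>E S\<close> is the limit of \<open>\<eta>\<close> at points that see larger and
  larger patterns of \<open>S\<close>; weak pattern equivariance makes these values Cauchy. In the
  second conclusion \<open>R\<close> is uniform in \<open>S\<close>, which the continuity of the
  induced map relies on.\<close>

lemma extend_to_hull:
  assumes T: "T \<in> \<Omega>"
    and \<eta>: "recurrent_line.weakly_pe (\<lambda>R x y. agree_on {- R..R} (translate x T) (translate y T)) \<eta>"
  obtains E where "\<And>x. E (translate x T) = \<eta> x"
    "\<And>e. 0 < e \<Longrightarrow> \<exists>R. \<forall>S\<in>\<Omega>. \<forall>x. agree_on {- R..R} S (translate x T) \<longrightarrow> \<bar>E S - \<eta> x\<bar> \<le> e"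
proof -
  interpret recurrent_line "\<lambda>R x y. agree_on {- R..R} (translate x T) (translate y T)"
    by (rule recurrent_line_hull[OF T])
  define X where "X S n = (SOME x. agree_on {- real n..real n} S (translate x T))" for S n
  have X: "agree_on {- real n..real n} S (translate (X S n) T)" if "S \<in> \<Omega>" for S n
    using someI_ex[OF hull_agree[OF that T]] unfolding X_def .
  have close: "\<exists>R. \<forall>S\<in>\<Omega>. \<forall>x n. agree_on {- R..R} S (translate x T) \<longrightarrow> R \<le> real n \<longrightarrow> \<bar>\<eta> (X S n) - \<eta> x\<bar> \<le> e"
    if e: "0 < e" for e
  proof -
    obtain R where R: "\<And>x y. agree_on {- R..R} (translate x T) (translate y T) \<Longrightarrow> \<bar>\<eta> x - \<eta> y\<bar> \<le> e"
      using weakly_peD[OF \<eta> e] by blast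
    have "\<bar>\<eta> (X S n) - \<eta> x\<bar> \<le> e"
      if "S \<in> \<Omega>" "agree_on {- R..R} S (translate x T)" "R \<le> real n" for S x n
      by (rule R[OF agree_on_trans[OF agree_on_sym[OF agree_on_shrink[OF X[OF that(1)] that(3)]] that(2)]])
    then show ?thesis by blast
  qed
  define E where "E S = lim (\<lambda>n. \<eta> (X S n))" for S
  have lim: "(\<lambda>n. \<eta> (X S n)) \<longlonglongrightarrow> E S" if S: "S \<in> \<Omega>" for S
  proof -
    have "Cauchy (\<lambda>n. \<eta> (X S n))"
    proof (rule metric_CauchyI)
      fix e :: real assume "0 < e"
      then obtain R where R: "\<forall>S\<in>\<Omega>. \<forall>x n. agree_on {- R..R} S (translate x T) \<longrightarrow> R \<le> real n \<longrightarrow> \<bar>\<eta> (X S n) - \<eta> x\<bar> \<le> e / 2"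
        using close[of "e / 2"] by auto
      obtain N where N: "R \<le> real N" using real_arch_simple by blast
      have "dist (\<eta> (X S m)) (\<eta> (X S n)) < e" if "N \<le> m" "N \<le> n" for m n
      proof -
        have "R \<le> real m" "R \<le> real n" using N that by linarith+
        then have "\<bar>\<eta> (X S m) - \<eta> (X S n)\<bar> \<le> e / 2" using R S agree_on_shrink[OF X[OF S]] by blast
        then show ?thesis using \<open>0 < e\<close> by (simp add: dist_real_def)
      qed
      then show "\<exists>N. \<forall>m\<ge>N. \<forall>n\<ge>N. dist (\<eta> (X S m)) (\<eta> (X S n)) < e" by blast
    qed
    then show ?thesis unfolding E_def by (simp add: Cauchy_convergent_iff convergent_LIMSEQ_iff)
  qed
  have E: "\<exists>R. \<forall>S\<in>\<Omega>. \<forall>x. agree_on {- R..R} S (translate x T) \<longrightarrow> \<bar>E S - \<eta> x\<bar> \<le> e" if "0 < e" for e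
  proof -
    obtain R where R: "\<forall>S\<in>\<Omega>. \<forall>x n. agree_on {- R..R} S (translate x T) \<longrightarrow> R \<le> real n \<longrightarrow> \<bar>\<eta> (X S n) - \<eta> x\<bar> \<le> e"
      using close[OF \<open>0 < e\<close>] by blast
    obtain N where N: "R \<le> real N" using real_arch_simple by blast
    have "\<bar>E S - \<eta> x\<bar> \<le> e" if S: "S \<in> \<Omega>" "agree_on {- R..R} S (translate x T)" for S x
    proof (rule LIMSEQ_le_const2)
      show "(\<lambda>n. \<bar>\<eta> (X S n) - \<eta> x\<bar>) \<longlonglongrightarrow> \<bar>E S - \<eta> x\<bar>" by (intro tendsto_intros lim S(1))
      have "\<bar>\<eta> (X S n) - \<eta> x\<bar> \<le> e" if "N \<le> n" for n
        using R S N that by (meson of_nat_le_iff order_trans)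
      then show "\<exists>N. \<forall>n\<ge>N. \<bar>\<eta> (X S n) - \<eta> x\<bar> \<le> e" by blast
    qed
    then show ?thesis by blast
  qed
  moreover have "E (translate x T) = \<eta> x" for x
  proof -
    have "\<bar>E (translate x T) - \<eta> x\<bar> \<le> 0 + e" if e: "0 < e" for e
      using E[OF e] T by (metis add_0 agree_on_refl hull_translate)
    then have "\<bar>E (translate x T) - \<eta> x\<bar> \<le> 0" by (rule field_le_epsilon)
    then show ?thesis by simp
  qed
  ultimately show thesis using that by blast
qed

lemma continuous_map_displacement:
  assumes T: "T \<in> \<Omega>"
    and E: "\<And>e. 0 < e \<Longrightarrow> \<exists>R. \<forall>S\<in>\<Omega>. \<forall>x. agree_on {- R..R} S (translate x T) \<longrightarrow> \<bar>E S - \<eta> x\<bar> \<le> e"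
    and uc: "\<And>e. 0 < e \<Longrightarrow> \<exists>d>0. \<forall>x y. \<bar>x - y\<bar> \<le> d \<longrightarrow> \<bar>\<eta> x - \<eta> y\<bar> \<le> e"
  shows "continuous_map (top_of_tilings \<Omega>) (top_of_tilings \<Omega>) (\<lambda>S. translate (E S) S)"
proof (rule continuous_map_into_hull)
  fix S and d R :: real assume "S \<in> topspace (top_of_tilings \<Omega>)" and d: "0 < d"
  then have S: "S \<in> \<Omega>" using hull_topspace by blast
  \<comment> \<open>Three errors of \<open>d / 6\<close> will add up to \<open>d / 2\<close>; the
    other half of \<open>d\<close> is for the shift \<open>s\<close>.\<close>
  obtain R1 where R1: "\<And>S x. S \<in> \<Omega> \<Longrightarrow> agree_on {- R1..R1} S (translate x T) \<Longrightarrow> \<bar>E S - \<eta> x\<bar> \<le> d / 6"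
    using E[of "d / 6"] d by auto
  obtain d1 where d1: "0 < d1" "\<And>x y. \<bar>x - y\<bar> \<le> d1 \<Longrightarrow> \<bar>\<eta> x - \<eta> y\<bar> \<le> d / 6"
    using uc[of "d / 6"] d by auto
  define d' where "d' = min d1 (min (d / 2) 1)"
  have d': "0 < d'" "d' \<le> d1" "d' \<le> d / 2" "d' \<le> 1" using d d1(1) by (auto simp: d'_def)
  \<comment> \<open>Leaves radius \<open>R1\<close> after a shift by at most 1, and radius
    \<open>R\<close> after the displacement \<open>E S'\<close>, which differs from
    \<open>E S\<close> by at most \<open>d / 2\<close>.\<close>
  define K where "K = \<bar>R1\<bar> + \<bar>R\<bar> + \<bar>E S\<bar> + d + 2"
  obtain U where U: "openin (top_of_tilings \<Omega>) U" "S \<in> U"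
    "\<And>S'. S' \<in> U \<Longrightarrow> \<exists>s. \<bar>s\<bar> \<le> d' \<and> agree_on {- K..K} (translate s S) S'"
    using hull_neighbourhood[OF S d'(1), of K] by metis
  have "\<exists>s. \<bar>s\<bar> \<le> d \<and> agree_on {- R..R} (translate s (translate (E S) S)) (translate (E S') S')"
    if S': "S' \<in> U" for S'
  proof -
    have S'\<Omega>: "S' \<in> \<Omega>" using S' openin_subset[OF U(1)] hull_topspace by blast
    obtain s where s: "\<bar>s\<bar> \<le> d'" "agree_on {- K..K} (translate s S) S'" using U(3)[OF S'] by blast
    obtain x where x: "agree_on {- K..K} S (translate x T)" using hull_agree[OF S T] by blast
    have "agree_on {- R1..R1} (translate s S) (translate s (translate x T))"
      by (rule agree_on_shift[OF x]) (use s(1) d'(4) d in \<open>simp add: K_def\<close>)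
    moreover have "agree_on {- R1..R1} S' (translate s S)"
      by (rule agree_on_sym[OF agree_on_shrink[OF s(2)]]) (use d in \<open>simp add: K_def\<close>)
    ultimately have "agree_on {- R1..R1} S' (translate (s + x) T)"
      using agree_on_trans by fastforce
    then have "\<bar>E S' - \<eta> (s + x)\<bar> \<le> d / 6" by (rule R1[OF S'\<Omega>])
    moreover have "\<bar>E S - \<eta> x\<bar> \<le> d / 6"
      by (rule R1[OF S agree_on_shrink[OF x]]) (use d in \<open>simp add: K_def\<close>)
    moreover have "\<bar>\<eta> (s + x) - \<eta> x\<bar> \<le> d / 6" by (rule d1(2)) (use s(1) d'(2) in simp)
    ultimately have EE: "\<bar>E S' - E S\<bar> \<le> d / 2" by linarith
    have "R + \<bar>E S'\<bar> \<le> K" using EE d unfolding K_def by linarith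
    then have "agree_on {- R..R} (translate (E S') (translate s S)) (translate (E S') S')"
      by (rule agree_on_shift[OF s(2)])
    then have "agree_on {- R..R} (translate (E S' + s - E S) (translate (E S) S)) (translate (E S') S')"
      by simp
    moreover have "\<bar>E S' + s - E S\<bar> \<le> d" using EE s(1) d'(3) by linarith
    ultimately show ?thesis by blast
  qed
  then show "\<exists>U. openin (top_of_tilings \<Omega>) U \<and> S \<in> U \<and> (\<forall>S'\<in>U. \<exists>s. \<bar>s\<bar> \<le> d \<and>
      agree_on {- R..R} (translate s (translate (E S) S)) (translate (E S') S'))"
    using U(1,2) by blast
qed (use hull_topspace in auto)

lemma wPE_weakly_pe:
  assumes T: "T \<in> \<Omega>" and "wPE T \<psi>"
  shows "recurrent_line.weakly_pe (\<lambda>R x y. agree_on {- R..R} (translate x T) (translate y T)) \<psi>"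
proof -
  interpret recurrent_line "\<lambda>R x y. agree_on {- R..R} (translate x T) (translate y T)"
    by (rule recurrent_line_hull[OF T])
  obtain f where f: "\<And>n. sPE T (f n)" "uniform_limit UNIV f \<psi> sequentially"
    using assms(2) unfolding wPE_def by blast
  show ?thesis
    unfolding weakly_pe_def
  proof (intro allI impI)
    fix e :: real assume "0 < e"
    then have "\<forall>\<^sub>F n in sequentially. \<forall>x\<in>UNIV. dist (f n x) (\<psi> x) < e / 2"
      by (intro uniform_limitD[OF f(2)]) simp
    then obtain n where n: "\<And>x. dist (f n x) (\<psi> x) < e / 2"
      by (auto simp: eventually_sequentially)
    obtain R where R: "PE_radius T R (f n)" using f(1) unfolding sPE_def by blast
    have "\<bar>\<psi> x - \<psi> y\<bar> \<le> e" if "agree_on {- R..R} (translate x T) (translate y T)" for x y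
    proof -
      have "f n x = f n y" using R that unfolding PE_radius_def by blast
      then show ?thesis using n[of x] n[of y] unfolding dist_real_def by linarith
    qed
    then show "\<exists>R. \<forall>x y. agree_on {- R..R} (translate x T) (translate y T) \<longrightarrow> \<bar>\<psi> x - \<psi> y\<bar> \<le> e" by blast
  qed
qed

lemma semi_conjugacy_to_translation:
  assumes T: "T \<in> \<Omega>" and F: "F \<in> homeos_sPE \<Omega>"
    and M: "is_d M \<nu>" "M 0 = 0" and m: "0 < m" "\<And>x. m * \<bar>x\<bar> \<le> \<bar>M x\<bar>"
    and \<kappa>: "continuous_on UNIV \<kappa>" "\<And>x. \<kappa> (orbit_map F T x) = \<kappa> x + 1"
      "recurrent_line.weakly_pe (\<lambda>R x y. agree_on {- R..R} (translate x T) (translate y T)) (\<lambda>x. \<kappa> x - M x)"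
    and \<psi>: "wPE T \<psi>" "is_d \<psi> (\<lambda>x. \<nu> x - c)"
  shows "\<exists>\<rho> H. \<rho> \<noteq> 0 \<and> semi_conjugacy \<Omega> F \<Omega> (translate \<rho>) H \<and>
    (\<forall>C\<in>path_components_of (top_of_tilings \<Omega>). H ` C \<subseteq> C)"
proof -
  interpret recurrent_line "\<lambda>R x y. agree_on {- R..R} (translate x T) (translate y T)"
    by (rule recurrent_line_hull[OF T])
  have \<psi>pe: "weakly_pe \<psi>" by (rule wPE_weakly_pe[OF T \<psi>(1)])
  have \<psi>c: "continuous_on UNIV \<psi>"
    using \<psi>(2) unfolding is_d_def by (meson DERIV_isCont continuous_at_imp_continuous_on)
  have "is_d (\<lambda>x. - (c * x)) (\<lambda>x. - c)"
    unfolding is_d_def by (auto intro!: derivative_eq_intros)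
  then have "is_d (\<lambda>x. M x + - (c * x)) (\<lambda>x. \<nu> x + - c)" by (rule is_d_add[OF M(1)])
  then have "is_d (\<lambda>x. M x + - (c * x)) (\<lambda>x. \<nu> x - c)" by simp
  from is_d_eq[OF this \<psi>(2), of _ 0] have M\<psi>: "M x = c * x + \<psi> x - \<psi> 0" for x
    using M(2) by (simp add: algebra_simps)
  \<comment> \<open>For \<open>c = 0\<close> the function \<open>M\<close> would be bounded, against
    its linear growth.\<close>
  have c: "c \<noteq> 0"
  proof
    assume "c = 0"
    obtain B where B: "0 < B" "\<And>x. \<bar>\<psi> x\<bar> \<le> B" by (rule weakly_pe_bounded[OF \<psi>c \<psi>pe]) blast
    define x where "x = (2 * B + 1) / m"
    have "2 * B + 1 = m * \<bar>x\<bar>" using m(1) B(1) by (simp add: x_def)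
    also have "\<dots> \<le> \<bar>\<psi> x - \<psi> 0\<bar>" using m(2)[of x] M\<psi>[of x] \<open>c = 0\<close> by simp
    also have "\<dots> \<le> 2 * B" using B(2)[of x] B(2)[of 0] by linarith
    finally show False by simp
  qed
  \<comment> \<open>\<open>\<kappa> / c\<close> carries the orbit map to translation by
    \<open>1 / c\<close>, and \<open>\<eta>\<close> is its displacement; it is weakly pattern
    equivariant because \<open>\<kappa> x - M x\<close> and \<open>M x - c * x\<close> are.\<close>
  define \<eta> where "\<eta> x = \<kappa> x / c - x" for x
  have "\<eta> = (\<lambda>x. (1 / c) * (\<kappa> x - M x) + ((1 / c) * \<psi> x + - \<psi> 0 / c))"
    using c by (auto simp: \<eta>_def M\<psi> field_simps)
  moreover have "weakly_pe (\<lambda>x. - \<psi> 0 / c)" by (rule pe_weakly_pe[of 0]) (simp add: pe_def)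
  ultimately have \<eta>pe: "weakly_pe \<eta>" by (simp only:) (intro weakly_pe_add weakly_pe_cmult \<kappa>(3) \<psi>pe)
  have \<eta>c: "continuous_on UNIV \<eta>" unfolding \<eta>_def[abs_def] using c by (intro continuous_intros \<kappa>(1)) simp
  obtain E where E: "\<And>x. E (translate x T) = \<eta> x"
    "\<And>e. 0 < e \<Longrightarrow> \<exists>R. \<forall>S\<in>\<Omega>. \<forall>x. agree_on {- R..R} S (translate x T) \<longrightarrow> \<bar>E S - \<eta> x\<bar> \<le> e"
    using extend_to_hull[OF T \<eta>pe] by metis
  define H where "H S = translate (E S) S" for S
  have Hc: "continuous_map (top_of_tilings \<Omega>) (top_of_tilings \<Omega>) H"
    unfolding H_def[abs_def]
    by (rule continuous_map_displacement[OF T E(2)]) (use weakly_pe_uniformly_continuous[OF \<eta>c \<eta>pe] in metis)+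
  have Fc: "continuous_map (top_of_tilings \<Omega>) (top_of_tilings \<Omega>) F"
    using F homeomorphic_imp_continuous_map unfolding homeos_sPE_def by blast
  have orbit: "(translate (1 / c) \<circ> H) S = (H \<circ> F) S" if S: "S \<in> range (\<lambda>x. translate x T)" for S
  proof -
    obtain x where S: "S = translate x T" using S by blast
    have FS: "F S = translate (orbit_map F T x) T" unfolding S by (rule orbit_map(1)[OF T F])
    have "\<eta> (orbit_map F T x) + orbit_map F T x = 1 / c + (\<eta> x + x)"
      by (simp add: \<eta>_def \<kappa>(2) add_divide_distrib)
    then show ?thesis by (simp add: FS H_def E(1)) (simp add: S E(1) add.assoc)
  qed
  \<comment> \<open>Both sides are continuous into a Hausdorff space and agree on the dense orbit of
    \<open>T\<close>.\<close>
  have "translate (1 / c) (H S) = H (F S)" if "S \<in> \<Omega>" for S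
    using forall_in_closure_of_eq[OF hull_dense_orbit[OF that T] Hausdorff_hull
        continuous_map_compose[OF Hc continuous_map_translate] continuous_map_compose[OF Fc Hc] orbit]
    by simp
  then have "semi_conjugacy \<Omega> F \<Omega> (translate (1 / c)) H" using Hc unfolding semi_conjugacy_def by blast
  moreover have "\<forall>C\<in>path_components_of (top_of_tilings \<Omega>). H ` C \<subseteq> C"
    by (subst preserves_path_components_iff) (auto simp: H_def)
  ultimately show ?thesis using c by (intro exI[of _ "1 / c"] exI[of _ H]) simp
qed

text \<open>If tilings converging to \<open>S\<close> had displacements bounded by \<open>N\<close>,
  a subsequence of these would converge to some \<open>l\<close>, and continuity of \<open>H\<close>
  would give \<open>H S = translate l S\<close>. By non-periodicity \<open>s = l\<close>, which is
  too small.\<close>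

lemma large_displacement_open:
  assumes H: "continuous_map (top_of_tilings \<Omega>) (top_of_tilings \<Omega>) H"
    and S: "S \<in> \<Omega>" "H S = translate s S" "N < \<bar>s\<bar>"
  shows "\<exists>R. \<forall>S'\<in>\<Omega>. \<forall>s'. agree_on {- R..R} S S' \<longrightarrow> H S' = translate s' S' \<longrightarrow> N < \<bar>s'\<bar>"
proof (rule ccontr)
  assume "\<not> ?thesis"
  then have "\<forall>n::nat. \<exists>S' s'. S' \<in> \<Omega> \<and> agree_on {- real n..real n} S S' \<and> H S' = translate s' S' \<and> \<bar>s'\<bar> \<le> N"
    by (meson not_le)
  then obtain X \<sigma> where X: "\<And>n. X n \<in> \<Omega>" "\<And>n. agree_on {- real n..real n} S (X n)"
    "\<And>n. H (X n) = translate (\<sigma> n) (X n)" "\<And>n. \<bar>\<sigma> n\<bar> \<le> N" by metis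
  have "seq_compact {- N..N}" by (intro compact_imp_seq_compact) simp
  moreover have "\<forall>n. \<sigma> n \<in> {- N..N}" using X(4) by (auto simp: abs_le_iff minus_le_iff)
  ultimately obtain l r where l: "l \<in> {- N..N}" "strict_mono (r :: nat \<Rightarrow> nat)" "(\<sigma> \<circ> r) \<longlonglongrightarrow> l"
    by (rule seq_compactE)
  have r: "n \<le> r n" for n using l(2) by (rule seq_suble)
  have agr: "agree_on {- K..K} S (X (r n))" if "K \<le> real n" for K n
    by (rule agree_on_shrink[OF X(2)]) (use that r[of n] in linarith)
  have "limitin (top_of_tilings \<Omega>) (X \<circ> r) S sequentially"
    unfolding limitin_def hull_topspace
  proof (intro conjI allI impI S(1))
    fix U assume "openin (top_of_tilings \<Omega>) U \<and> S \<in> U"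
    then obtain d R where d: "0 < (d::real)"
      "\<And>S' s. S' \<in> \<Omega> \<Longrightarrow> \<bar>s\<bar> \<le> d \<Longrightarrow> agree_on {- R..R} (translate s S) S' \<Longrightarrow> S' \<in> U"
      using hull_openE by metis
    obtain n0 where n0: "R \<le> real n0" using real_arch_simple by blast
    have "(X \<circ> r) n \<in> U" if "n0 \<le> n" for n
      using d(2)[of "X (r n)" 0] d(1) X(1) agr[of R n] n0 that by simp
    then show "\<forall>\<^sub>F n in sequentially. (X \<circ> r) n \<in> U" by (auto simp: eventually_sequentially)
  qed
  from continuous_map_limit[OF H this]
  have lim1: "limitin (top_of_tilings \<Omega>) (H \<circ> (X \<circ> r)) (H S) sequentially" .
  have "limitin (top_of_tilings \<Omega>) (H \<circ> (X \<circ> r)) (translate l S) sequentially"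
    unfolding limitin_def hull_topspace
  proof (intro conjI allI impI)
    show "translate l S \<in> \<Omega>" using S(1) by simp
    fix U assume "openin (top_of_tilings \<Omega>) U \<and> translate l S \<in> U"
    then obtain d R where d: "0 < (d::real)"
      "\<And>S' s. S' \<in> \<Omega> \<Longrightarrow> \<bar>s\<bar> \<le> d \<Longrightarrow> agree_on {- R..R} (translate s (translate l S)) S' \<Longrightarrow> S' \<in> U"
      using hull_openE by metis
    have "\<forall>\<^sub>F n in sequentially. dist ((\<sigma> \<circ> r) n) l < d" using l(3) d(1) by (rule tendstoD)
    moreover have "\<forall>\<^sub>F n in sequentially. R + N \<le> real n"
      using eventually_ge_at_top[of "nat \<lceil>R + N\<rceil>"] by (rule eventually_mono) linarith
    ultimately show "\<forall>\<^sub>F n in sequentially. (H \<circ> (X \<circ> r)) n \<in> U"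
    proof eventually_elim
      case (elim n)
      define k where "k = r n"
      have "agree_on {- R..R} (translate (\<sigma> k) S) (translate (\<sigma> k) (X k))"
        unfolding k_def by (rule agree_on_shift[OF agr[OF elim(2)]]) (use X(4)[of "r n"] in simp)
      then have "agree_on {- R..R} (translate (\<sigma> k - l) (translate l S)) (H (X k))" by (simp add: X(3))
      moreover have "\<bar>\<sigma> k - l\<bar> \<le> d" using elim(1) by (simp add: k_def dist_real_def)
      moreover have "H (X k) \<in> \<Omega>" using X(1)[of k] by (simp add: X(3))
      ultimately have "H (X k) \<in> U" using d(2) by blast
      then show ?case by (simp add: k_def)
    qed
  qed
  from limitin_Hausdorff_unique[OF lim1 this _ Hausdorff_hull]
  have "translate s S = translate l S" using S(2) by simp
  then have "s = l" by (rule hull_nonperiodic[OF S(1)])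
  then show False using l(1) S(3) by auto
qed

text \<open>A Baire category argument: if the displacement were unbounded on the orbit of \<open>T\<close>, then
  by \<open>large_displacement_open\<close> nested patterns could be chosen on which it is larger than
  1, 2, 3 and so on, and at the limit tiling it would have no value.\<close>

lemma displacement_bounded:
  assumes T: "T \<in> \<Omega>" and H: "continuous_map (top_of_tilings \<Omega>) (top_of_tilings \<Omega>) H"
    and leaf: "\<And>S. S \<in> \<Omega> \<Longrightarrow> \<exists>s. H S = translate s S"
    and h: "\<And>x. H (translate x T) = translate (h x) T"
    and AB: "0 \<le> B" "\<And>x y. \<bar>(h x - x) - (h y - y)\<bar> \<le> A + B * \<bar>x - y\<bar>"
  shows "\<exists>N. \<forall>x. \<bar>h x - x\<bar> \<le> N"
proof (rule ccontr)
  assume unb: "\<not> ?thesis"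
  define P where "P n = (\<lambda>(x, R). real n \<le> R \<and> (\<forall>S\<in>\<Omega>. \<forall>s. agree_on {- R..R} (translate x T) S \<longrightarrow>
      H S = translate s S \<longrightarrow> real n < \<bar>s\<bar>))" for n :: nat
  define Q where "Q n = (\<lambda>(x, R) (x', R'). R \<le> (R'::real) \<and>
      agree_on {- R..R} (translate x T) (translate x' T))" for n :: nat
  have step: "\<exists>x' R'. P n (x', R') \<and> Q k (x, R) (x', R')" for n k x R
  proof -
    obtain L where L: "0 < L" "\<And>S S' c. S \<in> \<Omega> \<Longrightarrow> S' \<in> \<Omega> \<Longrightarrow> \<exists>y. c \<le> y \<and> y \<le> c + L \<and> agree_on {- R..R} S (translate y S')"
      using hull_minimal[of R] by blast
    \<comment> \<open>The displacement at \<open>w\<close> is so large that it still exceeds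
      \<open>n\<close> at the return \<open>x'\<close>, which is at distance at most
      \<open>L\<close> from \<open>w\<close>.\<close>
    obtain w where w: "real n + \<bar>A\<bar> + B * L < \<bar>h w - w\<bar>" using unb by (meson not_le)
    obtain x' where x': "w \<le> x'" "x' \<le> w + L" "agree_on {- R..R} (translate x T) (translate x' T)"
      using L(2)[of "translate x T" T w] T by auto
    have "B * \<bar>x' - w\<bar> \<le> B * L" using x' AB(1) by (intro mult_left_mono) auto
    then have big: "real n < \<bar>h x' - x'\<bar>" using AB(2)[of x' w] w by linarith
    have "H (translate x' T) = translate (h x' - x') (translate x' T)" by (simp add: h)
    with big have "\<exists>R. \<forall>S'\<in>\<Omega>. \<forall>s'. agree_on {- R..R} (translate x' T) S' \<longrightarrow> H S' = translate s' S' \<longrightarrow> real n < \<bar>s'\<bar>"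
      by (intro large_displacement_open[OF H, where s = "h x' - x'"]) (simp_all add: T)
    then obtain R1 where R1: "\<forall>S'\<in>\<Omega>. \<forall>s'. agree_on {- R1..R1} (translate x' T) S' \<longrightarrow> H S' = translate s' S' \<longrightarrow> real n < \<bar>s'\<bar>"
      by blast
    define R' where "R' = max R1 (max R (real n))"
    have "P n (x', R')"
      unfolding P_def using R1 agree_on_shrink[of R' "translate x' T" _ R1] by (auto simp: R'_def)
    moreover have "Q k (x, R) (x', R')" unfolding Q_def using x'(3) by (simp add: R'_def le_max_iff_disj)
    ultimately show ?thesis by blast
  qed
  have "\<exists>p. P 0 p" using step[of 0 0 0 0] by blast
  moreover have "\<exists>p'. P (Suc n) p' \<and> Q n p p'" for n p using step[of "Suc n" n "fst p" "snd p"] by auto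
  ultimately have "\<exists>p. \<forall>n. P n (p n) \<and> Q n (p n) (p (Suc n))" by (intro dependent_nat_choice) auto
  then obtain p where p: "\<And>n. P n (p n)" "\<And>n. Q n (p n) (p (Suc n))" by blast
  define x R where "x n = fst (p n)" and "R n = snd (p n)" for n
  have R: "real n \<le> R n" "R n \<le> R (Suc n)" "agree_on {- R n..R n} (translate (x n) T) (translate (x (Suc n)) T)" for n
    using p(1)[of n] p(2)[of n] by (auto simp: P_def Q_def x_def R_def split: prod.splits)
  have lab: "snd ` translate (x n) T = snd ` T" for n
    by (simp add: translate_def image_image tile_translate_def)
  have til: "is_tiling (translate (x n) T)" for n using hull_tiling[OF T] by simp
  obtain S where S: "is_tiling S" "\<And>n. agree_on {- R n..R n} S (translate (x n) T)"
    using exact_limit_tiling[of "\<lambda>n. translate (x n) T", OF til lab R(3,2,1)] by metis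
  have S\<Omega>: "S \<in> \<Omega>"
  proof (rule hull_limit[OF S(1)])
    fix K
    obtain n where "K \<le> real n" using real_arch_simple by blast
    then have "agree_on {- K..K} S (translate (x n) T)" using R(1)[of n] by (intro agree_on_shrink[OF S(2)]) linarith
    then show "\<exists>S'\<in>\<Omega>. agree_on {- K..K} S S'" using T by (meson hull_translate)
  qed
  obtain s where s: "H S = translate s S" using leaf[OF S\<Omega>] by blast
  obtain n where n: "\<bar>s\<bar> \<le> real n" using real_arch_simple by blast
  have "real n < \<bar>s\<bar>"
    using p(1)[of n] S\<Omega> s agree_on_sym[OF S(2)[of n]] by (auto simp: P_def x_def R_def split: prod.splits)
  then show False using n by simp
qed

lemma translation_semi_conjugate_imp_AN:
  assumes T: "T \<in> \<Omega>" and F: "F \<in> homeos_sPE \<Omega>"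
    and \<nu>: "sPE T \<nu>" and M: "is_d M \<nu>" and m: "0 < m" "\<And>x. m * \<bar>x\<bar> \<le> \<bar>M x\<bar>"
    and \<kappa>: "continuous_on UNIV \<kappa>" "\<And>x. \<kappa> (orbit_map F T x) = \<kappa> x + 1"
      "recurrent_line.weakly_pe (\<lambda>R x y. agree_on {- R..R} (translate x T) (translate y T)) (\<lambda>x. \<kappa> x - M x)"
    and \<rho>: "\<rho> \<noteq> 0" and H: "semi_conjugacy \<Omega> F \<Omega> (translate \<rho>) H"
    and comp: "\<forall>C\<in>path_components_of (top_of_tilings \<Omega>). H ` C \<subseteq> C"
  shows "\<exists>c \<psi>. wPE T \<psi> \<and> is_d \<psi> (\<lambda>x. \<nu> x - c)"
proof -
  define rel where "rel = (\<lambda>R x y. agree_on {- R..R} (translate x T) (translate y T))"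
  interpret recurrent_line rel unfolding rel_def by (rule recurrent_line_hull[OF T])
  define f where "f = orbit_map F T"
  have Hc: "continuous_map (top_of_tilings \<Omega>) (top_of_tilings \<Omega>) H"
    and conj: "\<And>S. S \<in> \<Omega> \<Longrightarrow> translate \<rho> (H S) = H (F S)" using H unfolding semi_conjugacy_def by auto
  have H\<Omega>: "H S \<in> \<Omega>" if "S \<in> \<Omega>" for S
    using Hc that unfolding continuous_map_def hull_topspace by blast
  have leaf: "\<exists>s. H S = translate s S" if "S \<in> \<Omega>" for S
    using comp preserves_path_components_iff[of H] H\<Omega> that by blast
  have "\<exists>y. H (translate x T) = translate y T" for x
    using leaf[of "translate x T"] T by (metis hull_translate translate_translate)
  then obtain h where h: "\<And>x. H (translate x T) = translate (h x) T" by metis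
  have hf: "h (f x) = h x + \<rho>" for x
  proof (rule hull_nonperiodic[OF T])
    have "translate \<rho> (H (translate x T)) = H (F (translate x T))" using conj T by simp
    then show "translate (h (f x)) T = translate (h x + \<rho>) T"
      by (simp add: orbit_map(1)[OF T F] h f_def add.commute)
  qed
  have path: "continuous_map (top_of_set UNIV) (top_of_tilings \<Omega>) (\<lambda>x. translate (h x) T)"
    using continuous_map_compose[OF continuous_map_orbit[OF T continuous_on_id[of UNIV]] Hc] by (simp add: o_def h)
  \<comment> \<open>The image of the orbit is a path in the hull, so it moves by small translations;
    non-periodicity identifies them with the increments of \<open>h\<close>.\<close>
  have hc: "continuous_on UNIV h"
    unfolding continuous_on_iff
  proof (intro ballI allI impI)
    fix t e :: real assume "0 < e"
    then obtain d where d: "0 < d" "\<And>t'. \<bar>t' - t\<bar> < d \<Longrightarrow> \<exists>s. \<bar>s\<bar> < e \<and> translate (h t') T = translate s (translate (h t) T)"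
      using path_locally_in_orbit[OF path is_interval_univ, of t e] by auto
    have "dist (h t') (h t) < e" if "dist t' t < d" for t'
    proof -
      obtain s where s: "\<bar>s\<bar> < e" "translate (h t') T = translate (s + h t) T"
        using d(2)[of t'] \<open>dist t' t < d\<close> unfolding dist_real_def translate_translate by blast
      have "h t' = s + h t" by (rule hull_nonperiodic[OF T s(2)])
      then show ?thesis using s(1) by (simp add: dist_real_def)
    qed
    then show "\<exists>d>0. \<forall>t'\<in>UNIV. dist t' t < d \<longrightarrow> dist (h t') (h t) < e" using d(1) by blast
  qed
  have Mc: "continuous_on UNIV M"
    using M unfolding is_d_def by (meson DERIV_isCont continuous_at_imp_continuous_on)
  have "continuous_on UNIV (\<lambda>x. \<kappa> x - M x)" by (intro continuous_intros \<kappa>(1) Mc)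
  then obtain K where K: "0 < K" "\<And>x. \<bar>\<kappa> x - M x\<bar> \<le> K"
    using weakly_pe_bounded \<kappa>(3) unfolding rel_def by blast
  have \<kappa>f: "\<kappa> (f x) = \<kappa> x + 1" for x unfolding f_def by (rule \<kappa>(2))
  \<comment> \<open>The map adds \<open>\<rho>\<close> to \<open>h\<close> and 1 to
    \<open>\<kappa>\<close>, so \<open>Q\<close> is invariant and every value of \<open>Q\<close> is
    taken at a point with \<open>\<kappa>\<close> between 0 and 1.\<close>
  define Q where "Q x = h x - \<rho> * \<kappa> x" for x
  have Qf: "Q (f x) = Q x" for x by (simp add: Q_def hf \<kappa>f algebra_simps)
  have up: "\<exists>y. Q y = Q x \<and> \<kappa> y = \<kappa> x + real n" for x n
  proof (induction n)
    case (Suc n)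
    then obtain y where "Q y = Q x" "\<kappa> y = \<kappa> x + real n" by blast
    then show ?case using Qf[of y] \<kappa>f[of y] by (intro exI[of _ "f y"]) simp
  qed auto
  have down: "\<exists>y. Q y = Q x \<and> \<kappa> y = \<kappa> x - real n" for x n
  proof (induction n)
    case (Suc n)
    then obtain y where y: "Q y = Q x" "\<kappa> y = \<kappa> x - real n" by blast
    obtain z where "y = f z" using orbit_map_homeo(2)[OF T F] unfolding f_def by (metis surj_def)
    then show ?case using y Qf[of z] \<kappa>f[of z] by (intro exI[of _ z]) simp
  qed auto
  \<comment> \<open>A point with \<open>0 \<le> \<kappa> y\<close> and
    \<open>\<kappa> y \<le> 1\<close> satisfies \<open>\<bar>M y\<bar> \<le> K + 1\<close>, hence
    lies in this interval.\<close>
  have "compact (Q ` {- ((K + 1) / m)..(K + 1) / m})"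
    unfolding Q_def[abs_def]
    by (intro compact_continuous_image continuous_intros continuous_on_subset[OF hc] continuous_on_subset[OF \<kappa>(1)]) auto
  then have "bounded (Q ` {- ((K + 1) / m)..(K + 1) / m})" by (rule compact_imp_bounded)
  then obtain C0 where "\<forall>v\<in>Q ` {- ((K + 1) / m)..(K + 1) / m}. \<bar>v\<bar> \<le> C0"
    unfolding bounded_real by blast
  then have C0: "\<bar>Q x\<bar> \<le> C0" if "x \<in> {- ((K + 1) / m)..(K + 1) / m}" for x using that by simp
  have QC: "\<bar>Q x\<bar> \<le> C0" for x
  proof -
    have "\<exists>y. Q y = Q x \<and> 0 \<le> \<kappa> y \<and> \<kappa> y \<le> 1"
    proof (cases "0 \<le> \<kappa> x")
      case True
      define n where "n = nat \<lfloor>\<kappa> x\<rfloor>"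
      have "real n \<le> \<kappa> x" "\<kappa> x \<le> real n + 1" using True by (simp_all add: n_def of_nat_floor)
      moreover obtain y where "Q y = Q x" "\<kappa> y = \<kappa> x - real n" using down by blast
      ultimately show ?thesis by (intro exI[of _ y]) simp
    next
      case False
      define n where "n = nat \<lceil>- \<kappa> x\<rceil>"
      have "- \<kappa> x \<le> real n" "real n \<le> - \<kappa> x + 1" using False by (simp_all add: n_def) linarith
      moreover obtain y where "Q y = Q x" "\<kappa> y = \<kappa> x + real n" using up by blast
      ultimately show ?thesis by (intro exI[of _ y]) simp
    qed
    then obtain y where y: "Q y = Q x" "0 \<le> \<kappa> y" "\<kappa> y \<le> 1" by blast
    have "m * \<bar>y\<bar> \<le> K + 1" using m(2)[of y] K(2)[of y] y(2,3) by linarith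
    then have "\<bar>y\<bar> \<le> (K + 1) / m" using m(1) by (simp add: field_simps)
    then show ?thesis using C0[of y] y(1) by (auto simp: abs_le_iff)
  qed
  define C where "C = C0 + \<bar>\<rho>\<bar> * K"
  have hM: "\<bar>h x - \<rho> * M x\<bar> \<le> C" for x
  proof -
    have "h x - \<rho> * M x = Q x + \<rho> * (\<kappa> x - M x)" by (simp add: Q_def algebra_simps)
    moreover have "\<bar>\<rho> * (\<kappa> x - M x)\<bar> \<le> \<bar>\<rho>\<bar> * K" unfolding abs_mult by (intro mult_left_mono K(2)) simp
    ultimately show ?thesis using QC[of x] unfolding C_def by linarith
  qed
  obtain R where R: "0 < R" "PE_radius T R \<nu>" using \<nu> unfolding sPE_def by blast
  have \<nu>pe: "pe R \<nu>" and \<nu>c: "continuous_on UNIV \<nu>" using R(2) unfolding PE_radius_def pe_def by (auto simp: rel_def)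
  obtain B where B: "0 < B" "\<And>x. \<bar>\<nu> x\<bar> \<le> B" using weakly_pe_bounded[OF \<nu>c pe_weakly_pe[OF \<nu>pe]] by blast
  have lip: "\<bar>M x - M y\<bar> \<le> B * \<bar>x - y\<bar>" for x y
    using field_differentiable_bound[of UNIV M \<nu> B x y] M B(2) by (simp add: is_d_def has_field_derivative_at_within)
  have "\<bar>(h x - x) - (h y - y)\<bar> \<le> 2 * C + (\<bar>\<rho>\<bar> * B + 1) * \<bar>x - y\<bar>" for x y
  proof -
    have "\<bar>\<rho> * (M x - M y)\<bar> \<le> \<bar>\<rho>\<bar> * (B * \<bar>x - y\<bar>)" unfolding abs_mult by (intro mult_left_mono lip) simp
    moreover have "(h x - x) - (h y - y) = (h x - \<rho> * M x) - (h y - \<rho> * M y) + \<rho> * (M x - M y) - (x - y)"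
      by (simp add: algebra_simps)
    ultimately show ?thesis using hM[of x] hM[of y] by (simp add: algebra_simps abs_le_iff) linarith
  qed
  then obtain N where N: "\<And>x. \<bar>h x - x\<bar> \<le> N"
    using displacement_bounded[OF T Hc leaf h, of "\<bar>\<rho>\<bar> * B + 1" "2 * C"] B(1) by auto
  \<comment> \<open>\<open>\<rho> * g x\<close> is the sum of \<open>\<rho> * M x - h x\<close> and
    \<open>h x - x\<close>, both bounded.\<close>
  define g where "g x = M x - x / \<rho>" for x
  have g: "is_d g (\<lambda>x. \<nu> x - 1 / \<rho>)"
    using M \<rho> unfolding is_d_def g_def[abs_def] by (auto intro!: derivative_eq_intros)
  have "\<bar>g x\<bar> \<le> (C + N) / \<bar>\<rho>\<bar>" for x
  proof -
    have "\<bar>\<rho> * g x\<bar> \<le> C + N" using hM[of x] N[of x] \<rho> by (simp add: g_def right_diff_distrib)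
    then show ?thesis using \<rho> by (simp add: abs_mult field_simps)
  qed
  moreover have "pe R (\<lambda>x. \<nu> x - 1 / \<rho>)" using \<nu>pe by (simp add: pe_def)
  moreover have "\<bar>\<nu> x - 1 / \<rho>\<bar> \<le> B + \<bar>1 / \<rho>\<bar>" for x using B(2)[of x] by linarith
  ultimately obtain G where G: "\<And>n. continuous_on UNIV (G n)" "\<And>n. pe (R + real n) (G n)" "uniform_limit UNIV G g sequentially"
    using bounded_primitive_weakly_pe[of g "\<lambda>x. \<nu> x - 1 / \<rho>" R] g unfolding is_d_def by metis
  have "sPE T (G n)" for n
    unfolding sPE_def PE_radius_def using G(1,2)[of n] R(1) unfolding pe_def
    by (intro exI[of _ "R + real n"]) (simp add: rel_def)
  then have "wPE T g" unfolding wPE_def using G(3) by blast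
  then show ?thesis using g by blast
qed

end

theorem theorem5:
  fixes \<Omega> :: "'l tiling set" and F :: "'l tiling \<Rightarrow> 'l tiling"
    and T :: "'l tiling" and \<mu> :: "real \<Rightarrow> real"
  assumes "tiling_space \<Omega>" and "uniquely_ergodic \<Omega>"
    and "F \<in> homeos_sPE \<Omega>"
    and "T \<in> \<Omega>" and "rotation_form F T \<mu>"
    and "irrational_class T (form_class T \<mu>)"
  shows "(\<exists>\<rho> H. \<rho> \<noteq> 0 \<and> semi_conjugacy \<Omega> F \<Omega> (translate \<rho>) H \<and>
            (\<forall>C \<in> path_components_of (top_of_tilings \<Omega>). H ` C \<subseteq> C))
         \<longleftrightarrow> form_class T \<mu> \<in> subspace_sum (dx_line T) (H1_AN T)"
proof -
  interpret tiling_hull \<Omega> using assms(1) by unfold_locales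
  note T = assms(4) and F = assms(3)
  obtain \<nu> M \<kappa> m where \<nu>: "\<nu> \<in> form_class T \<mu>" and M: "is_d M \<nu>" "M 0 = 0" and m: "0 < m" "\<And>x. m * \<bar>x\<bar> \<le> \<bar>M x\<bar>"
    and \<kappa>: "continuous_on UNIV \<kappa>" "\<And>x. \<kappa> (orbit_map F T x) = \<kappa> x + 1"
    "recurrent_line.weakly_pe (\<lambda>R x y. agree_on {- R..R} (translate x T) (translate y T)) (\<lambda>x. \<kappa> x - M x)"
    by (rule rotation_class_height[OF T F assms(5,6)]) blast
  have s\<nu>: "sPE T \<nu>" using \<nu> unfolding form_class_iff by blast
  \<comment> \<open>The height function belongs to the representative \<open>\<nu>\<close> of
    definite sign, so the criterion is applied to \<open>\<nu>\<close>; the class is the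
    same.\<close>
  have AN: "form_class T \<mu> \<in> subspace_sum (dx_line T) (H1_AN T) \<longleftrightarrow> (\<exists>c \<psi>. wPE T \<psi> \<and> is_d \<psi> (\<lambda>x. \<nu> x - c))"
    unfolding form_class_eq[OF \<nu>, symmetric] by (rule in_dx_plus_AN_iff[OF s\<nu>])
  show ?thesis
    unfolding AN
  proof (rule iffI; elim exE conjE)
    fix \<rho> H assume "\<rho> \<noteq> 0" "semi_conjugacy \<Omega> F \<Omega> (translate \<rho>) H"
      "\<forall>C\<in>path_components_of (top_of_tilings \<Omega>). H ` C \<subseteq> C"
    then show "\<exists>c \<psi>. wPE T \<psi> \<and> is_d \<psi> (\<lambda>x. \<nu> x - c)"
      by (rule translation_semi_conjugate_imp_AN[OF T F s\<nu> M(1) m \<kappa>])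
  next
    fix c \<psi> assume "wPE T \<psi>" "is_d \<psi> (\<lambda>x. \<nu> x - c)"
    then show "\<exists>\<rho> H. \<rho> \<noteq> 0 \<and> semi_conjugacy \<Omega> F \<Omega> (translate \<rho>) H \<and>
        (\<forall>C\<in>path_components_of (top_of_tilings \<Omega>). H ` C \<subseteq> C)"
      by (rule semi_conjugacy_to_translation[OF T F M m \<kappa>])
  qed
qed

end
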